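(* Let $T\in L(H)^d$ be a pure $K$-contraction on a complex Hilbert space $H$, let $j\colon H\to H_K(\mathscr{D})$ be its canonical $K$-dilation, let $M=H_K(\mathscr{D})\ominus\operatorname{Im}j$ and let $W(M)=M\ominus\big(\sum_{i=1}^dM_{z_i}M\big)$. Let $W_T\colon\mathbb{B}_d\to L(\tilde{\mathscr{D}},\mathscr{D})$ be the analytic operator-valued function $$W_T(z)x=-\tilde Tx+CF(ZT^* )Z(\oplus I_T^{-1})D_{\tilde T}x\qquad(z\in\mathbb{B}_d,\ x\in\tilde{\mathscr{D}}).$$ Then $$W(M)=\{W_Tx;\ x\in\tilde{\mathscr{D}}\}$$ and $\|W_Tx\|=\|x\|$ for all $x\in\tilde{\mathscr{D}}$, where $W_Tx$ denotes the function $(W_Tx)(z)=W_T(z)x$, its norm is that of $H_K(\mathscr{D})$, and $\tilde{\mathscr{D}}$ carries the norm of $\tilde H^d$.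
   Context: Kernel and function spaces. Let $d\ge 1$, let $\mathbb{B}_d$ be the open Euclidean unit ball of $\mathbb{C}^d$ and $\mathbb{D}$ the open unit disc. Let $k\colon\mathbb{D}\to\mathbb{C}$, $k(z)=\sum_{n=0}^\infty a_nz^n$, be an analytic function without zeros such that $a_0=1$, $a_n>0$ for all $n$ and $0<\inf_n \frac{a_n}{a_{n+1}}\le\sup_n\frac{a_n}{a_{n+1}}<\infty$. Assume moreover that the limit $r=\lim_{n\to\infty}\frac{a_n}{a_{n+1}}$ exists (then $r\in[1,\infty)$ is the radius of convergence of $\sum a_nz^n$). Write $\frac1k(z)=\sum_{n=0}^\infty c_nz^n$ on $\mathbb{D}$ and $K(z,w)=k(\langle z,w\rangle)$ for $z,w\in\mathbb{B}_d$. Set $\gamma_\alpha=|\alpha|!/\alpha!$ for $\alpha\in\mathbb{N}^d$ ($0\in\mathbb N$). For a complex Hilbert space $\mathscr{E}$, $H_K(\mathscr{E})$ is the $\mathscr{E}$-valued functional Hilbert space on $\mathbb{B}_d$ with reproducing kernel $(z,w)\mapsto K(z,w)1_{\mathscr{E}}$; it consists of all $f=\sum_{\alpha\in\mathbb{N}^d}f_\alpha z^\alpha$ ($f_\alpha\in\mathscr{E}$) with $\|f\|^2=\sum_\alpha\frac{\|f_\alpha\|^2}{a_{|\alpha|}\gamma_\alpha}<\infty$. $M_z=(M_{z_1},\dots,M_{z_d})$ is the (bounded) tuple of multiplications by the coordinate functions on $H_K(\mathscr{E})$; it is also regarded as the row operator $M_z\colon H_K(\mathscr{E})^d\to H_K(\mathscr{E})$,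 $(f_i)\mapsto\sum_i z_if_i$, with adjoint the column operator $M_z^*f=(M_{z_i}^*f)_{i=1}^d$. $L(H,G)$ denotes the bounded linear operators from $H$ to $G$. $K$-contractions. For a commuting tuple $T=(T_1,\dots,T_d)\in L(H)^d$ let $\sigma_T(X)=\sum_{i=1}^dT_iXT_i^*$. $T$ is a $K$-contraction if the limit $\frac1K(T)=\text{SOT-}\sum_{n=0}^\infty c_n\sigma_T^n(1_H)$ exists and is a positive operator. It is pure if $\text{SOT-}\lim_{N\to\infty}\big(1_H-\sum_{n=0}^Na_n\sigma_T^n(\frac1K(T))\big)=0$. For a pure $K$-contraction put $C=(\frac1K(T))^{1/2}$ and $\mathscr{D}=\overline{\operatorname{Im}C}$. The canonical $K$-dilation of $T$ is the map $j\colon H\to H_K(\mathscr{D})$, $j(h)=\sum_\alpha a_{|\alpha|}\gamma_\alpha(CT^{*\alpha}h)z^\alpha$, which is a well-defined isometry with $jT_i^*=M_{z_i}^*j$ for $i=1,\dots,d$. $T^*\colon H\to H^d$ also denotes the column operator $x\mapsto(T_i^*x)_{i=1}^d$. $\oplus X$ denotes the $d$-fold direct sum of an operator $X$ acting componentwise on $d$-tuples. The space $\tilde H$ and related operators. On $H_K(\mathscr{D})$ let $\Delta\big(\sum_{n}\sum_{|\alpha|=n}f_\alpha z^\alpha\big)=\sum_{n=0}^\infty\frac{a_{n+1}}{a_n}\sum_{|\alpha|=n}f_\alpha z^\alpha$, and put $\Delta_T=j^*\Delta j\in L(H)$, an invertible positive operator. $\tilde H$ is the space $H$ with the (equivalent)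 scalar product $(x,y)=\langle\Delta_Tx,y\rangle$, and $I_T\colon H\to\tilde H$, $x\mapsto x$; thus $I_T^*x=\Delta_Tx$ for $x\in\tilde H$. $\tilde T\colon\tilde H^d\to H$ is the row operator with components $\tilde T_i=T_iI_T^*$, i.e. $\tilde T(x_i)_{i=1}^d=\sum_iT_i\Delta_Tx_i$; it is a contraction. Put $D_{\tilde T}=(1_{\tilde H^d}-\tilde T^*\tilde T)^{1/2}\in L(\tilde H^d)$, $\mathscr{D}_{\tilde T}=\overline{D_{\tilde T}\tilde H^d}\subset\tilde H^d$ and $$\tilde{\mathscr{D}}=\{y\in\mathscr{D}_{\tilde T};\ (\oplus jI_T^{-1})D_{\tilde T}y\in M_z^*H_K(\mathscr{D})\},$$ a closed subspace of $\tilde H^d$ equipped with the norm of $\tilde H^d$. For $y\in\tilde{\mathscr{D}}$ one has $\tilde Ty\in\mathscr{D}$. The function $F(ZT^* )$. Let $F(z)=\sum_{n=0}^\infty a_{n+1}z^n$ on the disc $D_r(0)$. For $z\in\mathbb{B}_d$ let $Z\colon H^d\to H$, $(h_i)\mapsto\sum_iz_ih_i$. Then $ZT^*=\sum_iz_iT_i^*\in L(H)$ has spectrum in $D_r(0)$ and $F(ZT^* )=\sum_{n=0}^\infty a_{n+1}\sum_{|\alpha|=n}\gamma_\alpha T^{*\alpha}z^\alpha\in L(H)$. *)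

theory Defs
  imports "HOL-Analysis.Analysis"
begin

section \<open>Complex Hilbert spaces\<close>

text \<open>The complex inner product is linear in its first argument; its real part is the real inner
  product of \<^class>\<open>real_inner\<close>, so norm and topology are the inherited ones.\<close>

class complex_hilbert_space = real_inner + banach +
  fixes scaleC :: "complex \<Rightarrow> 'a \<Rightarrow> 'a"  (infixr "*\<^sub>C" 75)
    and cinner :: "'a \<Rightarrow> 'a \<Rightarrow> complex"
  assumes scaleC_add_right: "c *\<^sub>C (x + y) = c *\<^sub>C x + c *\<^sub>C y"
    and scaleC_add_left: "(b + c) *\<^sub>C x = b *\<^sub>C x + c *\<^sub>C x"
    and scaleC_scaleC: "b *\<^sub>C c *\<^sub>C x = (b * c) *\<^sub>C x"
    and scaleC_of_real: "complex_of_real t *\<^sub>C x = t *\<^sub>R x"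
    and cinner_commute: "cinner x y = cnj (cinner y x)"
    and cinner_add_left: "cinner (x + y) z = cinner x z + cinner y z"
    and cinner_scaleC_left: "cinner (c *\<^sub>C x) y = c * cinner x y"
    and inner_eq_Re_cinner: "inner x y = Re (cinner x y)"

instantiation complex :: complex_hilbert_space
begin

definition scaleC_complex :: "complex \<Rightarrow> complex \<Rightarrow> complex"
  where "scaleC_complex c x = c * x"

definition cinner_complex :: "complex \<Rightarrow> complex \<Rightarrow> complex"
  where "cinner_complex x y = x * cnj y"

instance
  by standard
    (simp_all add: scaleC_complex_def cinner_complex_def algebra_simps scaleR_conv_of_real
      inner_complex_def)

end

instantiation vec :: (complex_hilbert_space, finite) complex_hilbert_space
begin

definition scaleC_vec :: "complex \<Rightarrow> 'a ^ 'b \<Rightarrow> 'a ^ 'b"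
  where "scaleC_vec c x = (\<chi> i. c *\<^sub>C x $ i)"

definition cinner_vec :: "'a ^ 'b \<Rightarrow> 'a ^ 'b \<Rightarrow> complex"
  where "cinner_vec x y = (\<Sum>i\<in>UNIV. cinner (x $ i) (y $ i))"

instance
proof
  fix b c :: complex and t :: real and x y z :: "'a ^ 'b"
  show "c *\<^sub>C (x + y) = c *\<^sub>C x + c *\<^sub>C y"
    by (simp add: scaleC_vec_def vec_eq_iff scaleC_add_right)
  show "(b + c) *\<^sub>C x = b *\<^sub>C x + c *\<^sub>C x"
    by (simp add: scaleC_vec_def vec_eq_iff scaleC_add_left)
  show "b *\<^sub>C c *\<^sub>C x = (b * c) *\<^sub>C x"
    by (simp add: scaleC_vec_def vec_eq_iff scaleC_scaleC)
  show "complex_of_real t *\<^sub>C x = t *\<^sub>R x"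
    by (simp add: scaleC_vec_def vec_eq_iff scaleC_of_real)
  show "cinner x y = cnj (cinner y x)"
    unfolding cinner_vec_def cnj_sum by (rule sum.cong[OF refl], rule cinner_commute)
  show "cinner (x + y) z = cinner x z + cinner y z"
    by (simp add: cinner_vec_def cinner_add_left sum.distrib)
  show "cinner (c *\<^sub>C x) y = c * cinner x y"
    by (simp add: cinner_vec_def scaleC_vec_def cinner_scaleC_left sum_distrib_left)
  show "inner x y = Re (cinner x y)"
    by (simp add: cinner_vec_def inner_vec_def inner_eq_Re_cinner Re_sum)
qed

end

definition bounded_clinear ::
    "('a::complex_hilbert_space \<Rightarrow> 'b::complex_hilbert_space) \<Rightarrow> bool"
  where "bounded_clinear A \<longleftrightarrow> bounded_linear A \<and> (\<forall>c x. A (c *\<^sub>C x) = c *\<^sub>C A x)"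


section \<open>Adjoints, positivity and orthogonal differences relative to a scalar product\<close>

text \<open>Several scalar products on one carrier are in play, so the scalar products are arguments.
  \<open>hadj S p q A\<close> is the adjoint of \<open>A\<close> from the Hilbert space with carrier \<open>S\<close> and scalar
  product \<open>p\<close> to a Hilbert space with scalar product \<open>q\<close>; by the Riesz theorem the described
  element exists uniquely when \<open>A\<close> is bounded.\<close>

definition hadj :: "'a set \<Rightarrow> ('a \<Rightarrow> 'a \<Rightarrow> complex) \<Rightarrow> ('b \<Rightarrow> 'b \<Rightarrow> complex) \<Rightarrow> ('a \<Rightarrow> 'b) \<Rightarrow> 'b \<Rightarrow> 'a"
  where "hadj S p q A y = (THE x. x \<in> S \<and> (\<forall>h\<in>S. q (A h) y = p h x))"

abbreviation cadj ::
    "('a::complex_hilbert_space \<Rightarrow> 'b::complex_hilbert_space) \<Rightarrow> 'b \<Rightarrow> 'a"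
  where "cadj \<equiv> hadj UNIV cinner cinner"

text \<open>Below, \<open>p\<close> is always a scalar product equivalent to \<open>cinner\<close>, so boundedness with respect
  to \<open>p\<close> is boundedness in the sense of the type.\<close>

definition positive_op ::
    "('a::complex_hilbert_space \<Rightarrow> 'a \<Rightarrow> complex) \<Rightarrow> ('a \<Rightarrow> 'a) \<Rightarrow> bool"
  where "positive_op p A \<longleftrightarrow> bounded_clinear A \<and> (\<forall>x. p (A x) x \<in> \<real>\<^sub>\<ge>\<^sub>0)"

text \<open>The positive square root of a positive operator exists and is unique.\<close>

definition op_sqrt ::
    "('a::complex_hilbert_space \<Rightarrow> 'a \<Rightarrow> complex) \<Rightarrow> ('a \<Rightarrow> 'a) \<Rightarrow> 'a \<Rightarrow> 'a"
  where "op_sqrt p A = (SOME B. positive_op p B \<and> B \<circ> B = A)"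

definition ominus :: "('a \<Rightarrow> 'a \<Rightarrow> complex) \<Rightarrow> 'a set \<Rightarrow> 'a set \<Rightarrow> 'a set"
  where "ominus p M N = {f \<in> M. \<forall>g\<in>N. p f g = 0}"


section \<open>The spaces \<open>H\<^sub>K(E)\<close>\<close>

definition mabs :: "nat ^ 'd::finite \<Rightarrow> nat"
  where "mabs \<alpha> = (\<Sum>i\<in>UNIV. \<alpha> $ i)"

definition mgamma :: "nat ^ 'd::finite \<Rightarrow> real"
  where "mgamma \<alpha> = fact (mabs \<alpha>) / (\<Prod>i\<in>UNIV. fact (\<alpha> $ i))"

definition mpow :: "complex ^ 'd::finite \<Rightarrow> nat ^ 'd \<Rightarrow> complex"
  where "mpow z \<alpha> = (\<Prod>i\<in>UNIV. (z $ i) ^ (\<alpha> $ i))"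

text \<open>A function on the open unit ball is represented by its extension by \<open>0\<close>.\<close>

definition on_ball :: "(complex ^ 'd::finite \<Rightarrow> 'h::zero) \<Rightarrow> complex ^ 'd \<Rightarrow> 'h"
  where "on_ball f z = (if z \<in> ball 0 1 then f z else 0)"

definition power_series ::
    "(nat ^ 'd::finite \<Rightarrow> 'h::complex_hilbert_space) \<Rightarrow> complex ^ 'd \<Rightarrow> 'h"
  where "power_series u = on_ball (\<lambda>z. \<Sum>\<^sub>\<infinity>\<alpha>. mpow z \<alpha> *\<^sub>C u \<alpha>)"

definition hk_summable ::
    "(nat \<Rightarrow> real) \<Rightarrow> (nat ^ 'd::finite \<Rightarrow> 'h::complex_hilbert_space) \<Rightarrow> bool"
  where "hk_summable a u \<longleftrightarrow>
    (\<lambda>\<alpha>. (norm (u \<alpha>))\<^sup>2 / (a (mabs \<alpha>) * mgamma \<alpha>)) summable_on UNIV"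

text \<open>\<open>E\<close> is a closed subspace of the ambient Hilbert space.\<close>

definition HK ::
    "(nat \<Rightarrow> real) \<Rightarrow> 'h::complex_hilbert_space set \<Rightarrow> (complex ^ 'd::finite \<Rightarrow> 'h) set"
  where "HK a E = {power_series u | u. hk_summable a u \<and> (\<forall>\<alpha>. u \<alpha> \<in> E)}"

definition hk_coeff ::
    "(nat \<Rightarrow> real) \<Rightarrow> (complex ^ 'd::finite \<Rightarrow> 'h::complex_hilbert_space) \<Rightarrow> nat ^ 'd \<Rightarrow> 'h"
  where "hk_coeff a f = (THE u. hk_summable a u \<and> f = power_series u)"

definition hk_inner ::
    "(nat \<Rightarrow> real) \<Rightarrow> (complex ^ 'd::finite \<Rightarrow> 'h::complex_hilbert_space) \<Rightarrow>
      (complex ^ 'd \<Rightarrow> 'h) \<Rightarrow> complex"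
  where "hk_inner a f g = (\<Sum>\<^sub>\<infinity>\<alpha>.
    cinner (hk_coeff a f \<alpha>) (hk_coeff a g \<alpha>) / complex_of_real (a (mabs \<alpha>) * mgamma \<alpha>))"

definition hk_norm ::
    "(nat \<Rightarrow> real) \<Rightarrow> (complex ^ 'd::finite \<Rightarrow> 'h::complex_hilbert_space) \<Rightarrow> real"
  where "hk_norm a f =
    sqrt (\<Sum>\<^sub>\<infinity>\<alpha>. (norm (hk_coeff a f \<alpha>))\<^sup>2 / (a (mabs \<alpha>) * mgamma \<alpha>))"

definition mult_coord ::
    "'d::finite \<Rightarrow> (complex ^ 'd \<Rightarrow> 'h::complex_hilbert_space) \<Rightarrow> complex ^ 'd \<Rightarrow> 'h"
  where "mult_coord i f z = z $ i *\<^sub>C f z"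

definition mult_coord_adj ::
    "(nat \<Rightarrow> real) \<Rightarrow> 'h::complex_hilbert_space set \<Rightarrow> 'd::finite \<Rightarrow>
      (complex ^ 'd \<Rightarrow> 'h) \<Rightarrow> complex ^ 'd \<Rightarrow> 'h"
  where "mult_coord_adj a E i = hadj (HK a E) (hk_inner a) (hk_inner a) (mult_coord i)"

definition hk_Delta ::
    "(nat \<Rightarrow> real) \<Rightarrow> (complex ^ 'd::finite \<Rightarrow> 'h::complex_hilbert_space) \<Rightarrow>
      complex ^ 'd \<Rightarrow> 'h"
  where "hk_Delta a f =
    power_series (\<lambda>\<alpha>. (a (Suc (mabs \<alpha>)) / a (mabs \<alpha>)) *\<^sub>R hk_coeff a f \<alpha>)"

definition wandering ::
    "(nat \<Rightarrow> real) \<Rightarrow> (complex ^ 'd::finite \<Rightarrow> 'h::complex_hilbert_space) set \<Rightarrow>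
      (complex ^ 'd \<Rightarrow> 'h) set"
  where "wandering a M =
    ominus (hk_inner a) M {(\<lambda>z. \<Sum>i\<in>UNIV. mult_coord i (g i) z) | g. \<forall>i. g i \<in> M}"


section \<open>\<open>K\<close>-contractions\<close>

text \<open>Throughout, \<open>a\<close> and \<open>c\<close> are the Taylor coefficients at \<open>0\<close> of \<open>k\<close> and \<open>1/k\<close>.\<close>

definition commuting_tuple :: "('d::finite \<Rightarrow> 'h::complex_hilbert_space \<Rightarrow> 'h) \<Rightarrow> bool"
  where "commuting_tuple T \<longleftrightarrow> (\<forall>i. bounded_clinear (T i)) \<and> (\<forall>i j. T i \<circ> T j = T j \<circ> T i)"

definition sigma_op ::
    "('d::finite \<Rightarrow> 'h::complex_hilbert_space \<Rightarrow> 'h) \<Rightarrow> ('h \<Rightarrow> 'h) \<Rightarrow> 'h \<Rightarrow> 'h"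
  where "sigma_op T X h = (\<Sum>i\<in>UNIV. T i (X (cadj (T i) h)))"

definition inv_K ::
    "(nat \<Rightarrow> complex) \<Rightarrow> ('d::finite \<Rightarrow> 'h::complex_hilbert_space \<Rightarrow> 'h) \<Rightarrow> 'h \<Rightarrow> 'h"
  where "inv_K c T h = (\<Sum>n. c n *\<^sub>C (sigma_op T ^^ n) id h)"

definition K_contraction ::
    "(nat \<Rightarrow> complex) \<Rightarrow> ('d::finite \<Rightarrow> 'h::complex_hilbert_space \<Rightarrow> 'h) \<Rightarrow> bool"
  where "K_contraction c T \<longleftrightarrow> commuting_tuple T \<and>
    (\<forall>h. summable (\<lambda>n. c n *\<^sub>C (sigma_op T ^^ n) id h)) \<and> positive_op cinner (inv_K c T)"

definition pure_K_contraction ::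
    "(nat \<Rightarrow> real) \<Rightarrow> (nat \<Rightarrow> complex) \<Rightarrow> ('d::finite \<Rightarrow> 'h::complex_hilbert_space \<Rightarrow> 'h) \<Rightarrow> bool"
  where "pure_K_contraction a c T \<longleftrightarrow> K_contraction c T \<and>
    (\<forall>h. (\<lambda>N. h - (\<Sum>n\<le>N. a n *\<^sub>R (sigma_op T ^^ n) (inv_K c T) h)) \<longlonglongrightarrow> 0)"

definition defect_op ::
    "(nat \<Rightarrow> complex) \<Rightarrow> ('d::finite \<Rightarrow> 'h::complex_hilbert_space \<Rightarrow> 'h) \<Rightarrow> 'h \<Rightarrow> 'h"
  where "defect_op c T = op_sqrt cinner (inv_K c T)"

definition defect_space ::
    "(nat \<Rightarrow> complex) \<Rightarrow> ('d::finite \<Rightarrow> 'h::complex_hilbert_space \<Rightarrow> 'h) \<Rightarrow> 'h set"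
  where "defect_space c T = closure (range (defect_op c T))"

text \<open>The order of the factors is immaterial for commuting tuples, so the fold is well defined.\<close>

definition adj_mpow ::
    "('d::finite \<Rightarrow> 'h::complex_hilbert_space \<Rightarrow> 'h) \<Rightarrow> nat ^ 'd \<Rightarrow> 'h \<Rightarrow> 'h"
  where "adj_mpow T \<alpha> = Finite_Set.fold (\<lambda>i S. (cadj (T i) ^^ (\<alpha> $ i)) \<circ> S) id UNIV"

definition dilation ::
    "(nat \<Rightarrow> real) \<Rightarrow> (nat \<Rightarrow> complex) \<Rightarrow> ('d::finite \<Rightarrow> 'h::complex_hilbert_space \<Rightarrow> 'h) \<Rightarrow>
      'h \<Rightarrow> complex ^ 'd \<Rightarrow> 'h"
  where "dilation a c T h =
    power_series (\<lambda>\<alpha>. (a (mabs \<alpha>) * mgamma \<alpha>) *\<^sub>R defect_op c T (adj_mpow T \<alpha> h))"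


section \<open>The renormed space and the function \<open>W\<^sub>T\<close>\<close>

definition Delta_T ::
    "(nat \<Rightarrow> real) \<Rightarrow> (nat \<Rightarrow> complex) \<Rightarrow> ('d::finite \<Rightarrow> 'h::complex_hilbert_space \<Rightarrow> 'h) \<Rightarrow>
      'h \<Rightarrow> 'h"
  where "Delta_T a c T h =
    hadj UNIV cinner (hk_inner a) (dilation a c T) (hk_Delta a (dilation a c T h))"

text \<open>Scalar products of \<open>\<tilde>H\<close> and \<open>\<tilde>H\<^sup>d\<close>. The spaces have the carriers \<open>UNIV\<close> of \<open>H\<close> and
  \<open>H\<^sup>d\<close>, so \<open>I\<^sub>T\<close> and its inverse are the identity map; only the adjoint of \<open>I\<^sub>T\<close> matters.\<close>

definition tinner ::
    "(nat \<Rightarrow> real) \<Rightarrow> (nat \<Rightarrow> complex) \<Rightarrow> ('d::finite \<Rightarrow> 'h::complex_hilbert_space \<Rightarrow> 'h) \<Rightarrow>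
      'h \<Rightarrow> 'h \<Rightarrow> complex"
  where "tinner a c T x y = cinner (Delta_T a c T x) y"

definition tinner_d ::
    "(nat \<Rightarrow> real) \<Rightarrow> (nat \<Rightarrow> complex) \<Rightarrow> ('d::finite \<Rightarrow> 'h::complex_hilbert_space \<Rightarrow> 'h) \<Rightarrow>
      'h ^ 'd \<Rightarrow> 'h ^ 'd \<Rightarrow> complex"
  where "tinner_d a c T x y = (\<Sum>i\<in>UNIV. tinner a c T (x $ i) (y $ i))"

definition tnorm_d ::
    "(nat \<Rightarrow> real) \<Rightarrow> (nat \<Rightarrow> complex) \<Rightarrow> ('d::finite \<Rightarrow> 'h::complex_hilbert_space \<Rightarrow> 'h) \<Rightarrow>
      'h ^ 'd \<Rightarrow> real"
  where "tnorm_d a c T x = sqrt (Re (tinner_d a c T x x))"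

definition I_T_adj ::
    "(nat \<Rightarrow> real) \<Rightarrow> (nat \<Rightarrow> complex) \<Rightarrow> ('d::finite \<Rightarrow> 'h::complex_hilbert_space \<Rightarrow> 'h) \<Rightarrow>
      'h \<Rightarrow> 'h"
  where "I_T_adj a c T = hadj UNIV cinner (tinner a c T) (\<lambda>x. x)"

definition T_tilde ::
    "(nat \<Rightarrow> real) \<Rightarrow> (nat \<Rightarrow> complex) \<Rightarrow> ('d::finite \<Rightarrow> 'h::complex_hilbert_space \<Rightarrow> 'h) \<Rightarrow>
      'h ^ 'd \<Rightarrow> 'h"
  where "T_tilde a c T x = (\<Sum>i\<in>UNIV. T i (I_T_adj a c T (x $ i)))"

definition D_tilde_op ::
    "(nat \<Rightarrow> real) \<Rightarrow> (nat \<Rightarrow> complex) \<Rightarrow> ('d::finite \<Rightarrow> 'h::complex_hilbert_space \<Rightarrow> 'h) \<Rightarrow>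
      'h ^ 'd \<Rightarrow> 'h ^ 'd"
  where "D_tilde_op a c T = op_sqrt (tinner_d a c T)
    (\<lambda>x. x - hadj UNIV (tinner_d a c T) cinner (T_tilde a c T) (T_tilde a c T x))"

text \<open>The norms of \<open>\<tilde>H\<^sup>d\<close> and \<open>H\<^sup>d\<close> are equivalent, so the closure may be taken in \<open>H\<^sup>d\<close>.\<close>

definition D_T_tilde_space ::
    "(nat \<Rightarrow> real) \<Rightarrow> (nat \<Rightarrow> complex) \<Rightarrow> ('d::finite \<Rightarrow> 'h::complex_hilbert_space \<Rightarrow> 'h) \<Rightarrow>
      ('h ^ 'd) set"
  where "D_T_tilde_space a c T = closure (range (D_tilde_op a c T))"

definition D_tilde_space ::
    "(nat \<Rightarrow> real) \<Rightarrow> (nat \<Rightarrow> complex) \<Rightarrow> ('d::finite \<Rightarrow> 'h::complex_hilbert_space \<Rightarrow> 'h) \<Rightarrow>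
      ('h ^ 'd) set"
  where "D_tilde_space a c T = {y \<in> D_T_tilde_space a c T.
    \<exists>f\<in>HK a (defect_space c T). \<forall>i.
      dilation a c T (D_tilde_op a c T y $ i) = mult_coord_adj a (defect_space c T) i f}"

text \<open>The value of \<open>F(z) = \<Sum>\<^sub>n a\<^bsub>n+1\<^esub> z\<^sup>n\<close> at the operator \<open>ZT\<^sup>*\<close>, whose powers are expanded by the
  multinomial theorem.\<close>

definition F_ZT_adj ::
    "(nat \<Rightarrow> real) \<Rightarrow> ('d::finite \<Rightarrow> 'h::complex_hilbert_space \<Rightarrow> 'h) \<Rightarrow> complex ^ 'd \<Rightarrow> 'h \<Rightarrow> 'h"
  where "F_ZT_adj a T z h = (\<Sum>n. a (Suc n) *\<^sub>R
    (\<Sum>\<alpha> | mabs \<alpha> = n. mgamma \<alpha> *\<^sub>R mpow z \<alpha> *\<^sub>C adj_mpow T \<alpha> h))"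

definition Z_row :: "complex ^ 'd::finite \<Rightarrow> 'h::complex_hilbert_space ^ 'd \<Rightarrow> 'h"
  where "Z_row z h = (\<Sum>i\<in>UNIV. z $ i *\<^sub>C h $ i)"

definition W_T ::
    "(nat \<Rightarrow> real) \<Rightarrow> (nat \<Rightarrow> complex) \<Rightarrow> ('d::finite \<Rightarrow> 'h::complex_hilbert_space \<Rightarrow> 'h) \<Rightarrow>
      complex ^ 'd \<Rightarrow> 'h ^ 'd \<Rightarrow> 'h"
  where "W_T a c T z x =
    - T_tilde a c T x + defect_op c T (F_ZT_adj a T z (Z_row z (D_tilde_op a c T x)))"

end

theory Submission
  imports Defs
begin

text \<open>
  On coefficients, \<open>M\<^sub>z\<close> and \<open>\<Delta>\<close> are weighted shifts and a diagonal operator, and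
  \<open>\<Sum>\<^sub>i M\<^sub>z\<^sub>i \<Delta> M\<^sub>z\<^sub>i\<^sup>* = 1 - P\<^sub>0\<close> with \<open>P\<^sub>0\<close> the projection onto the constants. Compressed by \<open>j\<close>, this
  is \<open>T' T'\<^sup>* = 1 - C\<^sup>2\<close> for \<open>T'\<close> the row operator on the renormed space, whose adjoint is the column
  \<open>T\<^sup>*\<close>. Hence \<open>C\<close> is the defect operator of \<open>T'\<^sup>*\<close>, and with \<open>D = D\<^bsub>T'\<^esub>\<close> the intertwining relations
  \<open>T' D = C T'\<close> and \<open>T'\<^sup>* C = D T'\<^sup>*\<close> hold.

  Since \<open>M\<^sup>\<bottom> = Im j\<close>, a function \<open>f\<close> lies in \<open>W(M)\<close> iff \<open>j\<^sup>*f = 0\<close> and \<open>M\<^sub>z\<^sub>i\<^sup>*f = j x\<^sub>i\<close> for some \<open>x\<close>. The identity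
  above then gives \<open>f = f\<^sub>0 + \<Sum>\<^sub>i M\<^sub>z\<^sub>i \<Delta> j x\<^sub>i\<close>, \<open>j\<^sup>*f = C f\<^sub>0 + T' x\<close> and \<open>\<parallel>f\<parallel>\<^sup>2 = \<parallel>f\<^sub>0\<parallel>\<^sup>2 + \<parallel>x\<parallel>\<^sup>2\<close>. The pairs
  \<open>(f\<^sub>0, x)\<close> with \<open>C f\<^sub>0 + T' x = 0\<close> are exactly those of the form \<open>(-T' y, D y)\<close>, with
  \<open>y = D x - T'\<^sup>* f\<^sub>0\<close>, because the block operator \<open>(-T', C; D, T'\<^sup>*)\<close> is unitary.
\<close>

section \<open>Hilbert space preliminaries\<close>

text \<open>\<open>HK a E\<close> is a set of functions and not a type, so its operators are carried
  out on coefficient families: \<open>power_series\<close> is injective on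
  \<open>hk_summable\<close> families, and from then on all statements are about
  \<open>coeff_inner\<close>, \<open>shift_up\<close>, \<open>shift_down\<close> and
  \<open>coeff_Delta\<close>. What turns the identity on coefficients into one about
  \<open>T\<close> is that the dilation carries \<open>cadj (T i)\<close> to the backward shift
  \<open>shift_down a i\<close>. The delicate point is the pair of intertwining relations:
  \<open>C\<close> and \<open>D\<close> are positive square roots for two different scalar products
  on two different spaces. Both are therefore compared with limits of one and the same polynomial
  iteration, through which an intertwiner passes term by term; uniqueness of the positive square
  root transfers the relation to the roots that \<open>op_sqrt\<close> selects.\<close>

lemma scaleC_zero_right [simp]: "c *\<^sub>C (0::'a::complex_hilbert_space) = 0"
  using scaleC_add_right[of c "0::'a" 0] by simp

lemma scaleC_zero_left [simp]: "0 *\<^sub>C (x::'a::complex_hilbert_space) = 0"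
  using scaleC_add_left[of 0 0 x] by simp

lemma scaleC_one [simp]: "1 *\<^sub>C (x::'a::complex_hilbert_space) = x"
  using scaleC_of_real[of 1 x] by simp

lemma scaleC_minus_right: "c *\<^sub>C (- x::'a::complex_hilbert_space) = - (c *\<^sub>C x)"
  using scaleC_add_right[of c x "- x"] by (simp add: eq_neg_iff_add_eq_0 add.commute)

lemma scaleC_diff_right: "c *\<^sub>C (x - y::'a::complex_hilbert_space) = c *\<^sub>C x - c *\<^sub>C y"
  using scaleC_add_right[of c x "- y"] by (simp add: scaleC_minus_right)

lemma scaleC_diff_left: "(b - c) *\<^sub>C (x::'a::complex_hilbert_space) = b *\<^sub>C x - c *\<^sub>C x"
  using scaleC_add_left[of "b - c" c x] by (simp add: algebra_simps)

lemma scaleC_scaleR_commute: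
  "c *\<^sub>C t *\<^sub>R (x::'a::complex_hilbert_space) = t *\<^sub>R c *\<^sub>C x"
  by (simp add: scaleC_of_real[symmetric] scaleC_scaleC mult.commute)

lemma scaleC_sum_right: "c *\<^sub>C (\<Sum>i\<in>A. f i::'a::complex_hilbert_space) = (\<Sum>i\<in>A. c *\<^sub>C f i)"
  by (induction A rule: infinite_finite_induct) (auto simp: scaleC_add_right)

section \<open>Positive semidefinite Hermitian forms and the Cauchy-Schwarz inequality\<close>

text \<open>Definiteness is left out so that Cauchy-Schwarz also applies to the forms
  \<open>p (A x) y\<close> of positive operators and to scalar products of coefficient families
  pulled back to a finite-dimensional space.\<close>

locale psd_form =
  fixes p :: "'a::complex_hilbert_space \<Rightarrow> 'a \<Rightarrow> complex"
  assumes add_left: "p (x + y) z = p x z + p y z"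
    and scaleC_left: "p (c *\<^sub>C x) z = c * p x z"
    and commute: "p x y = cnj (p y x)"
    and nonneg: "0 \<le> Re (p x x)"
begin

lemma add_right: "p x (y + z) = p x y + p x z"
  by (metis add_left commute complex_cnj_add)

lemma scaleC_right: "p x (c *\<^sub>C y) = cnj c * p x y"
  by (metis scaleC_left commute complex_cnj_mult)

lemma scaleR_left: "p (t *\<^sub>R x) z = of_real t * p x z"
  by (metis scaleC_left scaleC_of_real)

lemma scaleR_right: "p x (t *\<^sub>R z) = of_real t * p x z"
  by (metis scaleC_right scaleC_of_real complex_cnj_complex_of_real)

lemma zero_left [simp]: "p 0 z = 0"
  using add_left[of 0 0 z] by simp

lemma zero_right [simp]: "p z 0 = 0"
  using add_right[of z 0 0] by simp

lemma minus_left: "p (- x) z = - p x z"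
  using add_left[of x "- x" z] by (simp add: eq_neg_iff_add_eq_0 add.commute)

lemma minus_right: "p z (- x) = - p z x"
  using add_right[of z x "- x"] by (simp add: eq_neg_iff_add_eq_0 add.commute)

lemma diff_left: "p (x - y) z = p x z - p y z"
  using add_left[of x "- y" z] by (simp add: minus_left)

lemma diff_right: "p z (x - y) = p z x - p z y"
  using add_right[of z x "- y"] by (simp add: minus_right)

lemma self_real: "p x x = of_real (Re (p x x))"
  using commute[of x x] by (simp add: complex_eq_iff)

lemma Re_cauchy_schwarz: "(Re (p x y))\<^sup>2 \<le> Re (p x x) * Re (p y y)"
proof -
  define B C where "B = Re (p x y)" and "C = Re (p y y)"
  have yx: "Re (p y x) = B"
    using commute[of y x] by (simp add: B_def)
  have quad: "0 \<le> Re (p x x) + 2 * t * B + t\<^sup>2 * C" for t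
    using nonneg[of "x + t *\<^sub>R y"] yx
    by (simp add: add_left add_right scaleR_left scaleR_right B_def C_def power2_eq_square algebra_simps)
  have C0: "0 \<le> C" by (simp add: C_def nonneg)
  show ?thesis
  proof (cases "C = 0")
    case True
    have "B = 0"
    proof (rule ccontr)
      assume "B \<noteq> 0"
      \<comment> \<open>For \<open>C = 0\<close> the quadratic is affine in \<open>t\<close>; this
        \<open>t\<close> gives it the value -1.\<close>
      then show False
        using quad[of "- (Re (p x x) + 1) / (2 * B)"] True by (simp add: field_simps)
    qed
    then show ?thesis using True by (simp add: B_def C_def)
  next
    case False
    with C0 have C: "0 < C" by simp
    \<comment> \<open>The quadratic is minimal at \<open>t = - B / C\<close>.\<close>
    have "0 \<le> Re (p x x) - B\<^sup>2 / C"
      using quad[of "- B / C"] C by (simp add: power2_eq_square field_simps)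
    then show ?thesis
      using C by (simp add: field_simps B_def C_def)
  qed
qed

lemma cauchy_schwarz: "(cmod (p x y))\<^sup>2 \<le> Re (p x x) * Re (p y y)"
proof (cases "p x y = 0")
  case True
  then show ?thesis by (simp add: nonneg)
next
  case False
  \<comment> \<open>The unimodular factor that rotates \<open>p x y\<close> onto its modulus, which
    reduces the claim to real parts.\<close>
  define s where "s = cnj (sgn (p x y))"
  have ss: "cnj s * s = 1"
    using False by (simp add: s_def sgn_eq mult.commute complex_norm_square[symmetric] 
      power2_eq_square[symmetric])
  have "s * p x y = of_real (cmod (p x y))"
    using False by (simp add: s_def sgn_eq complex_norm_square[symmetric] mult.commute
       power2_eq_square)
  then have 1: "Re (p (s *\<^sub>C x) y) = cmod (p x y)"
    by (simp add: scaleC_left)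
  have "p (s *\<^sub>C x) (s *\<^sub>C x) = (cnj s * s) * p x x"
    by (simp add: scaleC_left scaleC_right)
  then have "p (s *\<^sub>C x) (s *\<^sub>C x) = p x x"
    using ss by simp
  then show ?thesis
    using Re_cauchy_schwarz[of "s *\<^sub>C x" y] 1 by simp
qed

text \<open>Replaces definiteness: a vector of length zero is orthogonal to everything. Uniqueness
  of square roots rests on it.\<close>

lemma eq_zero_of_self_zero: "Re (p x x) = 0 \<Longrightarrow> p x y = 0"
  using cauchy_schwarz[of x y] by simp

end

interpretation cinner: psd_form cinner
  by standard (auto simp: cinner_add_left cinner_scaleC_left inner_eq_Re_cinner[symmetric]
     intro: cinner_commute)

lemma cinner_self: "cinner x x = of_real ((norm x)\<^sup>2)"
  using cinner.self_real[of x] by (simp add: inner_eq_Re_cinner[symmetric] power2_norm_eq_inner)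

lemma norm_cinner_le: "cmod (cinner x y) \<le> norm x * norm y"
  using cinner.cauchy_schwarz[of x y]
  by (simp add: inner_eq_Re_cinner[symmetric] power2_norm_eq_inner[symmetric]
      power_mult_distrib[symmetric] abs_le_square_iff[symmetric] abs_mult)

lemma norm_scaleC: "norm (c *\<^sub>C (x::'a::complex_hilbert_space)) = cmod c * norm x"
proof -
  have "cinner (c *\<^sub>C x) (c *\<^sub>C x) = (c * cnj c) * cinner x x"
    by (simp add: cinner_scaleC_left cinner.scaleC_right)
  then have "(norm (c *\<^sub>C x))\<^sup>2 = (cmod c * norm x)\<^sup>2"
    unfolding cinner_self complex_norm_square[symmetric] of_real_mult[symmetric] power_mult_distrib
    using of_real_eq_iff by blast
  then show ?thesis
    by (simp add: power2_eq_iff_nonneg)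
qed

lemma cinner_eqI: "(\<And>h. cinner h x = cinner h y) \<Longrightarrow> x = y"
  by (metis cinner.diff_right cinner_self diff_self eq_iff_diff_eq_0 norm_eq_zero of_real_eq_0_iff
      zero_eq_power2)

lemma cinner_eqI_left: "(\<And>h. cinner x h = cinner y h) \<Longrightarrow> x = y"
  by (metis cinner_eqI cinner_commute)

lemma bounded_bilinear_cinner: "bounded_bilinear cinner"
proof
  show "\<exists>K. \<forall>a b. norm (cinner a b) \<le> norm a * norm b * K"
    by (intro exI[of _ 1]) (auto simp: norm_cinner_le)
qed (auto simp: cinner.add_left cinner.add_right cinner.scaleR_left cinner.scaleR_right
    scaleR_conv_of_real)

lemma bounded_linear_cinner_left: "bounded_linear (\<lambda>x. cinner x y)"
  by (rule bounded_bilinear.bounded_linear_left[OF bounded_bilinear_cinner])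

lemma bounded_linear_scaleC: "bounded_linear (\<lambda>x::'a::complex_hilbert_space. c *\<^sub>C x)"
  by (rule bounded_linear_intro[of _ "cmod c"])
    (auto simp: scaleC_add_right scaleC_scaleR_commute norm_scaleC mult.commute)

lemma bounded_clinear_scaleC: "bounded_clinear (\<lambda>x::'a::complex_hilbert_space. c *\<^sub>C x)"
  by (simp add: bounded_clinear_def bounded_linear_scaleC scaleC_scaleC mult.commute)

section \<open>Bounded complex-linear operators\<close>

lemma bounded_clinearI:
  assumes "\<And>x y. A (x + y) = A x + A y" "\<And>c x. A (c *\<^sub>C x) = c *\<^sub>C A x"
    and "\<And>x. norm (A x) \<le> norm x * K"
  shows "bounded_clinear A"
  unfolding bounded_clinear_def
proof (intro conjI allI bounded_linear_intro)
  show "A (r *\<^sub>R x) = r *\<^sub>R A x" for r x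
    by (metis assms(2) scaleC_of_real)
qed (use assms in auto)

lemma bounded_clinear_compose:
  "bounded_clinear A \<Longrightarrow> bounded_clinear B \<Longrightarrow> bounded_clinear (\<lambda>x. A (B x))"
  by (auto simp: bounded_clinear_def intro: bounded_linear_compose)

lemma bounded_clinear_add:
  "bounded_clinear A \<Longrightarrow> bounded_clinear B \<Longrightarrow> bounded_clinear (\<lambda>x. A x + B x)"
  by (auto simp: bounded_clinear_def scaleC_add_right intro: bounded_linear_add)

lemma bounded_clinear_diff:
  "bounded_clinear A \<Longrightarrow> bounded_clinear B \<Longrightarrow> bounded_clinear (\<lambda>x. A x - B x)"
  by (auto simp: bounded_clinear_def scaleC_diff_right intro: bounded_linear_sub)

lemma bounded_clinear_scaleR:
  "bounded_clinear A \<Longrightarrow> bounded_clinear (\<lambda>x. t *\<^sub>R A x)"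
  by (auto simp: bounded_clinear_def scaleC_scaleR_commute intro: bounded_linear_const_scaleR)

lemma bounded_clinear_ident: "bounded_clinear (\<lambda>x. x)"
  by (auto simp: bounded_clinear_def intro: bounded_linear_ident)

lemma bounded_clinear_zero: "bounded_clinear (\<lambda>x. 0)"
  by (auto simp: bounded_clinear_def intro: bounded_linear_zero)

lemma bounded_clinear_sum:
  "(\<And>i. i \<in> I \<Longrightarrow> bounded_clinear (A i)) \<Longrightarrow> bounded_clinear (\<lambda>x. \<Sum>i\<in>I. A i x)"
  by (auto simp: bounded_clinear_def scaleC_sum_right intro!: bounded_linear_sum)

lemma bounded_clinear_vec_nth: "bounded_clinear (\<lambda>x. x $ i)"
  by (auto simp: bounded_clinear_def scaleC_vec_def intro: bounded_linear_vec_nth)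

lemma bounded_clinear_vec_lambda:
  fixes A :: "'i::finite \<Rightarrow> 'a::complex_hilbert_space \<Rightarrow> 'b::complex_hilbert_space"
  assumes "\<And>i. bounded_clinear (A i)"
  shows "bounded_clinear (\<lambda>x. \<chi> i. A i x)"
proof -
  have "\<forall>i. \<exists>K. \<forall>x. norm (A i x) \<le> norm x * K"
    using assms unfolding bounded_clinear_def using bounded_linear.bounded by blast
  then obtain K where K: "\<And>i x. norm (A i x) \<le> norm x * K i" by metis
  show ?thesis
  proof (rule bounded_clinearI)
    fix x
    have "norm (\<chi> i. A i x) \<le> (\<Sum>i\<in>UNIV. norm (A i x))"
      unfolding norm_vec_def using L2_set_le_sum[of UNIV "\<lambda>i. norm (A i x)"] by simp
    also have "\<dots> \<le> norm x * (\<Sum>i\<in>UNIV. K i)"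
      by (simp add: sum_distrib_left sum_mono K)
    finally show "norm (\<chi> i. A i x) \<le> norm x * (\<Sum>i\<in>UNIV. K i)" .
  qed (use assms in \<open>auto simp: vec_eq_iff scaleC_vec_def bounded_clinear_def
     linear_simps bounded_linear.linear linear_add\<close>)
qed

context
  fixes A :: "'a::complex_hilbert_space \<Rightarrow> 'b::complex_hilbert_space"
  assumes A: "bounded_clinear A"
begin

lemma bounded_clinear_imp_bounded_linear: "bounded_linear A"
  using A by (simp add: bounded_clinear_def)

lemma clinear_add: "A (x + y) = A x + A y"
  using A by (simp add: bounded_clinear_def linear_simps)

lemma clinear_diff: "A (x - y) = A x - A y"
  using A by (simp add: bounded_clinear_def linear_simps)

lemma clinear_zero: "A 0 = 0"
  using A by (simp add: bounded_clinear_def linear_simps)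

lemma clinear_minus: "A (- x) = - A x"
  using A by (simp add: bounded_clinear_def linear_simps)

lemma clinear_scaleR: "A (t *\<^sub>R x) = t *\<^sub>R A x"
  using A by (simp add: bounded_clinear_def linear_simps)

lemma clinear_scaleC: "A (c *\<^sub>C x) = c *\<^sub>C A x"
  using A by (simp add: bounded_clinear_def)

lemma clinear_sum: "A (\<Sum>i\<in>I. f i) = (\<Sum>i\<in>I. A (f i))"
  using A by (simp add: bounded_clinear_def bounded_linear.linear linear_sum)

lemma clinear_tendsto: "(f \<longlongrightarrow> l) F \<Longrightarrow> ((\<lambda>n. A (f n)) \<longlongrightarrow> A l) F"
  using bounded_clinear_imp_bounded_linear bounded_linear.tendsto by blast

lemma bounded_clinear_pos_bound: "\<exists>K>0. \<forall>x. norm (A x) \<le> norm x * K"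
  using A by (simp add: bounded_clinear_def bounded_linear.pos_bounded)

end

subsection \<open>The Riesz theorem and adjoints\<close>

text \<open>Variational proof: \<open>q x = (norm x)\<^sup>2 / 2 - \<phi> x\<close> is bounded
  below, the parallelogram law makes a minimising sequence Cauchy, and the vanishing derivative of
  \<open>q\<close> at its minimiser \<open>x\<close> says that \<open>x\<close> represents
  \<open>\<phi>\<close>.\<close>

lemma riesz_real:
  fixes \<phi> :: "'a::{real_inner,banach} \<Rightarrow> real"
  assumes "bounded_linear \<phi>"
  obtains x where "\<And>h. \<phi> h = inner h x"
proof -
  interpret bounded_linear \<phi> by fact
  obtain K where K: "K > 0" "\<And>x. norm (\<phi> x) \<le> norm x * K"
    using pos_bounded by blast
  define q where "q x = (norm x)\<^sup>2 / 2 - \<phi> x" for x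
  have lb: "- K\<^sup>2 / 2 \<le> q x" for x
  proof -
    have "\<phi> x \<le> norm x * K" using K(2)[of x] by simp
    moreover have "0 \<le> (norm x - K)\<^sup>2" by simp
    ultimately show ?thesis by (simp add: q_def power2_eq_square algebra_simps)
  qed
  define I where "I = (INF x. q x)"
  have bdd: "bdd_below (range q)" using lb by (auto intro!: bdd_belowI)
  have I_le: "I \<le> q x" for x unfolding I_def by (rule cINF_lower[OF bdd]) auto
  have "\<exists>x. q x < I + inverse (real (Suc n))" for n
  proof -
    have "I < I + inverse (real (Suc n))" by simp
    then show ?thesis unfolding I_def using cInf_lessD[of "range q"] by blast
  qed
  then obtain X where X: "\<And>n. q (X n) < I + inverse (real (Suc n))" by metis
  \<comment> \<open>Parallelogram law; the linear part of \<open>q\<close> cancels at the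
    midpoint.\<close>
  have par: "(norm (x - y))\<^sup>2 / 8 = (q x + q y) / 2 - q ((1/2) *\<^sub>R (x + y))" for x y
    by (simp add: q_def power2_norm_eq_inner inner_diff inner_add inner_commute scaleR add
        scaleR_right_diff_distrib scaleR_right_distrib field_simps)
  have cau: "(norm (X n - X m))\<^sup>2 \<le> 8 * inverse (real (Suc N))" if "n \<ge> N" "m \<ge> N" for n m N
  proof -
    have "inverse (real (Suc n)) \<le> inverse (real (Suc N))" "inverse (real (Suc m)) \<le> inverse (real (Suc N))"
      using that by (auto simp: field_simps)
    then have "(q (X n) + q (X m)) / 2 \<le> I + inverse (real (Suc N))"
      using X[of n] X[of m] by argo
    then show ?thesis
      using par[of "X n" "X m"] I_le[of "(1/2) *\<^sub>R (X n + X m)"] by argo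
  qed
  have "Cauchy X"
  proof (rule metric_CauchyI)
    fix e :: real assume e: "e > 0"
    then have "0 < e\<^sup>2 / 8" by simp
    then obtain N where N: "inverse (real (Suc N)) < e\<^sup>2 / 8"
      using reals_Archimedean by blast
    have "dist (X m) (X n) < e" if "m \<ge> N" "n \<ge> N" for m n
    proof -
      have "(norm (X m - X n))\<^sup>2 < e\<^sup>2" using cau[OF that] N by linarith
      then show ?thesis using e power2_less_imp_less[of _ e] by (simp add: dist_norm)
    qed
    then show "\<exists>M. \<forall>m\<ge>M. \<forall>n\<ge>M. dist (X m) (X n) < e" by blast
  qed
  then obtain x where lim: "X \<longlonglongrightarrow> x"
    using Cauchy_convergent convergent_def by blast
  have "(\<lambda>n. q (X n)) \<longlonglongrightarrow> q x"
    unfolding q_def by (intro tendsto_intros tendsto lim) simp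
  moreover have "(\<lambda>n. I + inverse (real (Suc n))) \<longlonglongrightarrow> I"
    by (rule LIMSEQ_inverse_real_of_nat_add)
  ultimately have "q x \<le> I"
    by (rule LIMSEQ_le) (use X less_imp_le in blast)
  then have min: "q x \<le> q y" for y using I_le[of y] by linarith
  have "\<phi> h = inner h x" for h
  proof -
    have *: "0 \<le> t * (inner h x - \<phi> h) + t\<^sup>2 * ((norm h)\<^sup>2 / 2)" for t
      using min[of "x + t *\<^sub>R h"] unfolding q_def power2_norm_eq_inner
      by (simp add: inner_add inner_commute scaleR add power2_eq_square field_simps)
    \<comment> \<open>The summand 1 keeps \<open>C\<close> positive also for \<open>h = 0\<close>
      and costs only an additional square of \<open>t\<close>.\<close>
    define B C where "B = inner h x - \<phi> h" and "C = (norm h)\<^sup>2 / 2 + 1"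
    have "t * B + t\<^sup>2 * C = (t * (inner h x - \<phi> h) + t\<^sup>2 * ((norm h)\<^sup>2 / 2)) + t\<^sup>2" for t
      by (simp add: B_def C_def algebra_simps)
    then have quad: "0 \<le> t * B + t\<^sup>2 * C" for t
      using * by simp
    have C: "C > 0" by (simp add: C_def add_nonneg_pos)
    from quad[of "- B / (2 * C)"] have "0 \<le> - B / (2 * C) * B + (- B / (2 * C))\<^sup>2 * C" .
    also have "- B / (2 * C) * B + (- B / (2 * C))\<^sup>2 * C = - (B\<^sup>2 / (4 * C))"
      using C by (simp add: power2_eq_square field_simps)
    finally have "B\<^sup>2 / (4 * C) \<le> 0" by simp
    with C have "B\<^sup>2 \<le> 0" by (simp add: divide_le_0_iff)
    then show ?thesis by (simp add: B_def)
  qed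
  then show ?thesis using that by blast
qed

text \<open>The vector that represents the real part represents the whole functional, because the
  imaginary part at \<open>h\<close> is the real part at -i times \<open>h\<close>.\<close>

lemma riesz:
  fixes \<phi> :: "'a::complex_hilbert_space \<Rightarrow> complex"
  assumes "bounded_linear \<phi>" and "\<And>c x. \<phi> (c *\<^sub>C x) = c * \<phi> x"
  obtains x where "\<And>h. \<phi> h = cinner h x"
proof -
  have "bounded_linear (\<lambda>x. Re (\<phi> x))"
    by (rule bounded_linear_compose[OF bounded_linear_Re assms(1)])
  then obtain x where x: "\<And>h. Re (\<phi> h) = inner h x"
    using riesz_real by blast
  have "\<phi> h = cinner h x" for h
  proof (rule complex_eqI)
    show "Re (\<phi> h) = Re (cinner h x)" by (simp add: x inner_eq_Re_cinner)
    have "Re (\<phi> ((-\<i>) *\<^sub>C h)) = Re (cinner ((-\<i>) *\<^sub>C h) x)" by (simp only: x inner_eq_Re_cinner)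
    then show "Im (\<phi> h) = Im (cinner h x)"
      by (simp only: assms(2) cinner_scaleC_left) simp
  qed
  then show ?thesis using that by blast
qed

lemma hadj_UNIV_eqI:
  assumes "\<And>h. q (A h) y = cinner h x"
  shows "hadj UNIV cinner q A y = x"
  unfolding hadj_def
proof (rule the_equality)
  show "x \<in> UNIV \<and> (\<forall>h\<in>UNIV. q (A h) y = cinner h x)" using assms by simp
  fix x' assume "x' \<in> UNIV \<and> (\<forall>h\<in>UNIV. q (A h) y = cinner h x')"
  then show "x' = x" using assms by (metis UNIV_I cinner_eqI)
qed

context
  fixes A :: "'a::complex_hilbert_space \<Rightarrow> 'b::complex_hilbert_space"
  assumes A: "bounded_clinear A"
begin

lemma cadj: "cinner (A h) y = cinner h (cadj A y)"
proof -
  have "bounded_linear (\<lambda>h. cinner (A h) y)"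
    using A bounded_linear_compose[OF bounded_linear_cinner_left] bounded_clinear_def by blast
  then obtain x where x: "\<And>h. cinner (A h) y = cinner h x"
    by (rule riesz) (auto simp: clinear_scaleC[OF A] cinner_scaleC_left)
  then show ?thesis
    using hadj_UNIV_eqI[of cinner A, OF x] by simp
qed

lemma bounded_clinear_cadj: "bounded_clinear (cadj A)"
proof -
  obtain K where K: "K > 0" "\<And>x. norm (A x) \<le> norm x * K"
    using A by (metis bounded_clinear_pos_bound)
  show ?thesis
  proof (rule bounded_clinearI)
    show "cadj A (x + y) = cadj A x + cadj A y" for x y
      by (rule cinner_eqI) (simp add: cadj[symmetric] cinner.add_right)
    show "cadj A (c *\<^sub>C x) = c *\<^sub>C cadj A x" for c x
      by (rule cinner_eqI) (simp add: cadj[symmetric] cinner.scaleC_right)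
    show "norm (cadj A x) \<le> norm x * K" for x
    proof -
      have "(norm (cadj A x))\<^sup>2 = cmod (cinner (A (cadj A x)) x)"
        by (simp add: cadj cinner_self norm_power)
      also have "\<dots> \<le> norm (A (cadj A x)) * norm x" by (rule norm_cinner_le)
      also have "\<dots> \<le> norm (cadj A x) * K * norm x" by (intro mult_right_mono K) auto
      finally show ?thesis
        using K(1) by (cases "cadj A x = 0") (auto simp: power2_eq_square algebra_simps)
    qed
  qed
qed

end

section \<open>Square roots of positive operators\<close>

text \<open>A scalar product equivalent to that of the type, with constants of equivalence
  \<open>m\<close> and \<open>K\<close>: limits and completeness come from the type, while adjoints,
  positivity and contractivity refer to \<open>p\<close>.\<close>

locale hilbert_form = psd_form p for p :: "'a::complex_hilbert_space \<Rightarrow> 'a \<Rightarrow> complex" +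
  fixes m K :: real
  assumes m_pos: "m > 0"
    and lower: "m * (norm x)\<^sup>2 \<le> Re (p x x)"
    and upper: "cmod (p x y) \<le> K * norm x * norm y"
begin

definition pn :: "'a \<Rightarrow> real" where "pn x = sqrt (Re (p x x))"

lemma pn_nonneg [simp]: "0 \<le> pn x"
  by (simp add: pn_def nonneg)

lemma pn_power2: "(pn x)\<^sup>2 = Re (p x x)"
  by (simp add: pn_def nonneg)

lemma p_self: "p x x = of_real ((pn x)\<^sup>2)"
  unfolding pn_power2 by (rule self_real)

lemma p_le_pn: "cmod (p x y) \<le> pn x * pn y"
  using cauchy_schwarz[of x y]
  by (simp add: pn_power2[symmetric] power_mult_distrib[symmetric] abs_le_square_iff[symmetric] abs_mult)

lemma pn_triangle: "pn (x + y) \<le> pn x + pn y"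
proof (rule power2_le_imp_le)
  have "Re (p x y) \<le> pn x * pn y" "Re (p y x) \<le> pn x * pn y"
    using p_le_pn[of x y] p_le_pn[of y x] complex_Re_le_cmod order_trans
    by (auto simp: mult.commute)
  then have "Re (p (x + y) (x + y)) \<le> (pn x)\<^sup>2 + 2 * (pn x * pn y) + (pn y)\<^sup>2"
    by (simp add: add_left add_right pn_power2)
  then show "(pn (x + y))\<^sup>2 \<le> (pn x + pn y)\<^sup>2"
    by (simp add: pn_power2 power2_sum)
qed simp

lemma pn_scaleR: "pn (t *\<^sub>R x) = \<bar>t\<bar> * pn x"
  by (simp add: pn_def scaleR_left scaleR_right mult.assoc[symmetric] real_sqrt_mult)

lemma pn_zero [simp]: "pn 0 = 0"
  by (simp add: pn_def)

lemma norm_le_pn: "norm x \<le> pn x / sqrt m"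
proof -
  have "(sqrt m * norm x)\<^sup>2 \<le> (pn x)\<^sup>2"
    using lower[of x] m_pos by (simp add: pn_power2 power_mult_distrib)
  then have "sqrt m * norm x \<le> pn x" by (rule power2_le_imp_le) simp
  then show ?thesis using m_pos by (simp add: field_simps)
qed

lemma pn_le_norm: "pn x \<le> sqrt \<bar>K\<bar> * norm x"
proof (rule power2_le_imp_le)
  have "Re (p x x) \<le> K * (norm x)\<^sup>2"
    using upper[of x x] complex_Re_le_cmod[of "p x x"] by (simp add: power2_eq_square mult.assoc)
  also have "\<dots> \<le> \<bar>K\<bar> * (norm x)\<^sup>2" by (intro mult_right_mono) auto
  finally show "(pn x)\<^sup>2 \<le> (sqrt \<bar>K\<bar> * norm x)\<^sup>2"
    by (simp add: pn_power2 power_mult_distrib)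
qed simp

lemma eqI: "(\<And>h. p h x = p h y) \<Longrightarrow> x = y"
proof -
  assume "\<And>h. p h x = p h y"
  then have "p (x - y) (x - y) = 0" by (simp add: diff_right)
  then show "x = y" using lower[of "x - y"] m_pos by (simp add: mult_le_0_iff)
qed

lemma bounded_bilinear: "bounded_bilinear p"
proof
  show "\<exists>K. \<forall>a b. norm (p a b) \<le> norm a * norm b * K"
    using upper by (intro exI[of _ K]) (simp add: mult_ac)
qed (auto simp: add_left add_right scaleR_left scaleR_right scaleR_conv_of_real)

lemma hadj_eqI: "(\<And>h. q (A h) y = p h x) \<Longrightarrow> hadj UNIV p q A y = x"
  unfolding hadj_def
proof (rule the_equality)
  assume *: "\<And>h. q (A h) y = p h x"
  then show "x \<in> UNIV \<and> (\<forall>h\<in>UNIV. q (A h) y = p h x)" by simp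
  fix x' assume "x' \<in> UNIV \<and> (\<forall>h\<in>UNIV. q (A h) y = p h x')"
  then show "x' = x" using * by (metis UNIV_I eqI)
qed

text \<open>Polarisation: \<open>positive_op\<close> only asks for real non-negative values on the
  diagonal, and evaluating at \<open>x + y\<close> and \<open>x + \<i> *\<^sub>C y\<close> yields
  Hermitian symmetry.\<close>

lemma positive_op_psd:
  assumes "positive_op p A"
  shows "psd_form (\<lambda>x y. p (A x) y)"
proof -
  have A: "bounded_clinear A" and pos: "\<And>x. p (A x) x \<in> \<real>\<^sub>\<ge>\<^sub>0"
    using assms by (auto simp: positive_op_def)
  have Im0: "Im (p (A x) x) = 0" for x using pos[of x] by (auto simp: complex_nonneg_Reals_iff)
  show ?thesis
  proof
    fix x y
    have 1: "Im (p (A x) y) + Im (p (A y) x) = 0"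
      using Im0[of "x + y"] Im0[of x] Im0[of y] by (simp add: clinear_add[OF A] add_left add_right)
    have 2: "Re (p (A y) x) - Re (p (A x) y) = 0"
      using Im0[of "x + \<i> *\<^sub>C y"] Im0[of x] Im0[of y]
      by (simp add: clinear_add[OF A] add_left add_right clinear_scaleC[OF A] scaleC_left scaleC_right)
    show "p (A x) y = cnj (p (A y) x)"
      using 1 2 by (simp add: complex_eq_iff)
    show "0 \<le> Re (p (A x) x)" using pos[of x] by (simp add: complex_nonneg_Reals_iff)
  qed (auto simp: clinear_add[OF A] clinear_scaleC[OF A] add_left scaleC_left)
qed

lemma positive_op_hermitian:
  assumes "positive_op p A"
  shows "p (A x) y = p x (A y)"
  using psd_form.commute[OF positive_op_psd[OF assms], of x y] commute[of x "A y"] by simp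

lemma positive_op_bound:
  assumes "positive_op p A"
  obtains L where "L > 0" "\<And>x. Re (p (A x) x) \<le> L * Re (p x x)"
proof -
  obtain N where N: "N > 0" "\<And>x. norm (A x) \<le> norm x * N"
    using assms bounded_clinear_pos_bound unfolding positive_op_def by metis
  have "Re (p (A x) x) \<le> (\<bar>K\<bar> * N / m + 1) * Re (p x x)" for x
  proof -
    have "Re (p (A x) x) \<le> K * norm (A x) * norm x"
      using upper[of "A x" x] complex_Re_le_cmod[of "p (A x) x"] by linarith
    also have "\<dots> \<le> \<bar>K\<bar> * (norm x * N) * norm x"
      by (intro mult_right_mono mult_mono N) auto
    also have "\<dots> = \<bar>K\<bar> * N / m * (m * (norm x)\<^sup>2)"
      using m_pos by (simp add: power2_eq_square)
    also have "\<dots> \<le> \<bar>K\<bar> * N / m * Re (p x x)"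
      by (intro mult_left_mono lower) (use N m_pos in auto)
    also have "\<dots> \<le> (\<bar>K\<bar> * N / m + 1) * Re (p x x)"
      by (intro mult_right_mono nonneg) auto
    finally show ?thesis .
  qed
  moreover have "\<bar>K\<bar> * N / m + 1 > 0"
    using N m_pos by (simp add: add_nonneg_pos)
  ultimately show ?thesis using that by blast
qed

end

text \<open>The iteration for \<open>1 - \<surd>(1 - S)\<close>; \<open>sqrt_majorant\<close> is the same iteration at the scalar \<open>S = 1\<close>.\<close>

primrec sqrt_seq :: "('a::complex_hilbert_space \<Rightarrow> 'a) \<Rightarrow> nat \<Rightarrow> 'a \<Rightarrow> 'a" where
  "sqrt_seq S 0 = (\<lambda>v. 0)"
| "sqrt_seq S (Suc n) = (\<lambda>v. (1/2) *\<^sub>R (S v + sqrt_seq S n (sqrt_seq S n v)))"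

primrec sqrt_majorant :: "nat \<Rightarrow> real" where
  "sqrt_majorant 0 = 0"
| "sqrt_majorant (Suc n) = (1 + (sqrt_majorant n)\<^sup>2) / 2"

lemma sqrt_majorant_bounds: "0 \<le> sqrt_majorant n \<and> sqrt_majorant n \<le> 1"
  by (induction n) (auto simp: power2_eq_square mult_le_one)

lemma incseq_sqrt_majorant: "incseq sqrt_majorant"
proof (rule incseq_SucI)
  show "sqrt_majorant n \<le> sqrt_majorant (Suc n)" for n
    using zero_le_power2[of "sqrt_majorant n - 1"] by (simp add: power2_eq_square algebra_simps)
qed

lemma convergent_sqrt_majorant: "convergent sqrt_majorant"
  using incseq_convergent[OF incseq_sqrt_majorant, of 1] sqrt_majorant_bounds
  by (metis convergent_def)

text \<open>Every iterate is a polynomial in \<open>S\<close>. Since \<open>R\<close> may act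
  between different spaces, this is the origin of all intertwining of square roots below.\<close>

lemma sqrt_seq_intertwine:
  assumes R: "bounded_clinear R" and RS: "\<And>v. R (S v) = S' (R v)"
  shows "R (sqrt_seq S n v) = sqrt_seq S' n (R v)"
  by (induction n arbitrary: v)
    (simp_all add: clinear_zero[OF R] clinear_scaleR[OF R] clinear_add[OF R] RS)

definition sqrt_lim :: "('a::complex_hilbert_space \<Rightarrow> 'a) \<Rightarrow> 'a \<Rightarrow> 'a" where
  "sqrt_lim S v = lim (\<lambda>n. sqrt_seq S n v)"

text \<open>For S = 1 - A/L the iteration tends to 1 - sqrt(1 - S) = 1 - sqrt(A/L), so the root of
  \<open>A\<close> results after rescaling. The scale \<open>L\<close> is a parameter because two
  operators can be compared only if both use the same one.\<close>

definition psqrt :: "real \<Rightarrow> ('a::complex_hilbert_space \<Rightarrow> 'a) \<Rightarrow> 'a \<Rightarrow> 'a" where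
  "psqrt L A v = sqrt L *\<^sub>R (v - sqrt_lim (\<lambda>v. v - (1 / L) *\<^sub>R A v) v)"

section \<open>Convergence of the square root iteration for a Hermitian contraction\<close>

locale sqrt_iteration = hilbert_form +
  fixes S
  assumes S: "bounded_clinear S" and S_herm: "\<And>x y. p (S x) y = p x (S y)"
    and S_le: "\<And>x. pn (S x) \<le> pn x"
begin

abbreviation "X \<equiv> sqrt_seq S"

lemma bounded_clinear_X: "bounded_clinear (X n)"
proof (induction n)
  case (Suc n)
  show ?case
    unfolding sqrt_seq.simps
    by (intro bounded_clinear_scaleR bounded_clinear_add S bounded_clinear_compose[OF Suc Suc])
qed (simp add: bounded_clinear_zero)

lemma X_S: "X n (S v) = S (X n v)"
  by (rule sqrt_seq_intertwine[OF S, symmetric]) simp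

lemma X_X: "X n (X k v) = X k (X n v)"
  by (rule sqrt_seq_intertwine[OF bounded_clinear_X]) (simp add: X_S)

lemma X_herm: "p (X n v) w = p v (X n w)"
  by (induction n arbitrary: v w)
    (auto simp: scaleR_left scaleR_right add_left add_right S_herm)

lemma pn_X: "pn (X n v) \<le> sqrt_majorant n * pn v"
proof (induction n arbitrary: v)
  case (Suc n)
  have "pn (X (Suc n) v) \<le> (pn (S v) + pn (X n (X n v))) / 2"
    using pn_triangle[of "S v" "X n (X n v)"] by (simp add: pn_scaleR)
  moreover have "pn (X n (X n v)) \<le> sqrt_majorant n * (sqrt_majorant n * pn v)"
    by (rule order_trans[OF Suc mult_left_mono[OF Suc]]) (simp add: sqrt_majorant_bounds)
  ultimately show ?case
    using S_le[of v] by (simp add: power2_eq_square algebra_simps)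
qed simp

text \<open>Since the iterates commute, consecutive differences factor as X_(n+2) - X_(n+1) =
  (X_(n+1) + X_n)(X_(n+1) - X_n)/2. The majorant obeys the same recursion, so the increments are
  dominated by those of a convergent monotone real sequence.\<close>

lemma pn_X_diff: "pn (X (Suc n) v - X n v) \<le> (sqrt_majorant (Suc n) - sqrt_majorant n) * pn v"
proof (induction n arbitrary: v)
  case 0
  then show ?case using S_le[of v] by (simp add: pn_scaleR)
next
  case (Suc n)
  let ?s = sqrt_majorant
  define w where "w = X (Suc n) v - X n v"
  have "X (Suc (Suc n)) v - X (Suc n) v = (1/2) *\<^sub>R (X (Suc n) (X (Suc n) v) - X n (X n v))"
    unfolding sqrt_seq.simps(2)[of S "Suc n"] sqrt_seq.simps(2)[of S n]
    by (simp add: scaleR_right_diff_distrib[symmetric] del: sqrt_seq.simps)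
  also have "X (Suc n) (X (Suc n) v) - X n (X n v) = X (Suc n) w + X n w"
    unfolding w_def by (simp add: clinear_diff[OF bounded_clinear_X] X_X[of n "Suc n"] del: sqrt_seq.simps)
  finally have "pn (X (Suc (Suc n)) v - X (Suc n) v) \<le> (pn (X (Suc n) w) + pn (X n w)) / 2"
    using pn_triangle[of "X (Suc n) w" "X n w"] by (simp add: pn_scaleR del: sqrt_seq.simps)
  also have "\<dots> \<le> (?s (Suc n) * pn w + ?s n * pn w) / 2"
    using pn_X[of "Suc n" w] pn_X[of n w] by (intro divide_right_mono add_mono) auto
  also have "\<dots> = (?s (Suc n) + ?s n) / 2 * pn w" by (simp add: algebra_simps)
  also have "\<dots> \<le> (?s (Suc n) + ?s n) / 2 * ((?s (Suc n) - ?s n) * pn v)"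
    using sqrt_majorant_bounds Suc[of v] unfolding w_def
    by (intro mult_left_mono) (auto simp del: sqrt_seq.simps sqrt_majorant.simps)
  also have "\<dots> = (?s (Suc (Suc n)) - ?s (Suc n)) * pn v"
    unfolding sqrt_majorant.simps(2)[of "Suc n"]
    by (subst (4) sqrt_majorant.simps(2)) (simp add: power2_eq_square field_simps del: sqrt_majorant.simps)
  finally show ?case .
qed

lemma pn_X_diff_le: "n \<le> k \<Longrightarrow> pn (X k v - X n v) \<le> (sqrt_majorant k - sqrt_majorant n) * pn v"
proof (induction k rule: dec_induct)
  case (step k)
  have "pn (X (Suc k) v - X n v) \<le> pn (X (Suc k) v - X k v) + pn (X k v - X n v)"
    using pn_triangle[of "X (Suc k) v - X k v" "X k v - X n v"] by (simp del: sqrt_seq.simps)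
  also have "\<dots> \<le> (sqrt_majorant (Suc k) - sqrt_majorant n) * pn v"
    using pn_X_diff[of k v] step by (simp add: algebra_simps del: sqrt_seq.simps sqrt_majorant.simps)
  finally show ?case .
qed simp

lemma tendsto_sqrt_lim: "(\<lambda>n. X n v) \<longlonglongrightarrow> sqrt_lim S v"
proof -
  have "Cauchy (\<lambda>n. X n v)"
  proof (rule metric_CauchyI)
    fix e :: real assume e: "e > 0"
    \<comment> \<open>The factor \<open>sqrt m\<close> converts \<open>pn\<close> back to
      \<open>norm\<close>; adding 1 avoids division by zero for \<open>v = 0\<close>.\<close>
    define e' where "e' = e * sqrt m / (pn v + 1)"
    have pv: "pn v + 1 > 0" by (simp add: add_nonneg_pos)
    have e': "e' > 0" using e m_pos pv by (simp add: e'_def)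
    obtain N where N: "\<And>i j. i \<ge> N \<Longrightarrow> j \<ge> N \<Longrightarrow> dist (sqrt_majorant i) (sqrt_majorant j) < e'"
      using convergent_Cauchy[OF convergent_sqrt_majorant] e' unfolding Cauchy_def by blast
    have *: "dist (X k v) (X n v) < e" if "n \<ge> N" "k \<ge> n" for n k
    proof -
      have "sqrt_majorant k - sqrt_majorant n < e'"
        using N[of k n] that by (simp add: dist_real_def)
      then have "(sqrt_majorant k - sqrt_majorant n) * pn v \<le> e' * pn v"
        by (intro mult_right_mono) auto
      also have "\<dots> < e' * (pn v + 1)" using e' by simp
      also have "\<dots> = e * sqrt m" using pv by (simp add: e'_def)
      finally have "pn (X k v - X n v) < e * sqrt m"
        using pn_X_diff_le[OF that(2), of v] by simp
      then have "norm (X k v - X n v) * sqrt m < e * sqrt m"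
        using norm_le_pn[of "X k v - X n v"] m_pos unfolding pos_le_divide_eq[OF real_sqrt_gt_zero[OF m_pos]]
        by linarith
      then show ?thesis using m_pos by (simp add: dist_norm)
    qed
    have "dist (X k v) (X n v) < e" if "n \<ge> N" "k \<ge> N" for n k
      using *[of n k] *[of k n] that by (cases "n \<le> k") (auto simp: dist_commute)
    then show "\<exists>M. \<forall>m\<ge>M. \<forall>n\<ge>M. dist (X m v) (X n v) < e" by blast
  qed
  then show ?thesis
    unfolding sqrt_lim_def by (simp add: Cauchy_convergent_iff convergent_LIMSEQ_iff)
qed

abbreviation "L \<equiv> sqrt_lim S"

lemma tendsto_pn: "f \<longlonglongrightarrow> l \<Longrightarrow> (\<lambda>n. pn (f n)) \<longlonglongrightarrow> pn l"
  unfolding pn_def by (intro tendsto_intros bounded_bilinear.tendsto[OF bounded_bilinear])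

lemma pn_L: "pn (L v) \<le> pn v"
proof (rule LIMSEQ_le_const2[OF tendsto_pn[OF tendsto_sqrt_lim]])
  have "pn (X n v) \<le> pn v" for n
    using pn_X[of n v] mult_right_mono[of "sqrt_majorant n" 1 "pn v"] sqrt_majorant_bounds[of n] by simp
  then show "\<exists>N. \<forall>n\<ge>N. pn (X n v) \<le> pn v" by blast
qed

lemma bounded_clinear_L: "bounded_clinear L"
proof (rule bounded_clinearI)
  show "L (x + y) = L x + L y" for x y
    using tendsto_add[OF tendsto_sqrt_lim[of x] tendsto_sqrt_lim[of y]] tendsto_sqrt_lim[of "x + y"]
    by (simp add: clinear_add[OF bounded_clinear_X] LIMSEQ_unique)
  show "L (c *\<^sub>C x) = c *\<^sub>C L x" for c x
    using clinear_tendsto[OF bounded_clinear_scaleC tendsto_sqrt_lim[of x], of c] tendsto_sqrt_lim[of "c *\<^sub>C x"]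
    by (simp add: clinear_scaleC[OF bounded_clinear_X] LIMSEQ_unique)
  fix x
  have "norm (L x) \<le> pn x / sqrt m"
    using norm_le_pn[of "L x"] divide_right_mono[OF pn_L[of x], of "sqrt m"] m_pos by simp
  also have "\<dots> \<le> sqrt \<bar>K\<bar> * norm x / sqrt m"
    using pn_le_norm m_pos by (intro divide_right_mono) auto
  finally show "norm (L x) \<le> norm x * (sqrt \<bar>K\<bar> / sqrt m)" by (simp add: mult.commute)
qed

lemma L_herm: "p (L v) w = p v (L w)"
proof -
  have "(\<lambda>n. p (X n v) w) \<longlonglongrightarrow> p (L v) w" "(\<lambda>n. p v (X n w)) \<longlonglongrightarrow> p v (L w)"
    by (intro bounded_bilinear.tendsto[OF bounded_bilinear] tendsto_sqrt_lim tendsto_const)+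
  then show ?thesis unfolding X_herm using LIMSEQ_unique by blast
qed

lemma L_eq: "L v = (1/2) *\<^sub>R (S v + L (L v))"
proof -
  \<comment> \<open>Pointwise convergence passes to the product \<open>X n (X n v)\<close> because
    the iterates are uniformly bounded: the part \<open>X n (L v)\<close> converges by itself and
    only this difference has to vanish.\<close>
  have "(\<lambda>n. X n (X n v - L v)) \<longlonglongrightarrow> 0"
  proof (rule Lim_null_comparison)
    have "norm (X n w) \<le> pn w / sqrt m" for n w
    proof -
      have "pn (X n w) \<le> pn w"
        using pn_X[of n w] mult_right_mono[of "sqrt_majorant n" 1 "pn w"] sqrt_majorant_bounds[of n] by simp
      then show ?thesis
        using norm_le_pn[of "X n w"] divide_right_mono[of "pn (X n w)" "pn w" "sqrt m"] m_pos by simp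
    qed
    then show "\<forall>\<^sub>F n in sequentially. norm (X n (X n v - L v)) \<le> pn (X n v - L v) / sqrt m"
      by simp
    have "(\<lambda>n. pn (X n v - L v)) \<longlonglongrightarrow> pn (L v - L v)"
      by (intro tendsto_pn tendsto_diff tendsto_sqrt_lim tendsto_const)
    then have "(\<lambda>n. pn (X n v - L v) / sqrt m) \<longlonglongrightarrow> pn (L v - L v) / sqrt m"
      by (intro tendsto_divide tendsto_const) (use m_pos in auto)
    then show "(\<lambda>n. pn (X n v - L v) / sqrt m) \<longlonglongrightarrow> 0" by simp
  qed
  from tendsto_add[OF this tendsto_sqrt_lim[of "L v"]]
  have "(\<lambda>n. X n (X n v)) \<longlonglongrightarrow> L (L v)"
    by (simp add: clinear_diff[OF bounded_clinear_X])
  then have "(\<lambda>n. X (Suc n) v) \<longlonglongrightarrow> (1/2) *\<^sub>R (S v + L (L v))"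
    by (auto intro!: tendsto_intros)
  moreover have "(\<lambda>n. X (Suc n) v) \<longlonglongrightarrow> L v"
    using tendsto_sqrt_lim by (rule LIMSEQ_Suc)
  ultimately show ?thesis using LIMSEQ_unique by blast
qed

end

text \<open>For contractivity, S = 1 - A/l defines a semidefinite form dominated by
  \<open>p\<close>. Its Cauchy-Schwarz inequality at \<open>x\<close> and S x bounds the fourth
  power of the length of S x by the product of the squared lengths of \<open>x\<close> and S
  x.\<close>

lemma (in hilbert_form) sqrt_iterationI:
  assumes A: "positive_op p A" and l: "l > 0" and le: "\<And>x. Re (p (A x) x) \<le> l * Re (p x x)"
  shows "sqrt_iteration p m K (\<lambda>v. v - (1 / l) *\<^sub>R A v)"
proof
  let ?S = "\<lambda>v. v - (1 / l) *\<^sub>R A v"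
  have Ab: "bounded_clinear A" using A by (simp add: positive_op_def)
  show S: "bounded_clinear ?S"
    by (intro bounded_clinear_diff bounded_clinear_ident bounded_clinear_scaleR Ab)
  have pA: "psd_form (\<lambda>x y. p (A x) y)" by (rule positive_op_psd[OF A])
  show herm: "p (?S x) y = p x (?S y)" for x y
    by (simp add: diff_left diff_right scaleR_left scaleR_right positive_op_hermitian[OF A])
  have q: "psd_form (\<lambda>x y. p (?S x) y)"
  proof
    show "p (?S x) y = cnj (p (?S y) x)" for x y
      by (subst herm) (rule commute)
    show "0 \<le> Re (p (?S x) x)" for x
      using le[of x] l by (simp add: diff_left scaleR_left field_simps)
  qed (auto simp: clinear_add[OF S] clinear_scaleC[OF S] add_left scaleC_left)
  have le1: "Re (p (?S x) x) \<le> Re (p x x)" for x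
    using psd_form.nonneg[OF pA, of x] l by (simp add: diff_left scaleR_left)
  show "pn (?S x) \<le> pn x" for x
  proof -
    define w where "w = ?S x"
    have "(cmod (p (?S x) w))\<^sup>2 \<le> Re (p (?S x) x) * Re (p (?S w) w)"
      by (rule psd_form.cauchy_schwarz[OF q])
    also have "\<dots> \<le> Re (p x x) * Re (p w w)"
      using psd_form.nonneg[OF q] by (intro mult_mono le1) (auto simp: nonneg)
    finally have "((pn w)\<^sup>2)\<^sup>2 \<le> (pn x)\<^sup>2 * (pn w)\<^sup>2"
      unfolding w_def[symmetric] p_self by (simp add: norm_power)
    then have "(pn w)\<^sup>2 \<le> (pn x)\<^sup>2"
      by (cases "pn w = 0") (simp, simp only: power2_eq_square[of "(pn w)\<^sup>2"] mult_le_cancel_right, simp)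
    then show ?thesis unfolding w_def by (rule power2_le_imp_le) simp
  qed
qed

section \<open>Existence, uniqueness and intertwining of positive square roots\<close>

context hilbert_form
begin

context
  fixes A l
  assumes A: "positive_op p A" and l: "l > 0" and le: "\<And>x. Re (p (A x) x) \<le> l * Re (p x x)"
begin

interpretation si: sqrt_iteration p m K "\<lambda>v. v - (1 / l) *\<^sub>R A v"
  by (rule sqrt_iterationI[OF A l le])

lemma psqrt_square: "psqrt l A (psqrt l A v) = A v"
proof -
  \<comment> \<open>The fixed point equation L = (S + L L)/2 is equivalent to (1 - L)(1 - L) = 1 -
    S, which is A/l.\<close>
  have "2 *\<^sub>R si.L v = 2 *\<^sub>R (1/2) *\<^sub>R (v - (1 / l) *\<^sub>R A v + si.L (si.L v))"
    by (rule arg_cong[OF si.L_eq])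
  then have "2 *\<^sub>R si.L v = v - (1 / l) *\<^sub>R A v + si.L (si.L v)" by simp
  then have "v - si.L v - si.L (v - si.L v) = (1 / l) *\<^sub>R A v"
    by (simp add: clinear_diff[OF si.bounded_clinear_L] scaleR_2 algebra_simps)
  then show ?thesis
    using l by (simp add: psqrt_def clinear_scaleR[OF si.bounded_clinear_L]
        scaleR_right_diff_distrib[symmetric])
qed

lemma positive_op_psqrt: "positive_op p (psqrt l A)"
  unfolding positive_op_def
proof (intro conjI allI)
  show "bounded_clinear (psqrt l A)"
    unfolding psqrt_def[abs_def]
    by (intro bounded_clinear_scaleR bounded_clinear_diff bounded_clinear_ident si.bounded_clinear_L)
  fix x
  have "p (si.L x) x = cnj (p (si.L x) x)"
    using si.L_herm[of x x] commute[of x "si.L x"] by simp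
  then have "Im (p (si.L x) x) = 0" by (simp add: complex_eq_iff)
  moreover have "Im (p x x) = 0" using self_real[of x] by (simp add: complex_eq_iff)
  moreover have "Re (p (si.L x) x) \<le> Re (p x x)"
  proof -
    have "Re (p (si.L x) x) \<le> pn (si.L x) * pn x"
      using p_le_pn[of "si.L x" x] complex_Re_le_cmod order_trans by blast
    also have "\<dots> \<le> pn x * pn x" by (intro mult_right_mono si.pn_L) simp
    finally show ?thesis by (simp add: pn_power2[symmetric] power2_eq_square)
  qed
  ultimately show "p (psqrt l A x) x \<in> \<real>\<^sub>\<ge>\<^sub>0"
    using l by (simp add: psqrt_def scaleR_left diff_left complex_nonneg_Reals_iff)
qed

end

lemma psqrt_intertwine:
  assumes A: "positive_op p A" and l: "l > 0" and le: "\<And>x. Re (p (A x) x) \<le> l * Re (p x x)"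
    and q: "hilbert_form q m' K'"
    and A': "positive_op q A'" and le': "\<And>x. Re (q (A' x) x) \<le> l * Re (q x x)"
    and R: "bounded_clinear R" and RA: "\<And>v. R (A v) = A' (R v)"
  shows "R (psqrt l A v) = psqrt l A' (R v)"
proof -
  interpret q: hilbert_form q m' K' by fact
  interpret s: sqrt_iteration p m K "\<lambda>v. v - (1 / l) *\<^sub>R A v"
    by (rule sqrt_iterationI[OF A l le])
  interpret s': sqrt_iteration q m' K' "\<lambda>v. v - (1 / l) *\<^sub>R A' v"
    by (rule q.sqrt_iterationI[OF A' l le'])
  have "R (s.X n v) = s'.X n (R v)" for n
    by (rule sqrt_seq_intertwine[OF R]) (simp add: clinear_diff[OF R] clinear_scaleR[OF R] RA)
  then have "R (s.L v) = s'.L (R v)"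
    using clinear_tendsto[OF R s.tendsto_sqrt_lim[of v]] s'.tendsto_sqrt_lim[of "R v"]
    by (simp add: LIMSEQ_unique)
  then show ?thesis
    by (simp add: psqrt_def clinear_diff[OF R] clinear_scaleR[OF R])
qed

text \<open>\<open>B\<close> commutes with its square and hence with the iterative root Q, so B + Q
  annihilates y = B v - Q v. Both forms are non-negative at y, thus B y = Q y = 0, and moving
  \<open>B\<close> and Q to the other side shows that y is orthogonal to itself.\<close>

lemma positive_sqrt_unique:
  assumes B: "positive_op p B" and l: "l > 0" and le: "\<And>x. Re (p (B (B x)) x) \<le> l * Re (p x x)"
  shows "B v = psqrt l (\<lambda>v. B (B v)) v"
proof -
  let ?A = "\<lambda>v. B (B v)"
  let ?Q = "psqrt l ?A"
  have Bb: "bounded_clinear B" using B by (simp add: positive_op_def)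
  have A: "positive_op p ?A"
    using bounded_clinear_compose[OF Bb Bb] positive_op_hermitian[OF B]
    by (auto simp: positive_op_def complex_nonneg_Reals_iff nonneg p_self)
  have Q: "positive_op p ?Q" by (rule positive_op_psqrt[OF A l le])
  have com: "B (?Q v) = ?Q (B v)" for v
    by (rule psqrt_intertwine[OF A l le hilbert_form_axioms A le Bb]) simp
  define y where "y = B v - ?Q v"
  have Qb: "bounded_clinear ?Q" using Q by (simp add: positive_op_def)
  have "B y + ?Q y = 0"
    unfolding y_def
    by (simp add: clinear_diff[OF Bb] clinear_diff[OF Qb] com psqrt_square[OF A l le])
  then have "p (B y) y + p (?Q y) y = 0"
    by (metis add_left zero_left)
  then have "Re (p (B y) y) = 0" "Re (p (?Q y) y) = 0"
    using psd_form.nonneg[OF positive_op_psd[OF B], of y] psd_form.nonneg[OF positive_op_psd[OF Q], of y]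
    by (auto simp: complex_eq_iff)
  then have "p (B y) h = 0" "p (?Q y) h = 0" for h
    using psd_form.eq_zero_of_self_zero[OF positive_op_psd[OF B]]
      psd_form.eq_zero_of_self_zero[OF positive_op_psd[OF Q]] by blast+
  then have "p y (B v) = 0" "p y (?Q v) = 0"
    using positive_op_hermitian[OF B] positive_op_hermitian[OF Q] by metis+
  then have "p y y = 0" by (simp add: y_def diff_right)
  then have "y = 0" using lower[of y] m_pos by (simp add: mult_le_0_iff)
  then show ?thesis by (simp add: y_def)
qed

lemma op_sqrt:
  assumes A: "positive_op p A"
  shows "positive_op p (op_sqrt p A)" "op_sqrt p A (op_sqrt p A v) = A v"
proof -
  obtain l where l: "l > 0" "\<And>x. Re (p (A x) x) \<le> l * Re (p x x)"
    using positive_op_bound[OF A] by blast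
  have "\<exists>B. positive_op p B \<and> B \<circ> B = A"
    using positive_op_psqrt[OF A l] psqrt_square[OF A l] by (auto simp: fun_eq_iff)
  then have "positive_op p (op_sqrt p A) \<and> op_sqrt p A \<circ> op_sqrt p A = A"
    unfolding op_sqrt_def by (rule someI_ex)
  then show "positive_op p (op_sqrt p A)" "op_sqrt p A (op_sqrt p A v) = A v"
    by (auto simp: fun_eq_iff)
qed

text \<open>By uniqueness \<open>B\<close> and \<open>B'\<close> are the iterative roots of their
  squares, whatever way they were obtained, and iterative roots are intertwined.\<close>

lemma positive_sqrt_intertwine:
  assumes B: "positive_op p B" and q: "hilbert_form q m' K'" and B': "positive_op q B'"
    and R: "bounded_clinear R" and RB: "\<And>v. R (B (B v)) = B' (B' (R v))"
  shows "R (B v) = B' (R v)"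
proof -
  interpret q: hilbert_form q m' K' by fact
  have Bb: "bounded_clinear B" using B by (simp add: positive_op_def)
  have Bb': "bounded_clinear B'" using B' by (simp add: positive_op_def)
  have A: "positive_op p (\<lambda>v. B (B v))"
    using bounded_clinear_compose[OF Bb Bb] positive_op_hermitian[OF B]
    by (auto simp: positive_op_def complex_nonneg_Reals_iff nonneg p_self)
  have A': "positive_op q (\<lambda>v. B' (B' v))"
    using bounded_clinear_compose[OF Bb' Bb'] q.positive_op_hermitian[OF B']
    by (auto simp: positive_op_def complex_nonneg_Reals_iff q.nonneg q.p_self)
  obtain l1 where l1: "l1 > 0" "\<And>x. Re (p (B (B x)) x) \<le> l1 * Re (p x x)"
    using positive_op_bound[OF A] by blast
  obtain l2 where l2: "l2 > 0" "\<And>x. Re (q (B' (B' x)) x) \<le> l2 * Re (q x x)"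
    using q.positive_op_bound[OF A'] by blast
  \<comment> \<open>One scale for both squares, as the comparison of the two iterations
    requires.\<close>
  define l where "l = max l1 l2"
  have l: "l > 0" using l1 by (simp add: l_def)
  have le: "Re (p (B (B x)) x) \<le> l * Re (p x x)" for x
    using l1(2)[of x] mult_right_mono[OF _ nonneg[of x], of l1 l] by (simp add: l_def)
  have le': "Re (q (B' (B' x)) x) \<le> l * Re (q x x)" for x
    using l2(2)[of x] mult_right_mono[OF _ q.nonneg[of x], of l2 l] by (simp add: l_def)
  show ?thesis
    using psqrt_intertwine[OF A l le q A' le' R RB] 
      positive_sqrt_unique[OF B l le] q.positive_sqrt_unique[OF B' l le'] by metis
qed

end

interpretation cinner: hilbert_form cinner 1 1
  by standard (auto simp: cinner_self norm_cinner_le)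

section \<open>Multi-indices\<close>

lemma cinner_sum_left: "cinner (\<Sum>i\<in>I. f i) y = (\<Sum>i\<in>I. cinner (f i) y)"
  by (induction I rule: infinite_finite_induct) (auto simp: cinner.add_left)

lemma has_sum_sum_index:
  fixes f :: "'i \<Rightarrow> 'a \<Rightarrow> 'b::topological_comm_monoid_add"
  assumes "\<And>i. i \<in> I \<Longrightarrow> (f i has_sum s i) A"
  shows "((\<lambda>x. \<Sum>i\<in>I. f i x) has_sum (\<Sum>i\<in>I. s i)) A"
  using assms by (induction I rule: infinite_finite_induct) (auto intro: has_sum_add)

definition munit :: "'d::finite \<Rightarrow> nat ^ 'd"
  where "munit i = axis i 1"

lemma munit_nth [simp]: "munit i $ j = (if j = i then 1 else 0)"
  by (simp add: munit_def axis_def)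

lemma mabs_zero [simp]: "mabs 0 = 0"
  by (simp add: mabs_def)

lemma mabs_eq_0_iff [simp]: "mabs \<alpha> = 0 \<longleftrightarrow> \<alpha> = 0"
  by (simp add: mabs_def vec_eq_iff)

lemma mabs_add: "mabs (\<alpha> + \<beta>) = mabs \<alpha> + mabs \<beta>"
  by (simp add: mabs_def sum.distrib)

lemma mabs_munit [simp]: "mabs (munit i) = 1"
  by (simp add: mabs_def)

lemma mabs_add_munit [simp]: "mabs (\<alpha> + munit i) = Suc (mabs \<alpha>)"
  by (simp add: mabs_add)

lemma nth_le_mabs: "\<alpha> $ i \<le> mabs \<alpha>"
  unfolding mabs_def by (rule member_le_sum) auto

lemma diff_munit_add: "\<alpha> $ i > 0 \<Longrightarrow> \<alpha> - munit i + munit i = (\<alpha> :: nat ^ 'd::finite)"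
  by (auto simp: vec_eq_iff munit_nth)

lemma finite_mabs_eq: "finite {\<alpha> :: nat ^ 'd::finite. mabs \<alpha> = n}"
proof (rule finite_subset)
  show "{\<alpha> :: nat ^ 'd. mabs \<alpha> = n} \<subseteq> vec_lambda ` (UNIV \<rightarrow>\<^sub>E {..n})"
  proof
    fix \<alpha> :: "nat ^ 'd" assume "\<alpha> \<in> {\<alpha>. mabs \<alpha> = n}"
    then have "vec_nth \<alpha> \<in> UNIV \<rightarrow>\<^sub>E {..n}" using nth_le_mabs[of \<alpha>] by auto
    then show "\<alpha> \<in> vec_lambda ` (UNIV \<rightarrow>\<^sub>E {..n})" by (metis image_eqI vec_nth_inverse)
  qed
  show "finite (vec_lambda ` ((UNIV :: 'd set) \<rightarrow>\<^sub>E {..n}))"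
    by (intro finite_imageI finite_PiE) auto
qed

lemma mabs_induct [case_names zero add_munit]:
  fixes \<alpha> :: "nat ^ 'd::finite"
  assumes "P 0" and "\<And>\<alpha> i. P \<alpha> \<Longrightarrow> P (\<alpha> + munit i)"
  shows "P \<alpha>"
proof (induction "mabs \<alpha>" arbitrary: \<alpha>)
  case (Suc n)
  then have "\<alpha> \<noteq> 0" by auto
  then obtain i where i: "\<alpha> $ i > 0" by (auto simp: vec_eq_iff)
  have "mabs (\<alpha> - munit i + munit i) = Suc n" using Suc(2) diff_munit_add[OF i] by simp
  then have "n = mabs (\<alpha> - munit i)" unfolding mabs_add_munit by simp
  then show ?case using Suc(1) assms(2) diff_munit_add[OF i] by metis
qed (use assms in auto)

lemma prod_add_munit:
  fixes f :: "'d::finite \<Rightarrow> nat \<Rightarrow> 'a::comm_semiring_1"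
  assumes "f i (Suc (\<alpha> $ i)) = x * f i (\<alpha> $ i)"
  shows "(\<Prod>j\<in>UNIV. f j ((\<alpha> + munit i) $ j)) = x * (\<Prod>j\<in>UNIV. f j (\<alpha> $ j))"
proof -
  have "(\<Prod>j\<in>UNIV. f j ((\<alpha> + munit i) $ j)) = f i (Suc (\<alpha> $ i)) * (\<Prod>j\<in>UNIV - {i}. f j (\<alpha> $ j))"
    by (subst prod.remove[of _ i]) (auto simp: munit_nth intro!: prod.cong)
  also have "\<dots> = x * (f i (\<alpha> $ i) * (\<Prod>j\<in>UNIV - {i}. f j (\<alpha> $ j)))"
    by (simp add: assms mult.assoc)
  also have "f i (\<alpha> $ i) * (\<Prod>j\<in>UNIV - {i}. f j (\<alpha> $ j)) = (\<Prod>j\<in>UNIV. f j (\<alpha> $ j))"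
    by (subst (2) prod.remove[of _ i]) auto
  finally show ?thesis .
qed

lemma mpow_zero [simp]: "mpow z 0 = 1"
  by (simp add: mpow_def)

lemma mpow_add_munit: "mpow z (\<alpha> + munit i) = z $ i * mpow z \<alpha>"
  unfolding mpow_def by (rule prod_add_munit) simp

lemma mpow_mult: "mpow (\<chi> i. x $ i * y $ i) \<alpha> = mpow x \<alpha> * mpow y \<alpha>"
  by (simp add: mpow_def power_mult_distrib prod.distrib)

lemma mpow_scaleC: "mpow (t *\<^sub>C z) \<alpha> = t ^ mabs \<alpha> * mpow z \<alpha>"
  by (simp add: mpow_def scaleC_vec_def scaleC_complex_def power_mult_distrib prod.distrib mabs_def power_sum)

lemma mpow_distinct:
  fixes \<alpha> \<beta> :: "nat ^ 'b::finite"
  assumes "\<alpha> \<noteq> \<beta>"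
  obtains z where "mpow z \<alpha> \<noteq> mpow z \<beta>"
proof -
  obtain i where i: "\<alpha> $ i \<noteq> \<beta> $ i" using assms by (auto simp: vec_eq_iff)
  have "mpow (\<chi> j. if j = i then 2 else 1) \<gamma> = 2 ^ (\<gamma> $ i)" for \<gamma> :: "nat ^ 'b"
  proof -
    have "mpow (\<chi> j. if j = i then 2 else 1) \<gamma> = (\<Prod>j\<in>UNIV. if j = i then 2 ^ (\<gamma> $ i) else 1)"
      unfolding mpow_def by (rule prod.cong) auto
    then show ?thesis by simp
  qed
  moreover have "(2::complex) ^ (\<alpha> $ i) \<noteq> 2 ^ (\<beta> $ i)"
  proof
    assume "(2::complex) ^ (\<alpha> $ i) = 2 ^ (\<beta> $ i)"
    then have "of_nat (2 ^ (\<alpha> $ i)) = (of_nat (2 ^ (\<beta> $ i)) :: complex)" by simp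
    then have "(2::nat) ^ (\<alpha> $ i) = 2 ^ (\<beta> $ i)" using of_nat_eq_iff by blast
    then show False using i by simp
  qed
  ultimately show ?thesis using that by metis
qed

text \<open>Dedekind's argument: the monomials are pairwise distinct characters of the multiplicative
  monoid \<open>\<complex>\<^sup>d\<close>.\<close>

lemma mpow_independent:
  fixes u :: "nat ^ 'd::finite \<Rightarrow> 'h::complex_hilbert_space"
  assumes "finite A" and "\<And>z. (\<Sum>\<alpha>\<in>A. mpow z \<alpha> *\<^sub>C u \<alpha>) = 0" and "\<alpha> \<in> A"
  shows "u \<alpha> = 0"
  using assms
proof (induction A arbitrary: u \<alpha> rule: finite_induct)
  case (insert \<beta> A)
  have A0: "u \<alpha> = 0" if "\<alpha> \<in> A" for \<alpha>
  proof -
    have "\<alpha> \<noteq> \<beta>" using that insert.hyps by blast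
    then obtain y where y: "mpow y \<alpha> \<noteq> mpow y \<beta>"
      using mpow_distinct by blast
    \<comment> \<open>The relation at the product of \<open>z\<close> and \<open>y\<close>, minus
      \<open>mpow y \<beta>\<close> times the relation at \<open>z\<close>: the index \<beta> drops
      out.\<close>
    have "(\<Sum>\<gamma>\<in>A. mpow z \<gamma> *\<^sub>C (mpow y \<gamma> - mpow y \<beta>) *\<^sub>C u \<gamma>) = 0" for z
    proof -
      have "(\<Sum>\<gamma>\<in>A. mpow z \<gamma> *\<^sub>C (mpow y \<gamma> - mpow y \<beta>) *\<^sub>C u \<gamma>)
        = (\<Sum>\<gamma>\<in>insert \<beta> A. mpow z \<gamma> *\<^sub>C (mpow y \<gamma> - mpow y \<beta>) *\<^sub>C u \<gamma>)"
        using insert by simp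
      also have "\<dots> = (\<Sum>\<gamma>\<in>insert \<beta> A. mpow (\<chi> i. z $ i * y $ i) \<gamma> *\<^sub>C u \<gamma>)
          - mpow y \<beta> *\<^sub>C (\<Sum>\<gamma>\<in>insert \<beta> A. mpow z \<gamma> *\<^sub>C u \<gamma>)"
        unfolding scaleC_sum_right sum_subtractf[symmetric] mpow_mult
        by (rule sum.cong[OF refl])
          (simp only: scaleC_scaleC scaleC_diff_left[symmetric] right_diff_distrib mult.commute)
      also have "\<dots> = 0" using insert.prems(1) by simp
      finally show ?thesis .
    qed
    from insert.IH[OF this that] have "(mpow y \<alpha> - mpow y \<beta>) *\<^sub>C u \<alpha> = 0" .
    then have "cmod (mpow y \<alpha> - mpow y \<beta>) * norm (u \<alpha>) = 0" by (metis norm_scaleC norm_zero)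
    then show ?thesis using y by simp
  qed
  \<comment> \<open>At the point with all coordinates 1 every monomial is 1, and only the
    coefficient at \<beta> is left.\<close>
  have "(\<Sum>\<gamma>\<in>insert \<beta> A. mpow (\<chi> i. 1) \<gamma> *\<^sub>C u \<gamma>) = u \<beta>"
    using insert.hyps by (simp add: mpow_def A0)
  then have "u \<beta> = 0" using insert.prems(1) by metis
  then show ?case using insert.prems(2) A0 by blast
qed simp

section \<open>Multinomial coefficients, index shifts and summation by levels\<close>

lemma mgamma_pos [simp]: "mgamma \<alpha> > 0"
  by (simp add: mgamma_def prod_pos)

lemma mgamma_zero [simp]: "mgamma 0 = 1"
  by (simp add: mgamma_def)

lemma mgamma_add_munit:
  "mgamma (\<alpha> + munit i) = real (Suc (mabs \<alpha>)) / real (Suc (\<alpha> $ i)) * mgamma \<alpha>"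
proof -
  have "(\<Prod>j\<in>UNIV. fact ((\<alpha> + munit i) $ j)) = real (Suc (\<alpha> $ i)) * (\<Prod>j\<in>UNIV. fact (\<alpha> $ j))"
    by (rule prod_add_munit) (simp add: algebra_simps)
  then show ?thesis unfolding mgamma_def mabs_add_munit fact_Suc by (simp add: field_simps)
qed

lemma bij_betw_add_munit: "bij_betw (\<lambda>\<alpha>. \<alpha> + munit i) UNIV {\<beta> :: nat ^ 'd::finite. \<beta> $ i > 0}"
proof (rule bij_betwI[where g = "\<lambda>\<beta>. \<beta> - munit i"])
  show "\<beta> - munit i + munit i = \<beta>" if "\<beta> \<in> {\<beta>. \<beta> $ i > 0}" for \<beta> :: "nat ^ 'd"
    using that diff_munit_add by blast
qed (auto simp: vec_eq_iff munit_nth)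

lemma has_sum_add_munit_iff:
  fixes f :: "nat ^ 'd::finite \<Rightarrow> 'b::{comm_monoid_add, topological_space}"
  assumes "\<And>\<beta>. \<beta> $ i = 0 \<Longrightarrow> f \<beta> = 0"
  shows "((\<lambda>\<alpha>. f (\<alpha> + munit i)) has_sum s) UNIV \<longleftrightarrow> (f has_sum s) UNIV"
  unfolding has_sum_reindex_bij_betw[OF bij_betw_add_munit]
  by (rule has_sum_cong_neutral) (use assms in auto)

lemma summable_on_add_munit:
  fixes f :: "nat ^ 'd::finite \<Rightarrow> 'b::{comm_monoid_add, topological_space}"
  assumes "\<And>\<beta>. \<beta> $ i = 0 \<Longrightarrow> f \<beta> = 0"
  shows "(\<lambda>\<alpha>. f (\<alpha> + munit i)) summable_on UNIV \<longleftrightarrow> f summable_on UNIV"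
  using has_sum_add_munit_iff[where f = f and i = i, OF assms] by (simp add: summable_on_def)

lemma infsum_add_munit:
  fixes f :: "nat ^ 'd::finite \<Rightarrow> 'b::{comm_monoid_add, t2_space}"
  assumes "\<And>\<beta>. \<beta> $ i = 0 \<Longrightarrow> f \<beta> = 0"
  shows "infsum (\<lambda>\<alpha>. f (\<alpha> + munit i)) UNIV = infsum f UNIV"
proof (cases "f summable_on UNIV")
  case True
  then have "((\<lambda>\<alpha>. f (\<alpha> + munit i)) has_sum infsum f UNIV) UNIV"
    using has_sum_add_munit_iff[where f = f and i = i, OF assms] by simp
  then show ?thesis by (rule infsumI)
next
  case False
  then show ?thesis
    using summable_on_add_munit[where f = f and i = i, OF assms] by (simp add: infsum_not_exists)
qed

text \<open>Every \<open>\<beta> \<noteq> 0\<close> is \<open>\<alpha> + e\<^sub>i\<close> with weights \<open>\<beta>\<^sub>i / |\<beta>|\<close> that add up to \<open>1\<close>.\<close>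

lemma infsum_multiindex_shift:
  fixes F :: "nat ^ 'd::finite \<Rightarrow> 'b::banach"
  assumes F: "(\<lambda>\<beta>. norm (F \<beta>)) summable_on UNIV"
  shows "(\<lambda>\<alpha>. (real (Suc (\<alpha> $ i)) / real (Suc (mabs \<alpha>))) *\<^sub>R F (\<alpha> + munit i)) summable_on UNIV"
    and "infsum F UNIV = F 0 +
      (\<Sum>i\<in>UNIV. infsum (\<lambda>\<alpha>. (real (Suc (\<alpha> $ i)) / real (Suc (mabs \<alpha>))) *\<^sub>R F (\<alpha> + munit i)) UNIV)"
proof -
  define G where "G i \<beta> = (real (\<beta> $ i) / real (mabs \<beta>)) *\<^sub>R F \<beta>" for i \<beta>
  have G_shift: "(real (Suc (\<alpha> $ i)) / real (Suc (mabs \<alpha>))) *\<^sub>R F (\<alpha> + munit i) = G i (\<alpha> + munit i)" for i \<alpha>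
    by (simp add: G_def)
  have G0: "\<beta> $ i = 0 \<Longrightarrow> G i \<beta> = 0" for \<beta> i by (simp add: G_def)
  have infsum_G: "infsum (\<lambda>\<alpha>. G i (\<alpha> + munit i)) UNIV = infsum (G i) UNIV" for i
    by (rule infsum_add_munit) (rule G0)
  have "norm (G i \<beta>) \<le> norm (F \<beta>)" for i \<beta>
  proof -
    have "real (\<beta> $ i) / real (mabs \<beta>) \<le> 1" using nth_le_mabs[of \<beta> i] by (simp add: divide_le_eq)
    then have "real (\<beta> $ i) / real (mabs \<beta>) * norm (F \<beta>) \<le> 1 * norm (F \<beta>)"
      by (rule mult_right_mono) simp
    then show ?thesis by (simp add: G_def)
  qed
  then have "(\<lambda>\<beta>. norm (G i \<beta>)) summable_on UNIV" for i
    by (intro summable_on_comparison_test[OF F]) auto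
  then have Gs: "G i summable_on UNIV" for i
    by (rule abs_summable_summable)
  then show "(\<lambda>\<alpha>. (real (Suc (\<alpha> $ i)) / real (Suc (mabs \<alpha>))) *\<^sub>R F (\<alpha> + munit i)) summable_on UNIV"
    unfolding G_shift by (subst summable_on_add_munit) (auto simp: G0)
  have "((\<lambda>\<beta>. \<Sum>i\<in>UNIV. G i \<beta>) has_sum (\<Sum>i\<in>UNIV. infsum (G i) UNIV)) UNIV"
    by (rule has_sum_sum_index) (simp add: Gs)
  moreover have "((\<lambda>\<beta>. if \<beta> = 0 then F 0 else 0) has_sum F 0) UNIV"
    by (rule has_sum_finite_neutralI[of "{0}"]) auto
  ultimately have "((\<lambda>\<beta>. (if \<beta> = 0 then F 0 else 0) + (\<Sum>i\<in>UNIV. G i \<beta>)) has_sum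
      (F 0 + (\<Sum>i\<in>UNIV. infsum (G i) UNIV))) UNIV"
    by (rule has_sum_add[rotated])
  also have "(\<lambda>\<beta>. (if \<beta> = 0 then F 0 else 0) + (\<Sum>i\<in>UNIV. G i \<beta>)) = F"
  proof
    fix \<beta>
    \<comment> \<open>The quotient is 1 except at \<beta> = 0, where division by zero makes it 0;
      the separate term \<open>F 0\<close> compensates for this.\<close>
    have "(\<Sum>i\<in>UNIV. G i \<beta>) = (real (mabs \<beta>) / real (mabs \<beta>)) *\<^sub>R F \<beta>"
      by (simp only: G_def scaleR_left.sum[symmetric] sum_divide_distrib[symmetric] mabs_def of_nat_sum)
    then show "(if \<beta> = 0 then F 0 else 0) + (\<Sum>i\<in>UNIV. G i \<beta>) = F \<beta>" by simp
  qed
  finally show "infsum F UNIV = F 0 +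
      (\<Sum>i\<in>UNIV. infsum (\<lambda>\<alpha>. (real (Suc (\<alpha> $ i)) / real (Suc (mabs \<alpha>))) *\<^sub>R F (\<alpha> + munit i)) UNIV)"
    unfolding G_shift infsum_G by (rule infsumI)
qed

text \<open>Pascal's rule for multinomial coefficients: the preceding shift is applied to
  \<open>G\<close> weighted by \<open>mgamma\<close> and cut off to one level, and its weights
  cancel the recursion of \<open>mgamma\<close>.\<close>

lemma sum_multiindex_shift:
  fixes G :: "nat ^ 'd::finite \<Rightarrow> 'b::banach"
  shows "(\<Sum>i\<in>UNIV. \<Sum>\<alpha> | mabs \<alpha> = n. mgamma \<alpha> *\<^sub>R G (\<alpha> + munit i))
    = (\<Sum>\<beta> | mabs \<beta> = Suc n. mgamma \<beta> *\<^sub>R G \<beta>)"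
proof -
  have fin: "infsum (\<lambda>\<alpha>. if mabs \<alpha> = k then H \<alpha> else 0) UNIV = (\<Sum>\<alpha> | mabs \<alpha> = k. H \<alpha>)"
    for k and H :: "nat ^ 'd \<Rightarrow> 'b"
  proof -
    have "infsum (\<lambda>\<alpha>. if mabs \<alpha> = k then H \<alpha> else 0) UNIV = infsum H {\<alpha>. mabs \<alpha> = k}"
      by (rule infsum_cong_neutral) auto
    then show ?thesis by (simp add: finite_mabs_eq)
  qed
  define F where "F \<beta> = (if mabs \<beta> = Suc n then mgamma \<beta> *\<^sub>R G \<beta> else 0)" for \<beta>
  have "(\<lambda>\<beta>. norm (F \<beta>)) summable_on {\<beta>. mabs \<beta> = Suc n}"
    by (simp add: finite_mabs_eq)
  then have "(\<lambda>\<beta>. norm (F \<beta>)) summable_on UNIV"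
    by (rule iffD1[OF summable_on_cong_neutral, rotated -1]) (auto simp: F_def)
  note shift = infsum_multiindex_shift(2)[OF this]
  have F_shift: "(\<lambda>\<alpha>. (real (Suc (\<alpha> $ i)) / real (Suc (mabs \<alpha>))) *\<^sub>R F (\<alpha> + munit i)) =
      (\<lambda>\<alpha>. if mabs \<alpha> = n then mgamma \<alpha> *\<^sub>R G (\<alpha> + munit i) else 0)" for i
    by (auto simp: F_def mgamma_add_munit fun_eq_iff simp del: of_nat_Suc)
  have "F 0 = 0" by (simp add: F_def)
  with shift[unfolded F_shift fin] show ?thesis
    by (simp add: F_def fin)
qed

text \<open>The multinomial theorem for the n-th power of the sum of the squared moduli of the
  coordinates.\<close>

lemma sum_mpow_level:
  fixes z :: "complex ^ 'd::finite"
  shows "(\<Sum>\<alpha> | mabs \<alpha> = n. mgamma \<alpha> * (cmod (mpow z \<alpha>))\<^sup>2) = norm z ^ (2 * n)"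
proof (induction n)
  case 0
  then show ?case by simp
next
  case (Suc n)
  have "(\<Sum>\<alpha> | mabs \<alpha> = Suc n. mgamma \<alpha> * (cmod (mpow z \<alpha>))\<^sup>2)
      = (\<Sum>i\<in>UNIV. \<Sum>\<alpha> | mabs \<alpha> = n. mgamma \<alpha> * (cmod (mpow z (\<alpha> + munit i)))\<^sup>2)"
    using sum_multiindex_shift[where n = n and G = "\<lambda>\<alpha>. (cmod (mpow z \<alpha>))\<^sup>2"] by simp
  also have "\<dots> = (\<Sum>i\<in>UNIV. (cmod (z $ i))\<^sup>2 * norm z ^ (2 * n))"
    unfolding Suc[symmetric] sum_distrib_left
    by (intro sum.cong) (auto simp: mpow_add_munit norm_mult power_mult_distrib algebra_simps)
  also have "\<dots> = (norm z)\<^sup>2 * norm z ^ (2 * n)"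
    by (simp add: sum_distrib_right[symmetric] norm_vec_def L2_set_def sum_nonneg)
  finally show ?case by (simp add: power2_eq_square)
qed

lemma level_reindex:
  "(f has_sum s) UNIV \<longleftrightarrow> ((\<lambda>(n, \<alpha>). f \<alpha>) has_sum s) (SIGMA n:UNIV. {\<alpha> :: nat ^ 'd::finite. mabs \<alpha> = n})"
  by (rule has_sum_reindex_bij_witness[of _ snd "\<lambda>\<alpha>. (mabs \<alpha>, \<alpha>)"]) auto

lemma has_sum_levels:
  fixes f :: "nat ^ 'd::finite \<Rightarrow> 'b::{topological_comm_monoid_add, t3_space}"
  assumes "(f has_sum s) UNIV"
  shows "((\<lambda>n. \<Sum>\<alpha> | mabs \<alpha> = n. f \<alpha>) has_sum s) UNIV"
proof (rule has_sum_SigmaD)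
  show "((\<lambda>(n, \<alpha>). f \<alpha>) has_sum s) (SIGMA n:UNIV. {\<alpha> :: nat ^ 'd. mabs \<alpha> = n})"
    using assms by (simp add: level_reindex)
qed (simp add: finite_mabs_eq)

text \<open>Non-negative terms may be regrouped freely, so a series over levels, such as the one in
  the definition of pureness, yields an unconditional sum over multi-indices.\<close>

lemma has_sum_of_levels_nonneg:
  fixes f :: "nat ^ 'd::finite \<Rightarrow> real"
  assumes nn: "\<And>\<alpha>. 0 \<le> f \<alpha>" and s: "(\<lambda>n. \<Sum>\<alpha> | mabs \<alpha> = n. f \<alpha>) sums s"
  shows "(f has_sum s) UNIV"
proof -
  have g: "((\<lambda>n. \<Sum>\<alpha> | mabs \<alpha> = n. f \<alpha>) has_sum s) UNIV"
    using s nn by (simp add: sums_nonneg_imp_has_sum sum_nonneg)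
  have "((\<lambda>(n, \<alpha>). f \<alpha>) has_sum s) (SIGMA n:UNIV. {\<alpha> :: nat ^ 'd. mabs \<alpha> = n})"
  proof (rule has_sum_SigmaI[OF _ g])
    show "(\<lambda>(n, \<alpha>). f \<alpha>) summable_on (SIGMA n:UNIV. {\<alpha> :: nat ^ 'd. mabs \<alpha> = n})"
      by (rule summable_on_SigmaI[where g = "\<lambda>n. \<Sum>\<alpha> | mabs \<alpha> = n. f \<alpha>"])
        (use g nn in \<open>auto simp: finite_mabs_eq summable_on_def\<close>)
  qed (simp add: finite_mabs_eq)
  then show ?thesis by (simp add: level_reindex)
qed

subsection \<open>Powers of the adjoint tuple\<close>

lemma commuting_funpow:
  assumes "\<And>x. f (g x) = g (f x)"
  shows "(f ^^ m) ((g ^^ n) x) = (g ^^ n) ((f ^^ m) x)"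
proof -
  have "f ((g ^^ n) x) = (g ^^ n) (f x)" for n x
    by (induction n) (simp_all add: assms)
  then show ?thesis
    by (induction m) simp_all
qed

locale operator_tuple =
  fixes T :: "'d::finite \<Rightarrow> 'h::complex_hilbert_space \<Rightarrow> 'h"
  assumes tuple: "commuting_tuple T"
begin

lemma bounded_clinear_T: "bounded_clinear (T i)"
  using tuple by (simp add: commuting_tuple_def)

lemma T_T: "T i (T j x) = T j (T i x)"
  using tuple by (auto simp: commuting_tuple_def fun_eq_iff)

lemma cadj_T_T: "cadj (T i) (cadj (T j) x) = cadj (T j) (cadj (T i) x)"
  by (rule cinner_eqI) (simp add: cadj[OF bounded_clinear_T, symmetric] T_T)

text \<open>Permits peeling single coordinates off the \<open>Finite_Set.fold\<close> that defines
  \<open>adj_mpow\<close>.\<close>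

lemma comp_fun_commute_adj:
  "comp_fun_commute_on UNIV (\<lambda>i S. (cadj (T i) ^^ (\<alpha> $ i)) \<circ> S)"
proof
  fix i j
  have "(cadj (T j) ^^ m) ((cadj (T i) ^^ n) x) = (cadj (T i) ^^ n) ((cadj (T j) ^^ m) x)" for m n x
    by (rule commuting_funpow) (rule cadj_T_T)
  then show "(\<circ>) (cadj (T j) ^^ (\<alpha> $ j)) \<circ> (\<circ>) (cadj (T i) ^^ (\<alpha> $ i))
      = (\<circ>) (cadj (T i) ^^ (\<alpha> $ i)) \<circ> (\<circ>) (cadj (T j) ^^ (\<alpha> $ j))"
    by (simp add: fun_eq_iff)
qed

lemma adj_mpow_zero [simp]: "adj_mpow T 0 h = h"
proof -
  interpret comp_fun_commute_on UNIV "\<lambda>(i::'d) (S::'h \<Rightarrow> 'h). S"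
    by standard simp
  have "Finite_Set.fold (\<lambda>(i::'d) (S::'h \<Rightarrow> 'h). S) f A = f" for f A
    by (induction A rule: infinite_finite_induct) auto
  moreover have "(\<lambda>i (S::'h \<Rightarrow> 'h). (cadj (T i) ^^ ((0 :: nat ^ 'd) $ i)) \<circ> S) = (\<lambda>i S. S)"
    by (auto simp: fun_eq_iff)
  ultimately show ?thesis unfolding adj_mpow_def by (simp only: id_apply)
qed

text \<open>The coordinate \<open>i\<close> can be folded last, and the fold over the other
  coordinates does not see the increment.\<close>

lemma adj_mpow_add_munit: "adj_mpow T (\<alpha> + munit i) h = cadj (T i) (adj_mpow T \<alpha> h)"
proof -
  let ?f = "\<lambda>\<alpha> i S. (cadj (T i) ^^ (\<alpha> $ i)) \<circ> S"
  have 1: "adj_mpow T \<beta> = (cadj (T i) ^^ (\<beta> $ i)) \<circ> Finite_Set.fold (?f \<beta>) id (UNIV - {i})" for \<beta>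
    unfolding adj_mpow_def
    using comp_fun_commute_on.fold_rec[OF comp_fun_commute_adj[of \<beta>], of UNIV i id] by simp
  have "Finite_Set.fold (?f (\<alpha> + munit i)) id (UNIV - {i}) = Finite_Set.fold (?f \<alpha>) id (UNIV - {i})"
    by (rule Finite_Set.fold_cong[OF comp_fun_commute_adj comp_fun_commute_adj]) auto
  then show ?thesis unfolding 1 by simp
qed

lemma adj_mpow_cadj: "adj_mpow T \<alpha> (cadj (T i) h) = cadj (T i) (adj_mpow T \<alpha> h)"
proof (induction \<alpha> rule: mabs_induct)
  case (add_munit \<alpha> j)
  then show ?case by (simp add: adj_mpow_add_munit cadj_T_T)
qed simp

lemma bounded_clinear_adj_mpow: "bounded_clinear (adj_mpow T \<alpha>)"
proof (induction \<alpha> rule: mabs_induct)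
  case zero
  have "adj_mpow T 0 = (\<lambda>h. h)" by (simp add: fun_eq_iff)
  then show ?case by (simp add: bounded_clinear_ident)
next
  case (add_munit \<alpha> i)
  have "adj_mpow T (\<alpha> + munit i) = (\<lambda>h. cadj (T i) (adj_mpow T \<alpha> h))"
    by (simp add: fun_eq_iff adj_mpow_add_munit)
  then show ?case
    by (simp add: bounded_clinear_compose[OF bounded_clinear_cadj[OF bounded_clinear_T] add_munit])
qed

text \<open>The expansion of \<sigma>^n(X) as the sum of \<gamma>_\<alpha> T^\<alpha> X T*^\<alpha>
  over |\<alpha>| = n, tested against \<open>g\<close> so that only the adjoint powers
  \<open>adj_mpow\<close> occur.\<close>

lemma cinner_sigma_op_power:
  "cinner ((sigma_op T ^^ n) X h) g
    = (\<Sum>\<alpha> | mabs \<alpha> = n. mgamma \<alpha> *\<^sub>R cinner (X (adj_mpow T \<alpha> h)) (adj_mpow T \<alpha> g))"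
proof (induction n arbitrary: h g)
  case (Suc n)
  have "cinner ((sigma_op T ^^ Suc n) X h) g
      = (\<Sum>i\<in>UNIV. cinner ((sigma_op T ^^ n) X (cadj (T i) h)) (cadj (T i) g))"
    by (simp add: sigma_op_def cinner_sum_left cadj[OF bounded_clinear_T])
  also have "\<dots> = (\<Sum>i\<in>UNIV. \<Sum>\<alpha> | mabs \<alpha> = n. mgamma \<alpha> *\<^sub>R
      cinner (X (adj_mpow T (\<alpha> + munit i) h)) (adj_mpow T (\<alpha> + munit i) g))"
    unfolding Suc adj_mpow_add_munit adj_mpow_cadj ..
  finally show ?case
    using sum_multiindex_shift[where n = n and G = "\<lambda>\<alpha>. cinner (X (adj_mpow T \<alpha> h)) (adj_mpow T \<alpha> g)"] by simp
qed simp

end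

section \<open>The spaces \<open>H\<^sub>K(E)\<close> in terms of coefficients\<close>

text \<open>Once the lower coefficients vanish, \<open>t ^ n\<close> can be divided out, and the
  limit for \<open>t\<close> to 0 isolates \<open>p n\<close>.\<close>

lemma power_series_coeffs_unique:
  fixes p :: "nat \<Rightarrow> complex"
  assumes "\<And>t. cmod t < 1 \<Longrightarrow> (\<lambda>n. p n * t ^ n) sums 0"
  shows "p n = 0"
proof (induction n rule: less_induct)
  case (less n)
  have shifted: "(\<lambda>k. p (k + n) * t ^ k) sums 0" if "t \<noteq> 0" "cmod t < 1" for t
  proof -
    have "(\<lambda>k. p (k + n) * t ^ (k + n)) sums (0 - (\<Sum>k<n. p k * t ^ k))"
      using sums_split_initial_segment[OF assms[OF that(2)]] by simp
    then have "(\<lambda>k. p (k + n) * t ^ (k + n)) sums 0" using less by simp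
    then have "(\<lambda>k. p (k + n) * t ^ (k + n) / t ^ n) sums (0 / t ^ n)"
      by (rule sums_divide)
    then show ?thesis using that(1) by (simp add: power_add)
  qed
  have "((\<lambda>t::complex. 0) \<longlongrightarrow> (\<lambda>k. p (k + n)) 0) (at 0)"
    by (rule powser_limit_0_strong[of 1]) (use shifted in auto)
  then show ?case by (simp add: tendsto_const_iff)
qed

lemma has_sum_diff:
  fixes f g :: "'i \<Rightarrow> 'b::topological_ab_group_add"
  assumes "(f has_sum s) A" "(g has_sum t) A"
  shows "((\<lambda>x. f x - g x) has_sum (s - t)) A"
proof -
  have "((\<lambda>x. - g x) has_sum - t) A" using assms(2) by (simp add: has_sum_uminus)
  from has_sum_add[OF assms(1) this] show ?thesis by simp
qed

lemma scaleC_infsum: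
  fixes f :: "'i \<Rightarrow> 'h::complex_hilbert_space"
  assumes "f summable_on A"
  shows "infsum (\<lambda>x. c *\<^sub>C f x) A = c *\<^sub>C infsum f A"
  using has_sum_bounded_linear[OF bounded_linear_scaleC has_sum_infsum[OF assms], of c]
  by (simp add: infsumI)

section \<open>Coefficient families and their weighted shifts\<close>

definition shift_up :: "'d::finite \<Rightarrow> (nat ^ 'd \<Rightarrow> 'h::zero) \<Rightarrow> nat ^ 'd \<Rightarrow> 'h"
  where "shift_up i u \<beta> = (if \<beta> $ i = 0 then 0 else u (\<beta> - munit i))"

text \<open>The factor is the quotient of the weights at \<alpha> and \<alpha> + e_i in
  \<open>coeff_inner\<close>; it makes this the adjoint of \<open>shift_up\<close>, that is, the
  adjoint of multiplication by z_i.\<close>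

definition shift_down ::
    "(nat \<Rightarrow> real) \<Rightarrow> 'd::finite \<Rightarrow> (nat ^ 'd \<Rightarrow> 'h::complex_hilbert_space) \<Rightarrow> nat ^ 'd \<Rightarrow> 'h"
  where "shift_down a i v \<alpha> = ((a (mabs \<alpha>) * mgamma \<alpha>) /
    (a (mabs (\<alpha> + munit i)) * mgamma (\<alpha> + munit i))) *\<^sub>R v (\<alpha> + munit i)"

definition coeff_Delta :: "(nat \<Rightarrow> real) \<Rightarrow> (nat ^ 'd::finite \<Rightarrow> 'h::complex_hilbert_space) \<Rightarrow> nat ^ 'd \<Rightarrow> 'h"
  where "coeff_Delta a u \<alpha> = (a (Suc (mabs \<alpha>)) / a (mabs \<alpha>)) *\<^sub>R u \<alpha>"

definition coeff_inner ::
    "(nat \<Rightarrow> real) \<Rightarrow> (nat ^ 'd::finite \<Rightarrow> 'h::complex_hilbert_space) \<Rightarrow> (nat ^ 'd \<Rightarrow> 'h) \<Rightarrow> complex"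
  where "coeff_inner a u v = (\<Sum>\<^sub>\<infinity>\<alpha>. cinner (u \<alpha>) (v \<alpha>) / complex_of_real (a (mabs \<alpha>) * mgamma \<alpha>))"

text \<open>The analytic hypotheses in numerical form: convergence on [0, 1) provides the point
  evaluations, \<open>B\<close> bounds the coordinate multiplications and bounds \<Delta> from
  below, \<open>b\<close> bounds \<Delta> from above.\<close>

locale kernel_coeffs =
  fixes a :: "nat \<Rightarrow> real" and b B :: real
  assumes a_pos [simp]: "a n > 0" and a_0 [simp]: "a 0 = 1"
    and a_summable: "0 \<le> x \<Longrightarrow> x < 1 \<Longrightarrow> summable (\<lambda>n. a n * x ^ n)"
    and a_le: "a n \<le> B * a (Suc n)" and a_ge: "a (Suc n) \<le> b * a n"
begin

abbreviation weight :: "nat ^ 'd::finite \<Rightarrow> real"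
  where "weight \<alpha> \<equiv> a (mabs \<alpha>) * mgamma \<alpha>"

lemma a_nonzero [simp]: "a n \<noteq> 0"
  using a_pos[of n] by linarith

lemma mgamma_nonzero [simp]: "mgamma \<alpha> \<noteq> 0"
  using mgamma_pos[of \<alpha>] by linarith

lemma weight_pos: "weight \<alpha> > 0"
  by simp

lemma weight_nonneg: "0 \<le> weight \<alpha>"
  by (simp add: less_imp_le)

lemma B_pos: "B > 0"
proof -
  have "0 < B * a (Suc 0)" using a_pos[of 0] a_le[of 0] by (rule less_le_trans)
  then show ?thesis using a_pos[of "Suc 0"] by (rule zero_less_mult_pos2)
qed

lemma b_pos: "b > 0"
proof -
  have "0 < b * a 0" using a_pos[of "Suc 0"] a_ge[of 0] by (rule less_le_trans)
  then show ?thesis using a_pos[of 0] by (rule zero_less_mult_pos2)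
qed

lemma weight_munit:
  "weight (\<alpha> + munit i) = weight \<alpha> * (a (Suc (mabs \<alpha>)) / a (mabs \<alpha>)) * (real (Suc (mabs \<alpha>)) / real (Suc (\<alpha> $ i)))"
  by (simp add: mgamma_add_munit)

lemma weight_ratio_le: "weight \<alpha> / weight (\<alpha> + munit i) \<le> B"
proof -
  have "weight \<alpha> / weight (\<alpha> + munit i) = (a (mabs \<alpha>) / a (Suc (mabs \<alpha>))) * (real (Suc (\<alpha> $ i)) / real (Suc (mabs \<alpha>)))"
    unfolding weight_munit by (simp del: of_nat_Suc)
  also have "\<dots> \<le> B * 1"
  proof (rule mult_mono)
    show "a (mabs \<alpha>) / a (Suc (mabs \<alpha>)) \<le> B"
      using a_le by (simp add: divide_le_eq)
    show "real (Suc (\<alpha> $ i)) / real (Suc (mabs \<alpha>)) \<le> 1"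
      using nth_le_mabs[of \<alpha> i] by simp
  qed (use B_pos in auto)
  finally show ?thesis by simp
qed

lemma hk_summable_bounded:
  assumes u: "hk_summable a u" and le: "\<And>\<alpha>. norm (v \<alpha>) \<le> K * norm (u \<alpha>)"
  shows "hk_summable a v"
proof -
  have "(\<lambda>\<alpha>. K\<^sup>2 * ((norm (u \<alpha>))\<^sup>2 / weight \<alpha>)) summable_on UNIV"
    using u unfolding hk_summable_def by (rule summable_on_cmult_right)
  then show ?thesis
    unfolding hk_summable_def
  proof (rule summable_on_comparison_test)
    fix \<alpha>
    have "(norm (v \<alpha>))\<^sup>2 \<le> (K * norm (u \<alpha>))\<^sup>2" by (rule power_mono) (use le in auto)
    then show "(norm (v \<alpha>))\<^sup>2 / weight \<alpha> \<le> K\<^sup>2 * ((norm (u \<alpha>))\<^sup>2 / weight \<alpha>)"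
      using divide_right_mono[OF _ weight_nonneg] by (fastforce simp: power_mult_distrib)
  qed (simp add: weight_nonneg)
qed

lemma hk_summable_zero: "hk_summable a (\<lambda>\<alpha>. 0)"
  by (simp add: hk_summable_def)

lemma hk_summable_scaleC: "hk_summable a u \<Longrightarrow> hk_summable a (\<lambda>\<alpha>. c *\<^sub>C u \<alpha>)"
  by (rule hk_summable_bounded[where K = "cmod c"]) (auto simp: norm_scaleC)

lemma hk_summable_add:
  assumes u: "hk_summable a u" and v: "hk_summable a v"
  shows "hk_summable a (\<lambda>\<alpha>. u \<alpha> + v \<alpha>)"
proof -
  have "(\<lambda>\<alpha>. 2 * ((norm (u \<alpha>))\<^sup>2 / weight \<alpha>) + 2 * ((norm (v \<alpha>))\<^sup>2 / weight \<alpha>)) summable_on UNIV"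
    using u v unfolding hk_summable_def by (intro summable_on_add summable_on_cmult_right)
  then show ?thesis
    unfolding hk_summable_def
  proof (rule summable_on_comparison_test)
    fix \<alpha>
    have "(norm (u \<alpha> + v \<alpha>))\<^sup>2 \<le> (norm (u \<alpha>) + norm (v \<alpha>))\<^sup>2"
      by (rule power_mono) (auto simp: norm_triangle_ineq)
    also have "\<dots> \<le> 2 * (norm (u \<alpha>))\<^sup>2 + 2 * (norm (v \<alpha>))\<^sup>2"
      using sum_squares_bound[of "norm (u \<alpha>)" "norm (v \<alpha>)"] unfolding power2_sum by linarith
    finally have "(norm (u \<alpha> + v \<alpha>))\<^sup>2 / weight \<alpha> \<le> (2 * (norm (u \<alpha>))\<^sup>2 + 2 * (norm (v \<alpha>))\<^sup>2) / weight \<alpha>"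
      by (rule divide_right_mono[OF _ weight_nonneg])
    then show "(norm (u \<alpha> + v \<alpha>))\<^sup>2 / weight \<alpha> \<le> 2 * ((norm (u \<alpha>))\<^sup>2 / weight \<alpha>) + 2 * ((norm (v \<alpha>))\<^sup>2 / weight \<alpha>)"
      by (simp add: add_divide_distrib)
  qed (simp add: weight_nonneg)
qed

lemma hk_summable_minus: "hk_summable a u \<Longrightarrow> hk_summable a (\<lambda>\<alpha>. - u \<alpha>)"
  by (simp add: hk_summable_def)

lemma hk_summable_diff:
  "hk_summable a u \<Longrightarrow> hk_summable a v \<Longrightarrow> hk_summable a (\<lambda>\<alpha>. u \<alpha> - v \<alpha>)"
  using hk_summable_add[OF _ hk_summable_minus, of u v] by simp

lemma hk_summable_finite:
  assumes "finite {\<alpha>. u \<alpha> \<noteq> 0}"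
  shows "hk_summable a u"
proof -
  have "(\<lambda>\<alpha>. (norm (u \<alpha>))\<^sup>2 / weight \<alpha>) summable_on {\<alpha>. u \<alpha> \<noteq> 0}"
    using assms by simp
  then show ?thesis
    unfolding hk_summable_def by (rule iffD1[OF summable_on_cong_neutral, rotated -1]) auto
qed

subsection \<open>Evaluation\<close>

text \<open>The sum is the reproducing kernel on the diagonal, K(z,z) = k(|z|^2), summed level by
  level.\<close>

lemma summable_weight_mpow:
  fixes z :: "complex ^ 'd::finite"
  assumes "norm z < 1"
  shows "(\<lambda>\<alpha>. weight \<alpha> * (cmod (mpow z \<alpha>))\<^sup>2) summable_on UNIV"
proof -
  have "((norm z)\<^sup>2) < 1" using assms by (simp add: power_less_one_iff abs_square_less_1)
  then have "summable (\<lambda>n. a n * ((norm z)\<^sup>2) ^ n)" by (intro a_summable) auto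
  moreover have "(\<Sum>\<alpha> | mabs \<alpha> = n. weight \<alpha> * (cmod (mpow z \<alpha>))\<^sup>2) = a n * ((norm z)\<^sup>2) ^ n" for n
  proof -
    have "(\<Sum>\<alpha> | mabs \<alpha> = n. weight \<alpha> * (cmod (mpow z \<alpha>))\<^sup>2) = a n * norm z ^ (2 * n)"
      unfolding sum_mpow_level[symmetric] sum_distrib_left by (rule sum.cong) auto
    then show ?thesis by (simp only: power_mult)
  qed
  ultimately obtain s where "(\<lambda>n. \<Sum>\<alpha> | mabs \<alpha> = n. weight \<alpha> * (cmod (mpow z \<alpha>))\<^sup>2) sums s"
    unfolding summable_def by presburger
  then have "((\<lambda>\<alpha>. weight \<alpha> * (cmod (mpow z \<alpha>))\<^sup>2) has_sum s) UNIV"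
    by (rule has_sum_of_levels_nonneg[rotated]) (simp add: weight_nonneg)
  then show ?thesis by (auto simp: summable_on_def)
qed

lemma abs_summable_power_series:
  fixes z :: "complex ^ 'd::finite" and u :: "nat ^ 'd \<Rightarrow> 'h::complex_hilbert_space"
  assumes z: "norm z < 1" and u: "hk_summable a u"
  shows "(\<lambda>\<alpha>. norm (mpow z \<alpha> *\<^sub>C u \<alpha>)) summable_on UNIV"
proof -
  have "(\<lambda>\<alpha>. weight \<alpha> * (cmod (mpow z \<alpha>))\<^sup>2 + (norm (u \<alpha>))\<^sup>2 / weight \<alpha>) summable_on UNIV"
    using summable_weight_mpow[OF z] u unfolding hk_summable_def by (rule summable_on_add)
  then show ?thesis
  proof (rule summable_on_comparison_test)
    fix \<alpha> :: "nat ^ 'd"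
    \<comment> \<open>The weight is distributed over the two factors before 2 x y \<le> x^2 + y^2 is
      applied.\<close>
    define s where "s = sqrt (weight \<alpha>)"
    have s: "s > 0" "s\<^sup>2 = weight \<alpha>" using weight_pos[of \<alpha>] by (auto simp: s_def weight_nonneg)
    have "2 * (s * cmod (mpow z \<alpha>)) * (norm (u \<alpha>) / s) \<le> (s * cmod (mpow z \<alpha>))\<^sup>2 + (norm (u \<alpha>) / s)\<^sup>2"
      by (rule sum_squares_bound)
    also have "2 * (s * cmod (mpow z \<alpha>)) * (norm (u \<alpha>) / s) = 2 * norm (mpow z \<alpha> *\<^sub>C u \<alpha>)"
      using s by (simp add: norm_scaleC)
    finally show "norm (mpow z \<alpha> *\<^sub>C u \<alpha>) \<le> weight \<alpha> * (cmod (mpow z \<alpha>))\<^sup>2 + (norm (u \<alpha>))\<^sup>2 / weight \<alpha>"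
      using norm_ge_zero[of "mpow z \<alpha> *\<^sub>C u \<alpha>"] unfolding power_mult_distrib power_divide s(2) by linarith
  qed simp
qed

lemma summable_power_series:
  fixes z :: "complex ^ 'd::finite" and u :: "nat ^ 'd \<Rightarrow> 'h::complex_hilbert_space"
  shows "norm z < 1 \<Longrightarrow> hk_summable a u \<Longrightarrow> (\<lambda>\<alpha>. mpow z \<alpha> *\<^sub>C u \<alpha>) summable_on UNIV"
  by (rule abs_summable_summable[OF abs_summable_power_series])

lemma power_series_diff:
  assumes "hk_summable a u" "hk_summable a v"
  shows "power_series (\<lambda>\<alpha>. u \<alpha> - v \<alpha>) z = power_series u z - power_series v z"
proof (cases "norm z < 1")
  case True
  have "((\<lambda>\<alpha>. mpow z \<alpha> *\<^sub>C u \<alpha> - mpow z \<alpha> *\<^sub>C v \<alpha>) has_sum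
      (infsum (\<lambda>\<alpha>. mpow z \<alpha> *\<^sub>C u \<alpha>) UNIV - infsum (\<lambda>\<alpha>. mpow z \<alpha> *\<^sub>C v \<alpha>) UNIV)) UNIV"
    by (intro has_sum_diff has_sum_infsum summable_power_series True assms)
  then show ?thesis using True
    by (simp add: power_series_def on_ball_def scaleC_diff_right infsumI)
qed (simp add: power_series_def on_ball_def)

text \<open>On each complex line through 0 the homogeneous parts are the coefficients of a
  one-variable series, so they vanish on the closed unit ball, and by homogeneity everywhere.
  Independence of the monomials then gives the single coefficients.\<close>

lemma power_series_eq_zero:
  fixes u :: "nat ^ 'd::finite \<Rightarrow> 'h::complex_hilbert_space"
  assumes u: "hk_summable a u" and eq: "\<And>z. power_series u z = 0"
  shows "u \<alpha> = 0"
proof -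
  define P where "P n z = (\<Sum>\<alpha> | mabs \<alpha> = n. mpow z \<alpha> *\<^sub>C u \<alpha>)" for n z
  have P_small: "P n z = 0" if z: "norm z \<le> 1" for n z
  proof (rule cinner_eqI_left)
    fix y
    have "(\<lambda>n. cinner (P n z) y * t ^ n) sums 0" if t: "cmod t < 1" for t
    proof -
      have tz: "norm (t *\<^sub>C z) < 1"
        using t z mult_left_le[of "norm z" "cmod t"] by (simp add: norm_scaleC)
      have "((\<lambda>\<alpha>. mpow (t *\<^sub>C z) \<alpha> *\<^sub>C u \<alpha>) has_sum 0) UNIV"
        using has_sum_infsum[OF summable_power_series[OF tz u]] eq[of "t *\<^sub>C z"] tz
        by (simp add: power_series_def on_ball_def)
      then have "((\<lambda>n. \<Sum>\<alpha> | mabs \<alpha> = n. mpow (t *\<^sub>C z) \<alpha> *\<^sub>C u \<alpha>) has_sum 0) UNIV"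
        by (rule has_sum_levels)
      also have "(\<lambda>n. \<Sum>\<alpha> | mabs \<alpha> = n. mpow (t *\<^sub>C z) \<alpha> *\<^sub>C u \<alpha>) = (\<lambda>n. t ^ n *\<^sub>C P n z)"
        by (auto simp: P_def mpow_scaleC scaleC_sum_right scaleC_scaleC intro!: sum.cong)
      finally have "(\<lambda>n. t ^ n *\<^sub>C P n z) sums 0" by (rule has_sum_imp_sums)
      from bounded_linear.sums[OF bounded_linear_cinner_left this, of y] show ?thesis
        by (simp add: cinner_scaleC_left mult.commute)
    qed
    then have "cinner (P n z) y = 0" by (rule power_series_coeffs_unique)
    then show "cinner (P n z) y = cinner 0 y" by simp
  qed
  have "P n z = 0" for n z
  proof -
    \<comment> \<open>A non-zero scaling that moves an arbitrary point, 0 included, into the closed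
      unit ball.\<close>
    define t where "t = complex_of_real (1 / (norm z + 1))"
    have n1: "norm z + 1 > 0" by (simp add: add_nonneg_pos)
    then have t0: "t \<noteq> 0" unfolding t_def of_real_eq_0_iff by simp
    have "cmod t = 1 / (norm z + 1)"
      unfolding t_def norm_of_real using n1 by simp
    then have "norm (t *\<^sub>C z) = norm z / (norm z + 1)" by (simp add: norm_scaleC)
    also have "\<dots> \<le> 1" using n1 by simp
    finally have "P n (t *\<^sub>C z) = 0" by (rule P_small)
    moreover have "P n (t *\<^sub>C z) = t ^ n *\<^sub>C P n z"
      by (auto simp: P_def mpow_scaleC scaleC_sum_right scaleC_scaleC intro!: sum.cong)
    ultimately have "norm (t ^ n *\<^sub>C P n z) = 0" by simp
    then show ?thesis using t0 unfolding norm_scaleC by simp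
  qed
  then show ?thesis
    unfolding P_def by (rule mpow_independent[OF finite_mabs_eq]) simp
qed

lemma power_series_inject:
  assumes "hk_summable a u" "hk_summable a v" "power_series u = power_series v"
  shows "u = v"
proof
  fix \<alpha>
  have "u \<alpha> - v \<alpha> = 0"
    by (rule power_series_eq_zero[OF hk_summable_diff[OF assms(1,2)]])
      (simp add: power_series_diff assms)
  then show "u \<alpha> = v \<alpha>" by simp
qed

lemma hk_coeff_power_series: "hk_summable a u \<Longrightarrow> hk_coeff a (power_series u) = u"
  unfolding hk_coeff_def by (rule the_equality) (auto dest: power_series_inject)

subsection \<open>The scalar product\<close>

lemma abs_summable_coeff_inner:
  assumes u: "hk_summable a u" and v: "hk_summable a v"
  shows "(\<lambda>\<alpha>. norm (cinner (u \<alpha>) (v \<alpha>) / complex_of_real (weight \<alpha>))) summable_on UNIV"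
proof -
  have "(\<lambda>\<alpha>. (norm (u \<alpha>))\<^sup>2 / weight \<alpha> + (norm (v \<alpha>))\<^sup>2 / weight \<alpha>) summable_on UNIV"
    using u v unfolding hk_summable_def by (rule summable_on_add)
  then show ?thesis
  proof (rule summable_on_comparison_test)
    fix \<alpha>
    have "cmod (cinner (u \<alpha>) (v \<alpha>)) \<le> norm (u \<alpha>) * norm (v \<alpha>)" by (rule norm_cinner_le)
    also have "\<dots> \<le> (norm (u \<alpha>))\<^sup>2 + (norm (v \<alpha>))\<^sup>2"
      using sum_squares_bound[of "norm (u \<alpha>)" "norm (v \<alpha>)"]
        mult_nonneg_nonneg[OF norm_ge_zero[of "u \<alpha>"] norm_ge_zero[of "v \<alpha>"]] by linarith
    finally have "cmod (cinner (u \<alpha>) (v \<alpha>)) / weight \<alpha> \<le> ((norm (u \<alpha>))\<^sup>2 + (norm (v \<alpha>))\<^sup>2) / weight \<alpha>"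
      by (rule divide_right_mono[OF _ weight_nonneg])
    moreover have "norm (cinner (u \<alpha>) (v \<alpha>) / complex_of_real (weight \<alpha>)) = cmod (cinner (u \<alpha>) (v \<alpha>)) / weight \<alpha>"
      unfolding norm_divide norm_of_real abs_of_pos[OF weight_pos] ..
    ultimately show "norm (cinner (u \<alpha>) (v \<alpha>) / complex_of_real (weight \<alpha>))
        \<le> (norm (u \<alpha>))\<^sup>2 / weight \<alpha> + (norm (v \<alpha>))\<^sup>2 / weight \<alpha>"
      by (simp only: add_divide_distrib)
  qed simp
qed

lemma has_sum_coeff_inner:
  assumes "hk_summable a u" "hk_summable a v"
  shows "((\<lambda>\<alpha>. cinner (u \<alpha>) (v \<alpha>) / complex_of_real (weight \<alpha>)) has_sum coeff_inner a u v) UNIV"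
  unfolding coeff_inner_def
  by (rule has_sum_infsum[OF abs_summable_summable[OF abs_summable_coeff_inner[OF assms]]])

lemma coeff_inner_add_left:
  assumes "hk_summable a u" "hk_summable a v" "hk_summable a x"
  shows "coeff_inner a (\<lambda>\<alpha>. u \<alpha> + v \<alpha>) x = coeff_inner a u x + coeff_inner a v x"
  using has_sum_add[OF has_sum_coeff_inner[OF assms(1,3)] has_sum_coeff_inner[OF assms(2,3)]]
  unfolding coeff_inner_def[of a "\<lambda>\<alpha>. u \<alpha> + v \<alpha>"]
  by (simp add: cinner_add_left add_divide_distrib infsumI)

lemma coeff_inner_scaleC_left:
  assumes "hk_summable a u" "hk_summable a x"
  shows "coeff_inner a (\<lambda>\<alpha>. c *\<^sub>C u \<alpha>) x = c * coeff_inner a u x"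
  using has_sum_cmult_right[OF has_sum_coeff_inner[OF assms], of c]
  unfolding coeff_inner_def[of a "\<lambda>\<alpha>. c *\<^sub>C u \<alpha>"]
  by (simp add: cinner_scaleC_left infsumI)

lemma coeff_inner_commute: "coeff_inner a u v = cnj (coeff_inner a v u)"
  unfolding coeff_inner_def infsum_cnj[symmetric]
  by (rule infsum_cong) (simp add: cinner_commute[symmetric])

lemma coeff_inner_diff_left:
  assumes "hk_summable a u" "hk_summable a v" "hk_summable a x"
  shows "coeff_inner a (\<lambda>\<alpha>. u \<alpha> - v \<alpha>) x = coeff_inner a u x - coeff_inner a v x"
  using has_sum_diff[OF has_sum_coeff_inner[OF assms(1,3)] has_sum_coeff_inner[OF assms(2,3)]]
  unfolding coeff_inner_def[of a "\<lambda>\<alpha>. u \<alpha> - v \<alpha>"]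
  by (simp add: cinner.diff_left diff_divide_distrib infsumI)

lemma coeff_inner_diff_right:
  assumes "hk_summable a u" "hk_summable a v" "hk_summable a x"
  shows "coeff_inner a x (\<lambda>\<alpha>. u \<alpha> - v \<alpha>) = coeff_inner a x u - coeff_inner a x v"
  by (subst (1 2 3) coeff_inner_commute) (simp add: coeff_inner_diff_left assms)

lemma coeff_inner_self:
  assumes "hk_summable a u"
  shows "coeff_inner a u u = of_real (infsum (\<lambda>\<alpha>. (norm (u \<alpha>))\<^sup>2 / weight \<alpha>) UNIV)"
proof -
  have "((\<lambda>\<alpha>. (norm (u \<alpha>))\<^sup>2 / weight \<alpha>) has_sum infsum (\<lambda>\<alpha>. (norm (u \<alpha>))\<^sup>2 / weight \<alpha>) UNIV) UNIV"
    using assms unfolding hk_summable_def by (rule has_sum_infsum)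
  then have "((\<lambda>\<alpha>. complex_of_real ((norm (u \<alpha>))\<^sup>2 / weight \<alpha>)) has_sum
      of_real (infsum (\<lambda>\<alpha>. (norm (u \<alpha>))\<^sup>2 / weight \<alpha>) UNIV)) UNIV"
    by (rule has_sum_of_real)
  then show ?thesis
    unfolding coeff_inner_def cinner_self of_real_divide[symmetric] by (rule infsumI)
qed

lemma coeff_inner_self_nonneg: "hk_summable a u \<Longrightarrow> 0 \<le> Re (coeff_inner a u u)"
  by (simp add: coeff_inner_self infsum_nonneg weight_nonneg)

lemma coeff_inner_self_eq_zero:
  assumes "hk_summable a u" "coeff_inner a u u = 0"
  shows "u = (\<lambda>\<alpha>. 0)"
proof
  fix \<alpha>
  have "(norm (u \<alpha>))\<^sup>2 / weight \<alpha> = 0"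
    by (rule nonneg_infsum_le_0D[where A = UNIV])
      (use assms coeff_inner_self[OF assms(1)] in \<open>auto simp: hk_summable_def weight_nonneg\<close>)
  then show "u \<alpha> = 0" by simp
qed

lemma hk_inner_power_series:
  "hk_summable a u \<Longrightarrow> hk_summable a v \<Longrightarrow>
    hk_inner a (power_series u) (power_series v) = coeff_inner a u v"
  by (simp add: hk_inner_def hk_coeff_power_series coeff_inner_def)

lemma hk_norm_power_series:
  "hk_summable a u \<Longrightarrow> hk_norm a (power_series u) = sqrt (Re (coeff_inner a u u))"
  by (simp add: hk_norm_def hk_coeff_power_series coeff_inner_self)

subsection \<open>Multiplication by the coordinates\<close>

lemma shift_up_add_munit [simp]: "shift_up i u (\<alpha> + munit i) = u \<alpha>"
  by (simp add: shift_up_def)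

lemma hk_summable_shift_up:
  assumes "hk_summable a u"
  shows "hk_summable a (shift_up i u)"
proof -
  have "(\<lambda>\<alpha>. (norm (u \<alpha>))\<^sup>2 / weight (\<alpha> + munit i)) summable_on UNIV"
  proof (rule summable_on_comparison_test)
    show "(\<lambda>\<alpha>. B * ((norm (u \<alpha>))\<^sup>2 / weight \<alpha>)) summable_on UNIV"
      using assms unfolding hk_summable_def by (rule summable_on_cmult_right)
    fix \<alpha>
    have "(norm (u \<alpha>))\<^sup>2 / weight (\<alpha> + munit i) = (weight \<alpha> / weight (\<alpha> + munit i)) * ((norm (u \<alpha>))\<^sup>2 / weight \<alpha>)"
      by simp
    also have "\<dots> \<le> B * ((norm (u \<alpha>))\<^sup>2 / weight \<alpha>)"
      by (rule mult_right_mono[OF weight_ratio_le]) (simp add: weight_nonneg)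
    finally show "(norm (u \<alpha>))\<^sup>2 / weight (\<alpha> + munit i) \<le> B * ((norm (u \<alpha>))\<^sup>2 / weight \<alpha>)" .
  qed (simp add: less_imp_le)
  then show ?thesis
    unfolding hk_summable_def
    using summable_on_add_munit[where i = i and f = "\<lambda>\<alpha>. (norm (shift_up i u \<alpha>))\<^sup>2 / weight \<alpha>"]
    by (simp add: shift_up_def)
qed

lemma mult_coord_power_series:
  assumes "hk_summable a u"
  shows "mult_coord i (power_series u) = power_series (shift_up i u)"
proof
  fix z
  show "mult_coord i (power_series u) z = power_series (shift_up i u) z"
  proof (cases "norm z < 1")
    case True
    have "infsum (\<lambda>\<alpha>. mpow z \<alpha> *\<^sub>C shift_up i u \<alpha>) UNIV
        = infsum (\<lambda>\<alpha>. mpow z (\<alpha> + munit i) *\<^sub>C shift_up i u (\<alpha> + munit i)) UNIV"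
      by (rule infsum_add_munit[symmetric]) (simp add: shift_up_def)
    also have "\<dots> = infsum (\<lambda>\<alpha>. z $ i *\<^sub>C mpow z \<alpha> *\<^sub>C u \<alpha>) UNIV"
      by (simp add: mpow_add_munit scaleC_scaleC)
    also have "\<dots> = z $ i *\<^sub>C infsum (\<lambda>\<alpha>. mpow z \<alpha> *\<^sub>C u \<alpha>) UNIV"
      by (rule scaleC_infsum[OF summable_power_series[OF True assms]])
    finally show ?thesis using True by (simp add: mult_coord_def power_series_def on_ball_def)
  qed (simp add: mult_coord_def power_series_def on_ball_def)
qed

lemma hk_summable_shift_down:
  assumes "hk_summable a v"
  shows "hk_summable a (shift_down a i v)"
proof -
  have "(\<lambda>\<beta>. if \<beta> $ i = 0 then 0 else (norm (v \<beta>))\<^sup>2 / weight \<beta>) summable_on UNIV"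
    using assms unfolding hk_summable_def
    by (rule summable_on_comparison_test) (auto simp: weight_nonneg)
  then have "(\<lambda>\<alpha>. (norm (v (\<alpha> + munit i)))\<^sup>2 / weight (\<alpha> + munit i)) summable_on UNIV"
    by (subst (asm) summable_on_add_munit[where i = i, symmetric]) (auto simp del: mabs_add_munit)
  then have "(\<lambda>\<alpha>. B * ((norm (v (\<alpha> + munit i)))\<^sup>2 / weight (\<alpha> + munit i))) summable_on UNIV"
    by (rule summable_on_cmult_right)
  then show ?thesis
    unfolding hk_summable_def
  proof (rule summable_on_comparison_test)
    fix \<alpha>
    define x y N where "x = weight \<alpha>" and "y = weight (\<alpha> + munit i)" and "N = (norm (v (\<alpha> + munit i)))\<^sup>2"
    have xy: "x > 0" "y > 0" unfolding x_def y_def by (rule weight_pos)+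
    have "(norm (shift_down a i v \<alpha>))\<^sup>2 = (x / y)\<^sup>2 * N"
      using xy unfolding shift_down_def x_def[symmetric] y_def[symmetric] N_def
      by (simp add: power_mult_distrib power_divide)
    then have "(norm (shift_down a i v \<alpha>))\<^sup>2 / x = (x / y) * (N / y)"
      using xy by (simp add: power2_eq_square)
    also have "\<dots> \<le> B * (N / y)"
    proof (rule mult_right_mono)
      show "x / y \<le> B" unfolding x_def y_def by (rule weight_ratio_le)
      show "0 \<le> N / y" using xy by (simp add: N_def)
    qed
    finally show "(norm (shift_down a i v \<alpha>))\<^sup>2 / weight \<alpha>
        \<le> B * ((norm (v (\<alpha> + munit i)))\<^sup>2 / weight (\<alpha> + munit i))"
      unfolding x_def y_def N_def .
  qed (simp add: weight_nonneg)
qed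

text \<open>\<open>shift_up i u\<close> is supported on indices of the form \<alpha> + e_i; after
  reindexing, the quotient in \<open>shift_down\<close> replaces the weight at \<alpha> + e_i by the
  one at \<alpha>.\<close>

lemma coeff_inner_shift:
  "coeff_inner a (shift_up i u) v = coeff_inner a u (shift_down a i v)"
proof -
  have "coeff_inner a (shift_up i u) v = infsum (\<lambda>\<alpha>. cinner (shift_up i u (\<alpha> + munit i)) (v (\<alpha> + munit i))
      / complex_of_real (weight (\<alpha> + munit i))) UNIV"
    unfolding coeff_inner_def by (rule infsum_add_munit[symmetric]) (simp add: shift_up_def)
  also have "\<dots> = coeff_inner a u (shift_down a i v)"
    unfolding coeff_inner_def shift_down_def by (rule infsum_cong) (simp add: cinner.scaleR_right)
  finally show ?thesis .
qed

lemma norm_coeff_Delta_le: "norm (coeff_Delta a u \<alpha>) \<le> b * norm (u \<alpha>)"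
proof -
  have "a (Suc (mabs \<alpha>)) / a (mabs \<alpha>) \<le> b" using a_ge by (simp add: divide_le_eq)
  from mult_right_mono[OF this norm_ge_zero[of "u \<alpha>"]]
  show ?thesis by (simp add: coeff_Delta_def less_imp_le)
qed

lemma hk_summable_Delta: "hk_summable a u \<Longrightarrow> hk_summable a (coeff_Delta a u)"
  by (rule hk_summable_bounded[OF _ norm_coeff_Delta_le])

lemma hk_Delta_power_series:
  "hk_summable a u \<Longrightarrow> hk_Delta a (power_series u) = power_series (coeff_Delta a u)"
  by (simp add: hk_Delta_def hk_coeff_power_series coeff_Delta_def[abs_def])

lemma coeff_Delta_symmetric: "coeff_inner a (coeff_Delta a u) v = coeff_inner a u (coeff_Delta a v)"
  unfolding coeff_inner_def coeff_Delta_def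
  by (rule infsum_cong) (simp add: cinner.scaleR_left cinner.scaleR_right)

text \<open>The bound 1 \<le> B \<Delta>, from which the renormed scalar product inherits its lower
  estimate.\<close>

lemma coeff_Delta_lower:
  assumes "hk_summable a u"
  shows "Re (coeff_inner a u u) \<le> B * Re (coeff_inner a (coeff_Delta a u) u)"
proof -
  have "((\<lambda>\<alpha>. Re (cinner (u \<alpha>) (u \<alpha>) / complex_of_real (weight \<alpha>))) has_sum Re (coeff_inner a u u)) UNIV"
    by (intro has_sum_Re has_sum_coeff_inner assms)
  moreover have "((\<lambda>\<alpha>. B * Re (cinner (coeff_Delta a u \<alpha>) (u \<alpha>) / complex_of_real (weight \<alpha>))) has_sum
      B * Re (coeff_inner a (coeff_Delta a u) u)) UNIV"
    by (intro has_sum_cmult_right has_sum_Re has_sum_coeff_inner hk_summable_Delta assms)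
  ultimately show ?thesis
  proof (rule has_sum_mono)
    fix \<alpha>
    define x where "x = Re (cinner (u \<alpha>) (u \<alpha>) / complex_of_real (weight \<alpha>))"
    have "x = (norm (u \<alpha>))\<^sup>2 / weight \<alpha>"
      unfolding x_def cinner_self of_real_divide[symmetric] by simp
    then have "0 \<le> x" by (simp add: weight_nonneg)
    moreover have "1 \<le> B * (a (Suc (mabs \<alpha>)) / a (mabs \<alpha>))"
      using a_le[of "mabs \<alpha>"] by (simp add: le_divide_eq)
    ultimately have "1 * x \<le> B * (a (Suc (mabs \<alpha>)) / a (mabs \<alpha>)) * x"
      by (intro mult_right_mono)
    moreover have "Re (cinner (coeff_Delta a u \<alpha>) (u \<alpha>) / complex_of_real (weight \<alpha>)) = (a (Suc (mabs \<alpha>)) / a (mabs \<alpha>)) * x"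
      unfolding x_def coeff_Delta_def cinner.scaleR_left times_divide_eq_right[symmetric] by simp
    ultimately show "Re (cinner (u \<alpha>) (u \<alpha>) / complex_of_real (weight \<alpha>))
        \<le> B * Re (cinner (coeff_Delta a u \<alpha>) (u \<alpha>) / complex_of_real (weight \<alpha>))"
      unfolding x_def[symmetric] by (simp only: mult_1 mult.assoc)
  qed
qed

text \<open>The identity \<open>1 = P\<^sub>0 + M\<^sub>z \<Delta> M\<^sub>z\<^sup>*\<close>, with \<open>P\<^sub>0\<close> the projection onto the constants.\<close>

lemma coeff_inner_decomp:
  fixes u v :: "nat ^ 'd::finite \<Rightarrow> 'h::complex_hilbert_space"
  assumes "hk_summable a u" "hk_summable a v"
  shows "coeff_inner a u v = cinner (u 0) (v 0) +
    (\<Sum>i\<in>UNIV. coeff_inner a (coeff_Delta a (shift_down a i u)) (shift_down a i v))"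
proof -
  \<comment> \<open>Termwise, the shift weight \<open>s\<close> equals \<open>q * x / y\<close>, the
    factor that \<Delta> and the two backward shifts produce together; this is the reason for the
    ratio a_(n+1)/a_n in \<Delta>.\<close>
  have "(real (Suc (\<alpha> $ i)) / real (Suc (mabs \<alpha>))) *\<^sub>R
      (cinner (u (\<alpha> + munit i)) (v (\<alpha> + munit i)) / complex_of_real (weight (\<alpha> + munit i)))
    = cinner (coeff_Delta a (shift_down a i u) \<alpha>) (shift_down a i v \<alpha>) / complex_of_real (weight \<alpha>)" for \<alpha> i
  proof -
    define x y s q where "x = weight \<alpha>" and "y = weight (\<alpha> + munit i)"
      and "s = real (Suc (\<alpha> $ i)) / real (Suc (mabs \<alpha>))" and "q = a (Suc (mabs \<alpha>)) / a (mabs \<alpha>)"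
    have pos: "x > 0" "y > 0" "s > 0" "q > 0"
      unfolding x_def y_def s_def q_def by (auto simp del: of_nat_Suc)
    have "y = x * q / s"
      using weight_munit[of \<alpha> i] unfolding x_def y_def q_def s_def by (simp del: of_nat_Suc)
    then have "s / y = q * (x / y) * (x / y) / x"
      using pos by (simp add: field_simps)
    then have key: "complex_of_real s / complex_of_real y = complex_of_real q * (complex_of_real (x / y) * complex_of_real (x / y)) / complex_of_real x"
      by (simp only: of_real_divide[symmetric] of_real_mult[symmetric] mult.assoc)
    show ?thesis
      unfolding coeff_Delta_def shift_down_def x_def[symmetric] y_def[symmetric] s_def[symmetric] q_def[symmetric]
      unfolding cinner.scaleR_left cinner.scaleR_right scaleR_conv_of_real
      using arg_cong[OF key, of "\<lambda>t. t * cinner (u (\<alpha> + munit i)) (v (\<alpha> + munit i))"]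
      by (simp only: times_divide_eq_left times_divide_eq_right mult_ac)
  qed
  then show ?thesis
    using infsum_multiindex_shift(2)[OF abs_summable_coeff_inner[OF assms]]
    unfolding coeff_inner_def by simp
qed

text \<open>After division by the weights the backward shift is the plain index shift. This gives
  the intertwining property of the dilation, and conversely recovers the coefficients of a family
  from its backward shifts.\<close>

lemma shift_down_eq_iff:
  "shift_down a i v \<alpha> = weight \<alpha> *\<^sub>R x \<longleftrightarrow> v (\<alpha> + munit i) = weight (\<alpha> + munit i) *\<^sub>R x"
proof -
  define s t where "s = weight \<alpha>" and "t = weight (\<alpha> + munit i)"
  have "s > 0" "t > 0" unfolding s_def t_def by (rule weight_pos)+
  then show ?thesis
    unfolding shift_down_def s_def[symmetric] t_def[symmetric]
    by (simp add: vector_fraction_eq_iff)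
      (simp only: mult.commute[of t s] scaleR_scaleR[symmetric] scaleR_cancel_left, simp)
qed

end

subsection \<open>Growth of the Taylor coefficients\<close>

text \<open>Both bounds compare \<open>a\<close> with geometric sequences whose ratios are close to \<open>r\<close>; since
  \<open>r \<ge> 1\<close> and \<open>q < 1\<close> there is room for a loss by the factor \<open>\<surd>q\<close> in each of them.\<close>

lemma (in kernel_coeffs) ratio_growth:
  assumes lim: "(\<lambda>n. a n / a (Suc n)) \<longlonglongrightarrow> r" and q: "0 < q" "q < 1"
  obtains s where "\<And>n. 0 \<le> s n" "\<And>m n. a m \<le> (s n)\<^sup>2 * a (m + n)"
    "summable (\<lambda>n. a (Suc n) * q ^ n * s n)"
proof -
  \<comment> \<open>Otherwise, for some \<open>x\<close> below 1, the terms
    \<open>a n * x ^ n\<close> would eventually increase, although their series converges.\<close>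
  have r1: "1 \<le> r"
  proof (rule ccontr)
    assume "\<not> 1 \<le> r"
    then obtain x where x: "max r 0 < x" "x < 1" using dense[of "max r 0" 1] by auto
    then have "\<forall>\<^sub>F n in sequentially. a n / a (Suc n) < x"
      using order_tendstoD(2)[OF lim, of x] by simp
    then obtain N where N: "\<And>n. n \<ge> N \<Longrightarrow> a n / a (Suc n) < x"
      unfolding eventually_sequentially by blast
    have inc: "a N * x ^ N \<le> a n * x ^ n" if "n \<ge> N" for n
      using that
    proof (induction n rule: dec_induct)
      case (step n)
      have "a n \<le> x * a (Suc n)" using N[OF step(1)] by (simp add: divide_less_eq less_imp_le)
      then have "a n * x ^ n \<le> x * a (Suc n) * x ^ n" using x by (intro mult_right_mono) auto
      then show ?case using step(3) by (simp add: mult_ac)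
    qed simp
    have "(\<lambda>n. a n * x ^ n) \<longlonglongrightarrow> 0"
      using a_summable[of x] x by (intro summable_LIMSEQ_zero) auto
    then have "a N * x ^ N \<le> 0"
      by (rule LIMSEQ_le_const) (use inc in blast)
    moreover have "0 < a N * x ^ N" using x by simp
    ultimately show False by simp
  qed
  define t where "t = sqrt q"
  have t: "0 < t" "t < 1" "t * t = q" using q by (auto simp: t_def)
  define \<rho> \<tau> where "\<rho> = r / t" and "\<tau> = r * t"
  have pos: "0 < \<rho>" "0 < \<tau>" using r1 t by (auto simp: \<rho>_def \<tau>_def)
  have "r * t < r" using r1 t by (simp add: mult_less_cancel_left2)
  moreover have "r < r / t" using r1 t by (simp add: less_divide_eq mult_less_cancel_left2)
  ultimately have "\<forall>\<^sub>F n in sequentially. \<tau> < a n / a (Suc n) \<and> a n / a (Suc n) < \<rho>"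
    unfolding \<rho>_def \<tau>_def using order_tendstoD[OF lim] by (intro eventually_conj) auto
  then obtain N where N: "\<And>n. n \<ge> N \<Longrightarrow> \<tau> < a n / a (Suc n) \<and> a n / a (Suc n) < \<rho>"
    unfolding eventually_sequentially by blast
  \<comment> \<open>With the ratios trapped between \<open>\<tau>\<close> and \<open>\<rho>\<close>,
    eventually \<open>e\<close> increases and \<open>f\<close> decreases.\<close>
  define e f where "e n = a n * \<rho> ^ n" and "f n = a n * \<tau> ^ n" for n
  have e_pos: "0 < e n" and f_pos: "0 < f n" for n using pos by (auto simp: e_def f_def)
  have e_step: "e n \<le> e (Suc n)" and f_step: "f (Suc n) \<le> f n" if "n \<ge> N" for n
  proof -
    have "a n \<le> \<rho> * a (Suc n)" "\<tau> * a (Suc n) \<le> a n"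
      using N[OF that] by (simp_all add: divide_less_eq less_divide_eq less_imp_le)
    from mult_right_mono[OF this(1), of "\<rho> ^ n"] mult_right_mono[OF this(2), of "\<tau> ^ n"]
    show "e n \<le> e (Suc n)" "f (Suc n) \<le> f n" using pos by (simp_all add: e_def f_def mult_ac)
  qed
  have e_mono: "e n \<le> e k" if "n \<ge> N" "k \<ge> n" for n k
    using that(2,1) by (induction k rule: dec_induct) (auto intro: order_trans e_step)
  have f_anti: "f n \<le> f N" if "n \<ge> N" for n
    using that by (induction n rule: dec_induct) (auto intro: order_trans f_step)
  \<comment> \<open>Constants that absorb the finitely many indices below \<open>N\<close>, where
    the ratios are not controlled.\<close>
  define E0 E1 F1 where "E0 = Min (e ` {..N})" and "E1 = Max (e ` {..N})" and "F1 = Max (f ` {..N})"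
  have E0: "0 < E0" unfolding E0_def by (subst Min_gr_iff) (auto simp: e_pos)
  have E0_le: "E0 \<le> e k" for k
  proof (cases "k \<le> N")
    case True
    then show ?thesis unfolding E0_def by (intro Min_le) auto
  next
    case False
    have "E0 \<le> e N" unfolding E0_def by (intro Min_le) auto
    also have "\<dots> \<le> e k" using False by (intro e_mono) auto
    finally show ?thesis .
  qed
  have E1_ge: "e m \<le> E1" if "m \<le> N" for m unfolding E1_def using that by (intro Max_ge) auto
  have F1_ge: "f k \<le> F1" for k
  proof (cases "k \<le> N")
    case True
    then show ?thesis unfolding F1_def by (intro Max_ge) auto
  next
    case False
    have "f k \<le> f N" using False by (intro f_anti) auto
    also have "\<dots> \<le> F1" unfolding F1_def by (intro Max_ge) auto
    finally show ?thesis .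
  qed
  define D where "D = E1 / E0"
  have E01: "E0 \<le> E1" using E0_le[of 0] E1_ge[of 0] by simp
  have D: "1 \<le> D" unfolding D_def using E0 E01 by simp
  have eD: "e m \<le> D * e k" if "m \<le> k" for m k
  proof (cases "m \<le> N")
    case True
    have "e m \<le> D * E0" using E1_ge[OF True] E0 by (simp add: D_def)
    also have "\<dots> \<le> D * e k" using E0_le D by (intro mult_left_mono) auto
    finally show ?thesis .
  next
    case False
    then have "e m \<le> 1 * e k" using that e_mono by simp
    also have "\<dots> \<le> D * e k" using D e_pos by (intro mult_right_mono) (auto intro: less_imp_le)
    finally show ?thesis .
  qed
  \<comment> \<open>The comparison of \<open>a m\<close> with \<open>a (m + n)\<close> serves to
    bound squared norms, hence the square root.\<close>
  define s where "s n = sqrt (D * \<rho> ^ n)" for n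
  have s0: "0 \<le> s n" for n using D pos by (simp add: s_def)
  have s_sq: "(s n)\<^sup>2 = D * \<rho> ^ n" for n using D pos by (simp add: s_def)
  have "a m \<le> (s n)\<^sup>2 * a (m + n)" for m n
  proof -
    have "a m * \<rho> ^ m \<le> (D * \<rho> ^ n * a (m + n)) * \<rho> ^ m"
      using eD[of m "m + n"] by (simp add: e_def power_add mult_ac)
    then show ?thesis unfolding s_sq using pos by simp
  qed
  moreover have "summable (\<lambda>n. a (Suc n) * q ^ n * s n)"
  proof (rule summable_comparison_test)
    \<comment> \<open>The ratio of the geometric majorant: its square is \<open>t / r\<close>, which
      is below 1 because 1 \<le> r.\<close>
    define u where "u = q * sqrt \<rho> / \<tau>"
    have "u\<^sup>2 \<le> t\<^sup>2 * t\<^sup>2 * (1 / t) / t\<^sup>2"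
    proof -
      have "u\<^sup>2 = q\<^sup>2 * (r / t) / (r * t)\<^sup>2"
        using pos by (simp add: u_def power_mult_distrib power_divide \<rho>_def \<tau>_def)
      also have "\<dots> = t / r"
        using t(1) r1 unfolding t(3)[symmetric] by (simp add: power2_eq_square field_simps)
      also have "\<dots> \<le> t" using t r1 by (simp add: divide_le_eq mult_le_cancel_left1)
      finally show ?thesis using t(1) by (simp add: power2_eq_square)
    qed
    also have "\<dots> = t" using t(1) by (simp add: power2_eq_square)
    finally have "u\<^sup>2 < 1" using t by simp
    moreover have u0: "0 \<le> u" using q pos by (simp add: u_def)
    ultimately have u1: "u < 1" by (simp add: power_less_one_iff abs_square_less_1)
    show "summable (\<lambda>n. F1 / \<tau> * sqrt D * u ^ n)"
      using u0 u1 by (intro summable_mult summable_geometric) auto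
    have "norm (a (Suc n) * q ^ n * s n) \<le> F1 / \<tau> * sqrt D * u ^ n" for n
    proof -
      have "a (Suc n) * \<tau> ^ Suc n \<le> F1" using F1_ge[of "Suc n"] by (simp add: f_def)
      then have "a (Suc n) \<le> F1 / \<tau> ^ Suc n" using pos by (simp add: le_divide_eq)
      then have "a (Suc n) * (q ^ n * s n) \<le> F1 / \<tau> ^ Suc n * (q ^ n * s n)"
        using q s0 by (intro mult_right_mono) auto
      also have "\<dots> = F1 / \<tau> * sqrt D * u ^ n"
        using pos D by (simp add: s_def u_def real_sqrt_mult real_sqrt_power power_mult_distrib power_divide)
      finally show ?thesis using q s0 by (simp add: mult.assoc abs_mult abs_of_pos[OF a_pos])
    qed
    then show "\<exists>N. \<forall>n\<ge>N. norm (a (Suc n) * q ^ n * s n) \<le> F1 / \<tau> * sqrt D * u ^ n" by blast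
  qed
  ultimately show ?thesis using that s0 by blast
qed

section \<open>Cauchy-Schwarz for coefficient families and the adjoint of coordinate
  multiplication\<close>

context kernel_coeffs
begin

lemma coeff_inner_add_right:
  assumes "hk_summable a u" "hk_summable a v" "hk_summable a x"
  shows "coeff_inner a x (\<lambda>\<alpha>. u \<alpha> + v \<alpha>) = coeff_inner a x u + coeff_inner a x v"
  using coeff_inner_add_left[OF assms] coeff_inner_commute[of x] by simp

text \<open>Summable families do not form a type of class \<open>complex_hilbert_space\<close>, so
  the form is pulled back along the map from pairs of scalars to combinations of \<open>u\<close>
  and \<open>v\<close>.\<close>

lemma coeff_inner_cauchy_schwarz:
  fixes u v :: "nat ^ 'd::finite \<Rightarrow> 'h::complex_hilbert_space"
  assumes u: "hk_summable a u" and v: "hk_summable a v"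
  shows "(cmod (coeff_inner a u v))\<^sup>2 \<le> Re (coeff_inner a u u) * Re (coeff_inner a v v)"
proof -
  define g where "g x = (\<lambda>\<alpha>. x $ 1 *\<^sub>C u \<alpha> + x $ 2 *\<^sub>C v \<alpha>)" for x :: "complex ^ 2"
  have g: "hk_summable a (g x)" for x
    unfolding g_def by (intro hk_summable_add hk_summable_scaleC u v)
  have g_add: "g (x + y) = (\<lambda>\<alpha>. g x \<alpha> + g y \<alpha>)" for x y
    by (auto simp: g_def scaleC_add_left)
  have g_scaleC: "g (s *\<^sub>C x) = (\<lambda>\<alpha>. s *\<^sub>C g x \<alpha>)" for s x
    by (auto simp: g_def scaleC_vec_def scaleC_complex_def scaleC_add_right scaleC_scaleC)
  have "psd_form (\<lambda>x y. coeff_inner a (g x) (g y))"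
    by standard
      (auto simp: g_add g_scaleC coeff_inner_add_left coeff_inner_scaleC_left g
        coeff_inner_self_nonneg intro: coeff_inner_commute)
  from psd_form.cauchy_schwarz[OF this, of "axis 1 1" "axis 2 1"]
  show ?thesis by (simp add: g_def axis_def)
qed

lemma coeff_Delta_upper:
  assumes "hk_summable a u"
  shows "Re (coeff_inner a (coeff_Delta a u) (coeff_Delta a u)) \<le> b\<^sup>2 * Re (coeff_inner a u u)"
proof -
  have "infsum (\<lambda>\<alpha>. (norm (coeff_Delta a u \<alpha>))\<^sup>2 / weight \<alpha>) UNIV
      \<le> infsum (\<lambda>\<alpha>. b\<^sup>2 * ((norm (u \<alpha>))\<^sup>2 / weight \<alpha>)) UNIV"
  proof (rule infsum_mono)
    show "(\<lambda>\<alpha>. (norm (coeff_Delta a u \<alpha>))\<^sup>2 / weight \<alpha>) summable_on UNIV"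
      using hk_summable_Delta[OF assms] by (simp add: hk_summable_def)
    show "(\<lambda>\<alpha>. b\<^sup>2 * ((norm (u \<alpha>))\<^sup>2 / weight \<alpha>)) summable_on UNIV"
      using assms unfolding hk_summable_def by (rule summable_on_cmult_right)
    fix \<alpha>
    have "(norm (coeff_Delta a u \<alpha>))\<^sup>2 \<le> (b * norm (u \<alpha>))\<^sup>2"
      by (rule power_mono[OF norm_coeff_Delta_le]) simp
    from divide_right_mono[OF this weight_nonneg]
    show "(norm (coeff_Delta a u \<alpha>))\<^sup>2 / weight \<alpha> \<le> b\<^sup>2 * ((norm (u \<alpha>))\<^sup>2 / weight \<alpha>)"
      by (simp add: power_mult_distrib)
  qed
  then show ?thesis
    unfolding infsum_cmult_right' by (simp only: coeff_inner_self assms hk_summable_Delta Re_complex_of_real)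
qed

lemma hk_summable_sum:
  "(\<And>i. i \<in> I \<Longrightarrow> hk_summable a (u i)) \<Longrightarrow> hk_summable a (\<lambda>\<alpha>. \<Sum>i\<in>I. u i \<alpha>)"
  by (induction I rule: infinite_finite_induct) (auto intro: hk_summable_zero hk_summable_add)

lemma coeff_inner_zero_right [simp]: "coeff_inner a u (\<lambda>\<alpha>. 0) = 0"
  by (simp add: coeff_inner_def)

lemma coeff_inner_sum_right:
  assumes "hk_summable a v" "\<And>i. i \<in> I \<Longrightarrow> hk_summable a (u i)"
  shows "coeff_inner a v (\<lambda>\<alpha>. \<Sum>i\<in>I. u i \<alpha>) = (\<Sum>i\<in>I. coeff_inner a v (u i))"
  using assms(2)
  by (induction I rule: infinite_finite_induct)
    (auto simp: coeff_inner_add_right hk_summable_sum assms(1))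

lemma power_series_zero: "power_series (\<lambda>\<alpha>. 0) = (\<lambda>z. 0)"
  by (auto simp: power_series_def on_ball_def)

lemma power_series_sum:
  assumes "finite I" "\<And>i. i \<in> I \<Longrightarrow> hk_summable a (u i)"
  shows "power_series (\<lambda>\<alpha>. \<Sum>i\<in>I. u i \<alpha>) z = (\<Sum>i\<in>I. power_series (u i) z)"
proof (cases "norm z < 1")
  case True
  have "((\<lambda>\<alpha>. \<Sum>i\<in>I. mpow z \<alpha> *\<^sub>C u i \<alpha>) has_sum (\<Sum>i\<in>I. infsum (\<lambda>\<alpha>. mpow z \<alpha> *\<^sub>C u i \<alpha>) UNIV)) UNIV"
    by (rule has_sum_sum_index) (use summable_power_series[OF True assms(2)] in \<open>simp add: has_sum_infsum\<close>)
  then show ?thesis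
    using True by (simp add: power_series_def on_ball_def scaleC_sum_right infsumI)
qed (simp add: power_series_def on_ball_def)

text \<open>The adjoint is taken within \<open>HK a E\<close>: the backward shift stays there since
  \<open>E\<close> is closed under scalars, and closure under differences lets two candidates be
  tested against their own difference.\<close>

lemma mult_coord_adj_power_series:
  assumes E: "0 \<in> E" "\<And>x y. x \<in> E \<Longrightarrow> y \<in> E \<Longrightarrow> x - y \<in> E" "\<And>c x. x \<in> E \<Longrightarrow> c *\<^sub>C x \<in> E"
    and v: "hk_summable a v" "\<And>\<alpha>. v \<alpha> \<in> E"
  shows "mult_coord_adj a E i (power_series v) = power_series (shift_down a i v)"
  unfolding mult_coord_adj_def hadj_def
proof (rule the_equality)
  let ?s = "shift_down a i v"
  have s: "hk_summable a ?s" by (rule hk_summable_shift_down[OF v(1)])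
  have sE: "?s \<alpha> \<in> E" for \<alpha>
    unfolding shift_down_def scaleC_of_real[symmetric] by (intro E v)
  have adj: "hk_inner a (mult_coord i (power_series u)) (power_series v) = hk_inner a (power_series u) (power_series ?s)"
    if "hk_summable a u" for u
    using that s v by (simp add: mult_coord_power_series hk_inner_power_series hk_summable_shift_up coeff_inner_shift)
  show "power_series ?s \<in> HK a E \<and> (\<forall>h\<in>HK a E. hk_inner a (mult_coord i h) (power_series v) = hk_inner a h (power_series ?s))"
    using s sE adj by (auto simp: HK_def)
  fix x
  assume x: "x \<in> HK a E \<and> (\<forall>h\<in>HK a E. hk_inner a (mult_coord i h) (power_series v) = hk_inner a h x)"
  then obtain u where u: "x = power_series u" "hk_summable a u" "\<And>\<alpha>. u \<alpha> \<in> E"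
    by (auto simp: HK_def)
  define d where "d = (\<lambda>\<alpha>. u \<alpha> - ?s \<alpha>)"
  have d: "hk_summable a d" unfolding d_def by (intro hk_summable_diff u s)
  have "power_series d \<in> HK a E"
    using d u(3) sE E(2) unfolding HK_def d_def by blast
  then have "hk_inner a (power_series d) (power_series ?s) = hk_inner a (power_series d) (power_series u)"
    using x adj[OF d] unfolding u(1) by simp
  then have "coeff_inner a d u - coeff_inner a d ?s = 0"
    by (simp add: hk_inner_power_series d u s)
  moreover have "coeff_inner a d d = coeff_inner a d u - coeff_inner a d ?s"
    by (subst (2) d_def) (rule coeff_inner_diff_right[OF u(2) s d])
  ultimately have "coeff_inner a d d = 0" by simp
  then have "d = (\<lambda>\<alpha>. 0)" by (rule coeff_inner_self_eq_zero[OF d])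
  then have "u = ?s" unfolding d_def by (simp add: fun_eq_iff)
  then show "x = power_series ?s" unfolding u(1) by simp
qed

end

section \<open>Pure \<open>K\<close>-contractions\<close>

lemma closure_rangeE:
  fixes A :: "'a \<Rightarrow> 'b::complex_hilbert_space"
  assumes "x \<in> closure (range A)"
  obtains f where "(\<lambda>n. A (f n)) \<longlonglongrightarrow> x"
proof -
  obtain f where f: "\<forall>n. f n \<in> range A" "f \<longlonglongrightarrow> x"
    using assms unfolding closure_sequential by (elim exE conjE)
  define g where "g n = inv A (f n)" for n
  have "A (g n) = f n" for n
    unfolding g_def by (rule f_inv_into_f) (rule f(1)[rule_format])
  then have "(\<lambda>n. A (g n)) = f" by (rule ext)
  with f(2) show ?thesis by (intro that[of g]) (simp only:)
qed

lemma closure_rangeI: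
  fixes A :: "'a \<Rightarrow> 'b::complex_hilbert_space"
  shows "(\<lambda>n. A (f n)) \<longlonglongrightarrow> x \<Longrightarrow> x \<in> closure (range A)"
  unfolding closure_sequential by (intro exI[of _ "\<lambda>n. A (f n)"]) simp

lemma closure_range_diff:
  assumes A: "bounded_clinear A" and "x \<in> closure (range A)" "y \<in> closure (range A)"
  shows "x - y \<in> closure (range A)"
proof -
  obtain f g where "(\<lambda>n. A (f n)) \<longlonglongrightarrow> x" "(\<lambda>n. A (g n)) \<longlonglongrightarrow> y"
    using closure_rangeE[OF assms(2)] closure_rangeE[OF assms(3)] by metis
  from tendsto_diff[OF this] show ?thesis
    unfolding clinear_diff[OF A, symmetric] by (rule closure_rangeI)
qed

lemma closure_range_scaleC:
  assumes A: "bounded_clinear A" and "x \<in> closure (range A)"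
  shows "s *\<^sub>C x \<in> closure (range A)"
proof -
  obtain f where "(\<lambda>n. A (f n)) \<longlonglongrightarrow> x" using assms(2) by (rule closure_rangeE)
  from clinear_tendsto[OF bounded_clinear_scaleC this, of s] show ?thesis
    unfolding clinear_scaleC[OF A, symmetric] by (rule closure_rangeI)
qed

text \<open>Transports the closed ranges of \<open>C\<close> and \<open>D\<close> into each other
  once the intertwining relations are known.\<close>

lemma closure_range_intertwine:
  assumes R: "bounded_clinear R" and eq: "\<And>x. R (A x) = A' (R x)" and x: "x \<in> closure (range A)"
  shows "R x \<in> closure (range A')"
proof -
  have "R ` closure (range A) \<subseteq> closure (range A')"
  proof (rule image_closure_subset)
    show "continuous_on (closure (range A)) R"
      by (rule linear_continuous_on[OF bounded_clinear_imp_bounded_linear[OF R]])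
    have "R ` range A \<subseteq> range A'" using eq by auto
    then show "R ` range A \<subseteq> closure (range A')" using closure_subset by (rule subset_trans)
  qed simp
  then show ?thesis using x by (rule image_subset_iff[THEN iffD1, rule_format])
qed


locale pure_contraction = kernel_coeffs a b B + operator_tuple T
  for a b B and T :: "'d::finite \<Rightarrow> 'h::complex_hilbert_space \<Rightarrow> 'h" +
  fixes c r
  assumes pure: "pure_K_contraction a c T"
    and ratio_limit: "(\<lambda>n. a n / a (Suc n)) \<longlonglongrightarrow> r"
begin

abbreviation "C \<equiv> defect_op c T"
abbreviation "E \<equiv> defect_space c T"

lemma positive_C: "positive_op cinner C" and C_C: "C (C x) = inv_K c T x"
  using cinner.op_sqrt[of "inv_K c T"] pure
  by (auto simp: defect_op_def pure_K_contraction_def K_contraction_def)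

lemma bounded_clinear_C: "bounded_clinear C"
  using positive_C by (simp add: positive_op_def)

lemma C_hermitian: "cinner (C x) y = cinner x (C y)"
  by (rule cinner.positive_op_hermitian[OF positive_C])

lemma C_mem_E: "C x \<in> E"
  unfolding defect_space_def by (rule subsetD[OF closure_subset rangeI])

lemma E_zero: "0 \<in> E"
  using C_mem_E[of 0] by (simp only: clinear_zero[OF bounded_clinear_C])

lemma E_diff: "x \<in> E \<Longrightarrow> y \<in> E \<Longrightarrow> x - y \<in> E"
  unfolding defect_space_def by (rule closure_range_diff[OF bounded_clinear_C])

lemma E_scaleC: "x \<in> E \<Longrightarrow> s *\<^sub>C x \<in> E"
  unfolding defect_space_def by (rule closure_range_scaleC[OF bounded_clinear_C])

lemma E_scaleR: "x \<in> E \<Longrightarrow> t *\<^sub>R x \<in> E"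
  unfolding scaleC_of_real[symmetric] by (rule E_scaleC)

subsection \<open>The canonical dilation\<close>

definition dil :: "'h \<Rightarrow> nat ^ 'd \<Rightarrow> 'h"
  where "dil h \<alpha> = weight \<alpha> *\<^sub>R C (adj_mpow T \<alpha> h)"

lemma dilation_eq: "dilation a c T h = power_series (dil h)"
  by (simp add: dilation_def dil_def[abs_def])

lemma dil_mem_E: "dil h \<alpha> \<in> E"
  unfolding dil_def by (intro E_scaleR C_mem_E)

lemma dil_zero_index [simp]: "dil h 0 = C h"
  by (simp add: dil_def)

text \<open>Up to the factor \<open>a n\<close>, the level \<open>n\<close> part of the squared norm
  of the dilation; pureness says that these parts add up to the squared norm of
  \<open>h\<close>.\<close>

definition sigma_form :: "nat \<Rightarrow> 'h \<Rightarrow> real"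
  where "sigma_form n h = Re (cinner ((sigma_op T ^^ n) (inv_K c T) h) h)"

lemma cinner_inv_K: "cinner (inv_K c T g) g = of_real ((norm (C g))\<^sup>2)"
  unfolding C_C[symmetric] cinner_self[symmetric] by (rule C_hermitian)

lemma sigma_form_eq: "sigma_form n h = (\<Sum>\<alpha> | mabs \<alpha> = n. mgamma \<alpha> * (norm (C (adj_mpow T \<alpha> h)))\<^sup>2)"
  unfolding sigma_form_def cinner_sigma_op_power cinner_inv_K by simp

lemma sigma_form_nonneg: "0 \<le> sigma_form n h"
  unfolding sigma_form_eq by (intro sum_nonneg mult_nonneg_nonneg less_imp_le[OF mgamma_pos] zero_le_power2)

lemma sums_pure: "(\<lambda>n. a n *\<^sub>R (sigma_op T ^^ n) (inv_K c T) h) sums h"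
proof -
  have "(\<lambda>N. h - (\<Sum>n\<le>N. a n *\<^sub>R (sigma_op T ^^ n) (inv_K c T) h)) \<longlonglongrightarrow> 0"
    using pure by (simp add: pure_K_contraction_def)
  from tendsto_diff[OF tendsto_const[of h] this]
  show ?thesis by (simp add: sums_def_le)
qed

lemma sums_cinner_pure:
  "(\<lambda>n. of_real (a n) * cinner ((sigma_op T ^^ n) (inv_K c T) h) g) sums cinner h g"
  using bounded_linear.sums[OF bounded_linear_cinner_left sums_pure[of h], of g]
  by (simp add: cinner.scaleR_left)

lemma sums_sigma_form: "(\<lambda>n. a n * sigma_form n h) sums (norm h)\<^sup>2"
  using sums_Re[OF sums_cinner_pure[of h h]] by (simp add: sigma_form_def cinner_self)

lemma norm_dil: "(norm (dil h \<alpha>))\<^sup>2 / weight \<alpha> = weight \<alpha> * (norm (C (adj_mpow T \<alpha> h)))\<^sup>2"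
  unfolding dil_def norm_scaleR abs_of_pos[OF weight_pos] power_mult_distrib
  by (simp add: power2_eq_square)

lemma hk_summable_dil: "hk_summable a (dil h)"
proof -
  have "(\<Sum>\<alpha> | mabs \<alpha> = n. weight \<alpha> * (norm (C (adj_mpow T \<alpha> h)))\<^sup>2) = a n * sigma_form n h" for n
    unfolding sigma_form_eq sum_distrib_left by (rule sum.cong) (auto simp: mult.assoc)
  then have "(\<lambda>n. \<Sum>\<alpha> | mabs \<alpha> = n. weight \<alpha> * (norm (C (adj_mpow T \<alpha> h)))\<^sup>2) sums (norm h)\<^sup>2"
    using sums_sigma_form[of h] by (simp only:)
  then have "((\<lambda>\<alpha>. weight \<alpha> * (norm (C (adj_mpow T \<alpha> h)))\<^sup>2) has_sum (norm h)\<^sup>2) UNIV"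
    by (rule has_sum_of_levels_nonneg[rotated]) (simp add: weight_nonneg)
  then show ?thesis unfolding hk_summable_def norm_dil summable_on_def by blast
qed

text \<open>Isometry of the dilation: summed by levels, the left side is the series of a_n
  \<sigma>^n(1/K(T)) tested on \<open>h\<close> and \<open>g\<close>, and pureness gives its
  value.\<close>

lemma coeff_inner_dil: "coeff_inner a (dil h) (dil g) = cinner h g"
proof -
  have "(\<lambda>n. \<Sum>\<alpha> | mabs \<alpha> = n. cinner (dil h \<alpha>) (dil g \<alpha>) / complex_of_real (weight \<alpha>)) sums coeff_inner a (dil h) (dil g)"
    by (intro has_sum_imp_sums has_sum_levels has_sum_coeff_inner hk_summable_dil)
  moreover have "(\<Sum>\<alpha> | mabs \<alpha> = n. cinner (dil h \<alpha>) (dil g \<alpha>) / complex_of_real (weight \<alpha>))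
      = of_real (a n) * cinner ((sigma_op T ^^ n) (inv_K c T) h) g" for n
  proof -
    have "cinner (dil h \<alpha>) (dil g \<alpha>) / complex_of_real (weight \<alpha>)
        = of_real (a (mabs \<alpha>)) * (mgamma \<alpha> *\<^sub>R cinner (inv_K c T (adj_mpow T \<alpha> h)) (adj_mpow T \<alpha> g))" for \<alpha>
      unfolding dil_def cinner.scaleR_left cinner.scaleR_right C_C[symmetric]
      by (simp add: C_hermitian scaleR_conv_of_real)
    then show ?thesis
      unfolding cinner_sigma_op_power sum_distrib_left by (intro sum.cong) auto
  qed
  ultimately show ?thesis
    using sums_cinner_pure[of h g] by (simp only: sums_unique2)
qed

lemma shift_down_dil: "shift_down a i (dil h) = dil (cadj (T i) h)"
proof
  fix \<alpha>
  show "shift_down a i (dil h) \<alpha> = dil (cadj (T i) h) \<alpha>"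
    unfolding dil_def[of "cadj (T i) h"] shift_down_eq_iff adj_mpow_cadj
    by (simp only: dil_def adj_mpow_add_munit)
qed

lemma dil_add: "dil (h + g) = (\<lambda>\<alpha>. dil h \<alpha> + dil g \<alpha>)"
  by (simp add: dil_def fun_eq_iff clinear_add[OF bounded_clinear_C] clinear_add[OF bounded_clinear_adj_mpow]
      scaleR_add_right)

lemma dil_scaleC: "dil (s *\<^sub>C h) = (\<lambda>\<alpha>. s *\<^sub>C dil h \<alpha>)"
  by (simp add: dil_def fun_eq_iff clinear_scaleC[OF bounded_clinear_C]
      clinear_scaleC[OF bounded_clinear_adj_mpow] scaleC_scaleR_commute)

lemma dil_scaleR: "dil (t *\<^sub>R h) = (\<lambda>\<alpha>. complex_of_real t *\<^sub>C dil h \<alpha>)"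
  unfolding scaleC_of_real[symmetric, of t h] by (rule dil_scaleC)

definition dil_adj :: "(nat ^ 'd \<Rightarrow> 'h) \<Rightarrow> 'h"
  where "dil_adj = hadj UNIV cinner (coeff_inner a) dil"

text \<open>Riesz on \<open>H\<close>: the functional is bounded by the norm of \<open>v\<close>,
  because the dilation is isometric.\<close>

lemma dil_adj:
  assumes v: "hk_summable a v"
  shows "coeff_inner a (dil h) v = cinner h (dil_adj v)"
proof -
  have "bounded_linear (\<lambda>h. coeff_inner a (dil h) v)"
  proof (rule bounded_linear_intro)
    show "coeff_inner a (dil (x + y)) v = coeff_inner a (dil x) v + coeff_inner a (dil y) v" for x y
      by (simp add: dil_add coeff_inner_add_left hk_summable_dil v)
    show "coeff_inner a (dil (t *\<^sub>R x)) v = t *\<^sub>R coeff_inner a (dil x) v" for t x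
      unfolding dil_scaleR coeff_inner_scaleC_left[OF hk_summable_dil v] by (simp add: scaleR_conv_of_real)
    show "norm (coeff_inner a (dil x) v) \<le> norm x * sqrt (Re (coeff_inner a v v))" for x
    proof (rule power2_le_imp_le)
      show "(norm (coeff_inner a (dil x) v))\<^sup>2 \<le> (norm x * sqrt (Re (coeff_inner a v v)))\<^sup>2"
        using coeff_inner_cauchy_schwarz[OF hk_summable_dil[of x] v]
        by (simp add: coeff_inner_dil cinner_self power_mult_distrib coeff_inner_self_nonneg[OF v])
    qed (simp add: coeff_inner_self_nonneg[OF v])
  qed
  then obtain x where x: "\<And>h. coeff_inner a (dil h) v = cinner h x"
    by (rule riesz) (auto simp: dil_scaleC coeff_inner_scaleC_left hk_summable_dil v)
  then show ?thesis
    unfolding dil_adj_def using hadj_UNIV_eqI[of "coeff_inner a" dil, OF x] by simp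
qed

subsection \<open>The renormed space\<close>

abbreviation "\<Delta> \<equiv> Delta_T a c T"

lemma Delta_T_eq: "\<Delta> h = dil_adj (coeff_Delta a (dil h))"
proof -
  have "hk_inner a (dilation a c T g) (hk_Delta a (dilation a c T h)) = cinner g (dil_adj (coeff_Delta a (dil h)))" for g
    unfolding dilation_eq hk_Delta_power_series[OF hk_summable_dil]
    by (simp add: hk_inner_power_series hk_summable_dil hk_summable_Delta dil_adj)
  then show ?thesis
    unfolding Delta_T_def by (rule hadj_UNIV_eqI[where q = "hk_inner a" and A = "dilation a c T"])
qed

lemma cinner_Delta_T_right: "cinner g (\<Delta> h) = coeff_inner a (dil g) (coeff_Delta a (dil h))"
  by (simp add: Delta_T_eq dil_adj hk_summable_dil hk_summable_Delta)

lemma cinner_Delta_T: "cinner (\<Delta> h) g = coeff_inner a (coeff_Delta a (dil h)) (dil g)"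
  using cinner_Delta_T_right[of g h] cinner_commute[of "\<Delta> h" g] coeff_inner_commute[of "dil g"] by simp

lemma Delta_T_hermitian: "cinner (\<Delta> h) g = cinner h (\<Delta> g)"
  by (simp add: cinner_Delta_T cinner_Delta_T_right coeff_Delta_symmetric)

text \<open>The bound \<open>b\<close> of \<Delta> survives compression by the isometric dilation;
  Cauchy-Schwarz is applied to \<Delta> of the dilation of \<open>x\<close> against the dilation of
  \<open>\<Delta> x\<close>.\<close>

lemma bounded_clinear_Delta_T: "bounded_clinear \<Delta>"
proof (rule bounded_clinearI)
  show "\<Delta> (x + y) = \<Delta> x + \<Delta> y" for x y
    by (rule cinner_eqI) (simp add: Delta_T_hermitian[symmetric] cinner.add_right)
  show "\<Delta> (s *\<^sub>C x) = s *\<^sub>C \<Delta> x" for s x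
    by (rule cinner_eqI) (simp add: Delta_T_hermitian[symmetric] cinner.scaleC_right)
  fix x
  have "(norm (\<Delta> x))\<^sup>2 = cmod (coeff_inner a (coeff_Delta a (dil x)) (dil (\<Delta> x)))"
    unfolding cinner_Delta_T[symmetric] cinner_self by (simp add: norm_power)
  then have "((norm (\<Delta> x))\<^sup>2)\<^sup>2 \<le> Re (coeff_inner a (coeff_Delta a (dil x)) (coeff_Delta a (dil x))) * (norm (\<Delta> x))\<^sup>2"
    using coeff_inner_cauchy_schwarz[OF hk_summable_Delta[OF hk_summable_dil[of x]] hk_summable_dil[of "\<Delta> x"]]
    by (simp add: coeff_inner_dil cinner_self)
  also have "Re (coeff_inner a (coeff_Delta a (dil x)) (coeff_Delta a (dil x))) \<le> b\<^sup>2 * (norm x)\<^sup>2"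
    using coeff_Delta_upper[OF hk_summable_dil[of x]] by (simp add: coeff_inner_dil cinner_self)
  finally have "(norm (\<Delta> x))\<^sup>2 * (norm (\<Delta> x))\<^sup>2 \<le> (norm x * b)\<^sup>2 * (norm (\<Delta> x))\<^sup>2"
    by (simp add: mult_right_mono power2_eq_square mult_ac)
  then have "(norm (\<Delta> x))\<^sup>2 \<le> (norm x * b)\<^sup>2"
    by (cases "\<Delta> x = 0") (simp, simp only: mult_le_cancel_right, simp)
  then show "norm (\<Delta> x) \<le> norm x * b"
    by (rule power2_le_imp_le) (use b_pos in simp)
qed

lemma hilbert_form_tinner_d: "\<exists>m K. hilbert_form (tinner_d a c T) m K"
proof -
  obtain K where K: "K > 0" "\<And>x. norm (\<Delta> x) \<le> norm x * K"
    using bounded_clinear_pos_bound[OF bounded_clinear_Delta_T] by blast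
  have low: "norm x ^ 2 \<le> B * Re (tinner a c T x x)" for x
    using coeff_Delta_lower[OF hk_summable_dil[of x]]
    by (simp add: tinner_def cinner_Delta_T coeff_inner_dil cinner_self)
  have tpos: "0 \<le> Re (tinner a c T x x)" for x
    using low[of x] B_pos by (metis zero_le_mult_iff zero_le_power2 order_trans not_less)
  \<comment> \<open>The lower constant stems from 1 \<le> B \<Delta>; the upper one bounds each
    coordinate by the full norm and counts the coordinates.\<close>
  have "hilbert_form (tinner_d a c T) (1 / B) (real CARD('d) * K)"
  proof
    fix x y z :: "'h ^ 'd" and s :: complex
    show "tinner_d a c T (x + y) z = tinner_d a c T x z + tinner_d a c T y z"
      by (simp add: tinner_d_def tinner_def clinear_add[OF bounded_clinear_Delta_T] cinner.add_left sum.distrib)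
    show "tinner_d a c T (s *\<^sub>C x) z = s * tinner_d a c T x z"
      by (simp add: tinner_d_def tinner_def scaleC_vec_def clinear_scaleC[OF bounded_clinear_Delta_T]
          cinner_scaleC_left sum_distrib_left)
    show "tinner_d a c T x y = cnj (tinner_d a c T y x)"
      unfolding tinner_d_def tinner_def cnj_sum Delta_T_hermitian
      by (rule sum.cong[OF refl]) (simp add: Delta_T_hermitian[symmetric] cinner_commute[symmetric])
    show "0 \<le> Re (tinner_d a c T x x)"
      by (simp add: tinner_d_def sum_nonneg tpos)
    show "1 / B > 0" using B_pos by simp
    have "(norm x)\<^sup>2 = (\<Sum>i\<in>UNIV. (norm (x $ i))\<^sup>2)"
      by (simp add: norm_vec_def L2_set_def sum_nonneg)
    also have "\<dots> \<le> (\<Sum>i\<in>UNIV. B * Re (tinner a c T (x $ i) (x $ i)))"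
      by (intro sum_mono low)
    also have "\<dots> = B * Re (tinner_d a c T x x)"
      by (simp add: tinner_d_def sum_distrib_left)
    finally show "1 / B * (norm x)\<^sup>2 \<le> Re (tinner_d a c T x x)"
      using B_pos by (simp add: divide_le_eq mult.commute)
    have "cmod (tinner a c T (x $ i) (y $ i)) \<le> K * norm x * norm y" for i
    proof -
      have "cmod (tinner a c T (x $ i) (y $ i)) \<le> norm (\<Delta> (x $ i)) * norm (y $ i)"
        unfolding tinner_def by (rule norm_cinner_le)
      also have "\<dots> \<le> (norm (x $ i) * K) * norm (y $ i)" by (intro mult_right_mono K) simp
      also have "\<dots> \<le> (norm x * K) * norm y"
        using K(1) by (intro mult_mono Finite_Cartesian_Product.norm_nth_le) auto
      finally show ?thesis by (simp add: mult.commute)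
    qed
    then have "cmod (tinner_d a c T x y) \<le> (\<Sum>i\<in>(UNIV::'d set). K * norm x * norm y)"
      unfolding tinner_d_def by (intro order_trans[OF norm_sum] sum_mono)
    then show "cmod (tinner_d a c T x y) \<le> real CARD('d) * K * norm x * norm y"
      by (simp add: mult.assoc)
  qed
  then show ?thesis by blast
qed

text \<open>The equivalence constants are only known to exist; choosing them makes them terms with
  which the locale can be instantiated.\<close>

definition td_lower where "td_lower = (SOME m. \<exists>K. hilbert_form (tinner_d a c T) m K)"
definition td_upper where "td_upper = (SOME K. hilbert_form (tinner_d a c T) td_lower K)"

sublocale td: hilbert_form "tinner_d a c T" td_lower td_upper
  unfolding td_upper_def
  by (rule someI_ex) (unfold td_lower_def, rule someI_ex, rule hilbert_form_tinner_d)

lemma I_T_adj_eq: "I_T_adj a c T = \<Delta>"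
proof
  fix y
  show "I_T_adj a c T y = \<Delta> y"
    unfolding I_T_adj_def by (rule hadj_UNIV_eqI) (simp add: tinner_def Delta_T_hermitian)
qed

section \<open>The row operator on the renormed space, its adjoint and the two defect
  operators\<close>

abbreviation "T' \<equiv> T_tilde a c T"
abbreviation "D \<equiv> D_tilde_op a c T"

definition T_col :: "'h \<Rightarrow> 'h ^ 'd"
  where "T_col y = (\<chi> i. cadj (T i) y)"

lemma T_tilde_eq: "T' x = (\<Sum>i\<in>UNIV. T i (\<Delta> (x $ i)))"
  by (simp add: T_tilde_def I_T_adj_eq)

lemma bounded_clinear_T_tilde: "bounded_clinear T'"
  unfolding T_tilde_eq[abs_def]
  by (rule bounded_clinear_sum)
    (rule bounded_clinear_compose[OF bounded_clinear_T
        bounded_clinear_compose[OF bounded_clinear_Delta_T bounded_clinear_vec_nth]])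

lemma bounded_clinear_T_col: "bounded_clinear T_col"
  unfolding T_col_def[abs_def] by (rule bounded_clinear_vec_lambda) (rule bounded_clinear_cadj[OF bounded_clinear_T])

text \<open>The factor \<open>\<Delta>\<close> inside \<open>T'\<close> is absorbed by the renormed
  scalar product, so the adjoint is the plain column of the \<open>cadj (T i)\<close>.\<close>

lemma cinner_T_tilde: "cinner (T' x) y = tinner_d a c T x (T_col y)"
  by (simp add: T_tilde_eq tinner_d_def tinner_def T_col_def cinner_sum_left cadj[OF bounded_clinear_T])

lemma T_tilde_adj: "hadj UNIV (tinner_d a c T) cinner T' = T_col"
  by (rule ext) (rule td.hadj_eqI, rule cinner_T_tilde)

text \<open>Both parts are the decomposition of \<open>coeff_inner\<close> with the backward shifts
  of \<open>v\<close> replaced by dilations, which turns each \<Delta>-term into one about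
  \<open>Delta_T\<close>.\<close>

lemma coeff_inner_lift:
  assumes v: "hk_summable a v" and x: "\<And>i. shift_down a i v = dil (x $ i)"
  shows "coeff_inner a v (dil k) = cinner (C (v 0) + T' x) k"
    and "coeff_inner a v v = cinner (v 0) (v 0) + tinner_d a c T x x"
proof -
  show "coeff_inner a v (dil k) = cinner (C (v 0) + T' x) k"
    unfolding coeff_inner_decomp[OF v hk_summable_dil] x shift_down_dil cinner_Delta_T[symmetric]
    by (simp add: cinner.add_left T_tilde_eq cinner_sum_left cadj[OF bounded_clinear_T] C_hermitian)
  show "coeff_inner a v v = cinner (v 0) (v 0) + tinner_d a c T x x"
    unfolding coeff_inner_decomp[OF v v] x cinner_Delta_T[symmetric] tinner_d_def tinner_def ..
qed

text \<open>A dilation is itself such a lift, with \<open>x\<close> replaced by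
  \<open>T_col x\<close> and constant term \<open>C x\<close>; isometry evaluates the left
  side.\<close>

lemma T_tilde_T_col: "T' (T_col x) = x - C (C x)"
proof (rule cinner_eqI_left)
  fix k
  have "cinner x k = cinner (C (C x) + T' (T_col x)) k"
    using coeff_inner_lift(1)[OF hk_summable_dil[of x], of "T_col x" k]
    by (simp add: shift_down_dil T_col_def coeff_inner_dil)
  then show "cinner (T' (T_col x)) k = cinner (x - C (C x)) k"
    by (simp add: cinner.add_left cinner.diff_left)
qed

text \<open>The adjoint \<open>T_col\<close> is contractive because T' T_col = 1 - C C, and
  contractivity passes to \<open>T'\<close> through Cauchy-Schwarz.\<close>

lemma T_tilde_contraction: "norm (T' x) \<le> td.pn x"
proof -
  have "norm (T' x) * norm (T' x) \<le> td.pn x * norm (T' x)"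
  proof -
    have "(td.pn (T_col y))\<^sup>2 \<le> (norm y)\<^sup>2" for y
    proof -
      have "tinner_d a c T (T_col y) (T_col y) = cinner y y - cinner (C y) (C y)"
        by (simp add: cinner_T_tilde[symmetric] T_tilde_T_col cinner.diff_left C_hermitian)
      then have "Re (tinner_d a c T (T_col y) (T_col y)) = (norm y)\<^sup>2 - (norm (C y))\<^sup>2"
        by (simp add: cinner_self)
      then show ?thesis unfolding td.pn_power2 by simp
    qed
    then have col: "td.pn (T_col y) \<le> norm y" for y by (rule power2_le_imp_le) simp
    have "norm (T' x) * norm (T' x) = cmod (tinner_d a c T x (T_col (T' x)))"
      unfolding cinner_T_tilde[symmetric] cinner_self by (simp add: norm_power power2_eq_square norm_mult)
    also have "\<dots> \<le> td.pn x * td.pn (T_col (T' x))" by (rule td.p_le_pn)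
    also have "\<dots> \<le> td.pn x * norm (T' x)" by (intro mult_left_mono col) simp
    finally show ?thesis .
  qed
  then show ?thesis by (cases "T' x = 0") auto
qed

lemma positive_defect: "positive_op (tinner_d a c T) (\<lambda>x. x - T_col (T' x))"
  unfolding positive_op_def
proof (intro conjI allI)
  show "bounded_clinear (\<lambda>x. x - T_col (T' x))"
    by (intro bounded_clinear_diff bounded_clinear_ident bounded_clinear_compose[OF bounded_clinear_T_col bounded_clinear_T_tilde])
  fix x
  have "tinner_d a c T (T_col (T' x)) x = cinner (T' x) (T' x)"
    using td.commute[of "T_col (T' x)" x] cinner_T_tilde[of x "T' x"] cinner_commute[of "T' x" "T' x"] by simp
  then have "tinner_d a c T (x - T_col (T' x)) x = of_real ((td.pn x)\<^sup>2 - (norm (T' x))\<^sup>2)"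
    by (simp add: td.diff_left td.p_self cinner_self)
  moreover have "(norm (T' x))\<^sup>2 \<le> (td.pn x)\<^sup>2"
    by (rule power_mono[OF T_tilde_contraction]) simp
  ultimately show "tinner_d a c T (x - T_col (T' x)) x \<in> \<real>\<^sub>\<ge>\<^sub>0"
    by (simp only: nonneg_Reals_of_real_iff)
qed

lemma D_eq: "D = op_sqrt (tinner_d a c T) (\<lambda>x. x - T_col (T' x))"
  by (simp add: D_tilde_op_def T_tilde_adj)

lemma positive_D: "positive_op (tinner_d a c T) D" and D_D: "D (D x) = x - T_col (T' x)"
  using td.op_sqrt[OF positive_defect] by (auto simp: D_eq)

lemma bounded_clinear_D: "bounded_clinear D"
  using positive_D by (simp add: positive_op_def)

text \<open>The relations that make \<open>(-T', C; D, T'\<^sup>*)\<close> a unitary block operator.\<close>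

lemma T_tilde_D: "T' (D x) = C (T' x)"
  by (rule td.positive_sqrt_intertwine[OF positive_D cinner.hilbert_form_axioms positive_C bounded_clinear_T_tilde])
    (simp add: D_D clinear_diff[OF bounded_clinear_T_tilde] T_tilde_T_col)

lemma T_col_C: "T_col (C x) = D (T_col x)"
  by (rule cinner.positive_sqrt_intertwine[OF positive_C td.hilbert_form_axioms positive_D bounded_clinear_T_col])
    (simp add: D_D T_tilde_T_col clinear_diff[OF bounded_clinear_T_col])

end

context pure_contraction
begin

subsection \<open>The function \<open>W\<^sub>T\<close>\<close>

text \<open>Pureness expands each squared norm on the left into a series of
  \<open>sigma_form\<close>; the levels recombine to \<open>sigma_form (m + n) h\<close>, and the
  comparison of \<open>a m\<close> with \<open>a (m + n)\<close> leaves a tail of the series for the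
  squared norm of \<open>h\<close>.\<close>

lemma sum_norm_adj_mpow_le:
  assumes s: "\<And>m. a m \<le> t * a (m + n)" and t: "0 \<le> t"
  shows "(\<Sum>\<alpha> | mabs \<alpha> = n. mgamma \<alpha> * (norm (adj_mpow T \<alpha> h))\<^sup>2) \<le> t * (norm h)\<^sup>2"
proof -
  have level: "(\<Sum>\<alpha> | mabs \<alpha> = n. mgamma \<alpha> * sigma_form m (adj_mpow T \<alpha> h)) = sigma_form (m + n) h" for m
  proof -
    have "(sigma_op T ^^ (m + n)) (inv_K c T) = (sigma_op T ^^ n) ((sigma_op T ^^ m) (inv_K c T))"
      by (subst add.commute) (simp only: funpow_add comp_apply)
    then show ?thesis
      by (simp only: sigma_form_def cinner_sigma_op_power[of n "(sigma_op T ^^ m) (inv_K c T)"] Re_sum scaleR_complex.sel)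
  qed
  have "(\<lambda>m. \<Sum>\<alpha> | mabs \<alpha> = n. mgamma \<alpha> * (a m * sigma_form m (adj_mpow T \<alpha> h))) sums
      (\<Sum>\<alpha> | mabs \<alpha> = n. mgamma \<alpha> * (norm (adj_mpow T \<alpha> h))\<^sup>2)"
    by (intro sums_sum sums_mult sums_sigma_form)
  also have "(\<lambda>m. \<Sum>\<alpha> | mabs \<alpha> = n. mgamma \<alpha> * (a m * sigma_form m (adj_mpow T \<alpha> h)))
      = (\<lambda>m. a m * sigma_form (m + n) h)"
  proof
    fix m
    have "a m * sigma_form (m + n) h = (\<Sum>\<alpha> | mabs \<alpha> = n. a m * (mgamma \<alpha> * sigma_form m (adj_mpow T \<alpha> h)))"
      by (simp only: level[symmetric] sum_distrib_left)
    then show "(\<Sum>\<alpha> | mabs \<alpha> = n. mgamma \<alpha> * (a m * sigma_form m (adj_mpow T \<alpha> h))) = a m * sigma_form (m + n) h"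
      by (simp only: mult.left_commute)
  qed
  finally have 1: "(\<lambda>m. a m * sigma_form (m + n) h) sums
      (\<Sum>\<alpha> | mabs \<alpha> = n. mgamma \<alpha> * (norm (adj_mpow T \<alpha> h))\<^sup>2)" .
  have 2: "(\<lambda>m. t * (a (m + n) * sigma_form (m + n) h)) sums
      (t * ((norm h)\<^sup>2 - (\<Sum>m<n. a m * sigma_form m h)))"
    using sums_mult[OF sums_split_initial_segment[OF sums_sigma_form[of h], of n], of t] .
  have "a m * sigma_form (m + n) h \<le> t * (a (m + n) * sigma_form (m + n) h)" for m
    using mult_right_mono[OF s sigma_form_nonneg, of m "m + n" h] by (simp only: mult.assoc)
  then have "(\<Sum>\<alpha> | mabs \<alpha> = n. mgamma \<alpha> * (norm (adj_mpow T \<alpha> h))\<^sup>2)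
      \<le> t * ((norm h)\<^sup>2 - (\<Sum>m<n. a m * sigma_form m h))"
    by (rule sums_le[OF _ 1 2])
  also have "\<dots> \<le> t * (norm h)\<^sup>2"
  proof (rule mult_left_mono[OF _ t])
    have "0 \<le> (\<Sum>m<n. a m * sigma_form m h)"
      by (intro sum_nonneg mult_nonneg_nonneg sigma_form_nonneg less_imp_le[OF a_pos])
    then show "(norm h)\<^sup>2 - (\<Sum>m<n. a m * sigma_form m h) \<le> (norm h)\<^sup>2" by simp
  qed
  finally show ?thesis .
qed

text \<open>This replaces the spectral radius estimate for \<open>ZT\<^sup>*\<close>: by Cauchy-Schwarz the \<open>n\<close>-th term is at
  most \<open>a\<^bsub>n+1\<^esub> |z|\<^sup>n \<langle>\<sigma>\<^sup>n(1)h,h\<rangle>\<^sup>1\<^sup>/\<^sup>2\<close>, and \<open>\<langle>\<sigma>\<^sup>n(1)h,h\<rangle> \<le> sup\<^sub>m (a\<^sub>m/a\<^bsub>m+n\<^esub>) \<parallel>h\<parallel>\<^sup>2\<close> by pureness.\<close>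

lemma summable_F_ZT_adj:
  assumes z: "norm z < 1"
  shows "summable (\<lambda>n. a (Suc n) *\<^sub>R (\<Sum>\<alpha> | mabs \<alpha> = n. mgamma \<alpha> *\<^sub>R mpow z \<alpha> *\<^sub>C adj_mpow T \<alpha> h))"
proof -
  \<comment> \<open>Strictly between 0 and 1 also for \<open>z = 0\<close>, as the growth estimate
    demands.\<close>
  define q where "q = (norm z + 1) / 2"
  have q: "0 < q" "q < 1" "norm z \<le> q" using z norm_ge_zero[of z] by (auto simp: q_def field_simps simp del: norm_ge_zero)
  obtain s where s: "\<And>n. 0 \<le> s n" "\<And>m n. a m \<le> (s n)\<^sup>2 * a (m + n)"
    "summable (\<lambda>n. a (Suc n) * q ^ n * s n)"
    using ratio_growth[OF ratio_limit q(1,2)] by blast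
  have le: "norm (\<Sum>\<alpha> | mabs \<alpha> = n. mgamma \<alpha> *\<^sub>R mpow z \<alpha> *\<^sub>C adj_mpow T \<alpha> h) \<le> q ^ n * s n * norm h" for n
  proof -
    let ?A = "{\<alpha> :: nat ^ 'd. mabs \<alpha> = n}"
    have "norm (\<Sum>\<alpha>\<in>?A. mgamma \<alpha> *\<^sub>R mpow z \<alpha> *\<^sub>C adj_mpow T \<alpha> h)
        \<le> (\<Sum>\<alpha>\<in>?A. norm (mgamma \<alpha> *\<^sub>R mpow z \<alpha> *\<^sub>C adj_mpow T \<alpha> h))"
      by (rule norm_sum)
    also have "\<dots> = (\<Sum>\<alpha>\<in>?A. (sqrt (mgamma \<alpha>) * cmod (mpow z \<alpha>)) * (sqrt (mgamma \<alpha>) * norm (adj_mpow T \<alpha> h)))"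
    proof (rule sum.cong[OF refl])
      fix \<alpha> :: "nat ^ 'd"
      define \<sigma> where "\<sigma> = sqrt (mgamma \<alpha>)"
      have "mgamma \<alpha> = \<sigma> * \<sigma>" by (simp add: \<sigma>_def less_imp_le)
      then show "norm (mgamma \<alpha> *\<^sub>R mpow z \<alpha> *\<^sub>C adj_mpow T \<alpha> h)
          = (sqrt (mgamma \<alpha>) * cmod (mpow z \<alpha>)) * (sqrt (mgamma \<alpha>) * norm (adj_mpow T \<alpha> h))"
        unfolding norm_scaleR norm_scaleC abs_of_pos[OF mgamma_pos] \<sigma>_def[symmetric] by simp
    qed
    finally have 1: "norm (\<Sum>\<alpha>\<in>?A. mgamma \<alpha> *\<^sub>R mpow z \<alpha> *\<^sub>C adj_mpow T \<alpha> h)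
        \<le> (\<Sum>\<alpha>\<in>?A. (sqrt (mgamma \<alpha>) * cmod (mpow z \<alpha>)) * (sqrt (mgamma \<alpha>) * norm (adj_mpow T \<alpha> h)))" (is "?N \<le> ?S") .
    have "?S\<^sup>2 \<le> (\<Sum>\<alpha>\<in>?A. (sqrt (mgamma \<alpha>) * cmod (mpow z \<alpha>))\<^sup>2) * (\<Sum>\<alpha>\<in>?A. (sqrt (mgamma \<alpha>) * norm (adj_mpow T \<alpha> h))\<^sup>2)"
      by (rule Cauchy_Schwarz_ineq_sum)
    also have "\<dots> = norm z ^ (2 * n) * (\<Sum>\<alpha>\<in>?A. mgamma \<alpha> * (norm (adj_mpow T \<alpha> h))\<^sup>2)"
      unfolding sum_mpow_level[symmetric] power_mult_distrib by (simp add: less_imp_le)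
    also have "\<dots> \<le> q ^ (2 * n) * ((s n)\<^sup>2 * (norm h)\<^sup>2)"
      by (intro mult_mono power_mono q sum_norm_adj_mpow_le s sum_nonneg mult_nonneg_nonneg)
        (use q in \<open>auto simp: less_imp_le\<close>)
    also have "\<dots> = (q ^ n * s n * norm h)\<^sup>2"
      by (simp add: power_mult_distrib power_mult[symmetric] mult.commute)
    finally have "?S \<le> q ^ n * s n * norm h"
      by (rule power2_le_imp_le) (use q s in auto)
    with 1 show ?thesis by (rule order_trans)
  qed
  show ?thesis
  proof (rule summable_comparison_test)
    show "summable (\<lambda>n. a (Suc n) * q ^ n * s n * norm h)"
      by (rule summable_mult2[OF s(3)])
    have "norm (a (Suc n) *\<^sub>R (\<Sum>\<alpha> | mabs \<alpha> = n. mgamma \<alpha> *\<^sub>R mpow z \<alpha> *\<^sub>C adj_mpow T \<alpha> h))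
        \<le> a (Suc n) * q ^ n * s n * norm h" for n
      unfolding norm_scaleR abs_of_pos[OF a_pos]
      using mult_left_mono[OF le less_imp_le[OF a_pos], of "Suc n" n] by (simp add: mult.assoc)
    then show "\<exists>N. \<forall>n\<ge>N. norm (a (Suc n) *\<^sub>R (\<Sum>\<alpha> | mabs \<alpha> = n. mgamma \<alpha> *\<^sub>R mpow z \<alpha> *\<^sub>C adj_mpow T \<alpha> h))
        \<le> a (Suc n) * q ^ n * s n * norm h" by blast
  qed
qed

text \<open>The backward shifts determine all coefficients but the constant one. Grouping the others
  by a removed unit index, with the weights of the index shift, reassembles the series of F at
  ZT*.\<close>

lemma power_series_lift:
  assumes v: "hk_summable a v" and x: "\<And>i. shift_down a i v = dil (x $ i)"
  shows "power_series v = on_ball (\<lambda>z. v 0 + C (F_ZT_adj a T z (Z_row z x)))"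
proof
  fix z :: "complex ^ 'd"
  show "power_series v z = on_ball (\<lambda>z. v 0 + C (F_ZT_adj a T z (Z_row z x))) z"
  proof (cases "norm z < 1")
    case True
    \<comment> \<open>The term at \<alpha> in the multi-index expansion of
      \<open>C (F_ZT_adj a T z h)\<close>; linearity in \<open>h\<close> turns the sum over
      \<open>i\<close> into \<open>Z_row z x\<close>.\<close>
    define G where "G \<alpha> h = (a (Suc (mabs \<alpha>)) * mgamma \<alpha>) *\<^sub>R mpow z \<alpha> *\<^sub>C C (adj_mpow T \<alpha> h)" for \<alpha> h
    have v_shift: "v (\<alpha> + munit i) = weight (\<alpha> + munit i) *\<^sub>R C (adj_mpow T \<alpha> (x $ i))" for \<alpha> i
      using fun_cong[OF x[of i], of \<alpha>] unfolding dil_def shift_down_eq_iff .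
    have term_eq: "(real (Suc (\<alpha> $ i)) / real (Suc (mabs \<alpha>))) *\<^sub>R (mpow z (\<alpha> + munit i) *\<^sub>C v (\<alpha> + munit i))
        = z $ i *\<^sub>C G \<alpha> (x $ i)" for \<alpha> i
    proof -
      have "real (Suc (\<alpha> $ i)) / real (Suc (mabs \<alpha>)) * weight (\<alpha> + munit i) = a (Suc (mabs \<alpha>)) * mgamma \<alpha>"
        unfolding weight_munit by (simp del: of_nat_Suc)
      then show ?thesis
        unfolding v_shift mpow_add_munit G_def
        by (simp only: scaleC_scaleR_commute scaleC_scaleC scaleR_scaleR)
    qed
    note shift = infsum_multiindex_shift[OF abs_summable_power_series[OF True v], unfolded term_eq]
    have G_row: "(\<Sum>i\<in>UNIV. z $ i *\<^sub>C G \<alpha> (x $ i)) = G \<alpha> (Z_row z x)" for \<alpha>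
      unfolding G_def Z_row_def clinear_sum[OF bounded_clinear_adj_mpow] clinear_scaleC[OF bounded_clinear_adj_mpow]
        clinear_sum[OF bounded_clinear_C] clinear_scaleC[OF bounded_clinear_C] scaleC_sum_right scaleR_sum_right
      by (simp only: scaleC_scaleR_commute scaleC_scaleC mult.commute)
    \<comment> \<open>The unconditional sum, known from \<open>v\<close>, is regrouped by levels in
      order to meet the series that defines \<open>F_ZT_adj\<close>.\<close>
    have "((\<lambda>\<alpha>. \<Sum>i\<in>UNIV. z $ i *\<^sub>C G \<alpha> (x $ i)) has_sum (\<Sum>i\<in>UNIV. infsum (\<lambda>\<alpha>. z $ i *\<^sub>C G \<alpha> (x $ i)) UNIV)) UNIV"
      by (rule has_sum_sum_index) (rule has_sum_infsum[OF shift(1)])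
    then have "((\<lambda>\<alpha>. G \<alpha> (Z_row z x)) has_sum (\<Sum>i\<in>UNIV. infsum (\<lambda>\<alpha>. z $ i *\<^sub>C G \<alpha> (x $ i)) UNIV)) UNIV"
      unfolding G_row .
    from has_sum_imp_sums[OF has_sum_levels[OF this]]
    have 1: "(\<lambda>n. \<Sum>\<alpha> | mabs \<alpha> = n. G \<alpha> (Z_row z x)) sums (\<Sum>i\<in>UNIV. infsum (\<lambda>\<alpha>. z $ i *\<^sub>C G \<alpha> (x $ i)) UNIV)" .
    have "(\<lambda>n. C (a (Suc n) *\<^sub>R (\<Sum>\<alpha> | mabs \<alpha> = n. mgamma \<alpha> *\<^sub>R mpow z \<alpha> *\<^sub>C adj_mpow T \<alpha> (Z_row z x))))
        sums C (F_ZT_adj a T z (Z_row z x))"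
      unfolding F_ZT_adj_def
      by (rule bounded_linear.sums[OF bounded_clinear_imp_bounded_linear[OF bounded_clinear_C]
            summable_sums[OF summable_F_ZT_adj[OF True]]])
    also have "(\<lambda>n. C (a (Suc n) *\<^sub>R (\<Sum>\<alpha> | mabs \<alpha> = n. mgamma \<alpha> *\<^sub>R mpow z \<alpha> *\<^sub>C adj_mpow T \<alpha> (Z_row z x))))
        = (\<lambda>n. \<Sum>\<alpha> | mabs \<alpha> = n. G \<alpha> (Z_row z x))"
      unfolding G_def clinear_scaleR[OF bounded_clinear_C] clinear_sum[OF bounded_clinear_C]
        clinear_scaleC[OF bounded_clinear_C] scaleR_sum_right scaleR_scaleR
      by (intro ext sum.cong) auto
    finally have "C (F_ZT_adj a T z (Z_row z x)) = (\<Sum>i\<in>UNIV. infsum (\<lambda>\<alpha>. z $ i *\<^sub>C G \<alpha> (x $ i)) UNIV)"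
      using 1 by (rule sums_unique2)
    then show ?thesis
      using shift(2) True by (simp add: power_series_def on_ball_def)
  qed (simp add: power_series_def on_ball_def)
qed

lemma T_tilde_mem_E: "y \<in> D_T_tilde_space a c T \<Longrightarrow> T' y \<in> E"
  unfolding D_T_tilde_space_def defect_space_def
  by (rule closure_range_intertwine[where A = D and A' = C, OF bounded_clinear_T_tilde T_tilde_D])

lemma T_col_mem_closure: "x \<in> E \<Longrightarrow> T_col x \<in> D_T_tilde_space a c T"
  unfolding D_T_tilde_space_def defect_space_def
  by (rule closure_range_intertwine[where A = C and A' = D, OF bounded_clinear_T_col T_col_C])

lemma D_T_tilde_space_diff:
  assumes "x \<in> D_T_tilde_space a c T" "y \<in> D_T_tilde_space a c T"
  shows "x - y \<in> D_T_tilde_space a c T"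
  using assms unfolding D_T_tilde_space_def by (rule closure_range_diff[OF bounded_clinear_D])

text \<open>Membership in W(M) on coefficients: the dilations \<open>dil (x $ i)\<close> encode
  orthogonality to the z_i-multiples of M, the last equation orthogonality to the range of the
  dilation.\<close>

definition wandering_coeffs :: "(nat ^ 'd \<Rightarrow> 'h) \<Rightarrow> bool"
  where "wandering_coeffs v \<longleftrightarrow> hk_summable a v \<and> (\<forall>\<alpha>. v \<alpha> \<in> E) \<and>
    (\<exists>x. (\<forall>i. shift_down a i v = dil (x $ i)) \<and> C (v 0) + T' x = 0)"

lemma mult_coord_adj_eq:
  "hk_summable a v \<Longrightarrow> (\<And>\<alpha>. v \<alpha> \<in> E) \<Longrightarrow>
    mult_coord_adj a E i (power_series v) = power_series (shift_down a i v)"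
  by (rule mult_coord_adj_power_series[OF E_zero E_diff E_scaleC])

text \<open>The preimage of \<open>v\<close> is given by the inverse of the block operator \<open>(-T', C; D, T'\<^sup>*)\<close>.\<close>

lemma wandering_coeffs_imp_W_T:
  assumes "wandering_coeffs v"
  shows "\<exists>y\<in>D_tilde_space a c T. power_series v = on_ball (\<lambda>z. W_T a c T z y)"
proof -
  obtain x where v: "hk_summable a v" "\<And>\<alpha>. v \<alpha> \<in> E" and x: "\<And>i. shift_down a i v = dil (x $ i)"
    and zero: "C (v 0) + T' x = 0"
    using assms unfolding wandering_coeffs_def by blast
  define y where "y = D x - T_col (v 0)"
  have "T' y = C (T' x) - (v 0 - C (C (v 0)))"
    by (simp add: y_def clinear_diff[OF bounded_clinear_T_tilde] T_tilde_D T_tilde_T_col)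
  also have "\<dots> = C (C (v 0) + T' x) - v 0"
    by (simp add: clinear_add[OF bounded_clinear_C])
  finally have T'y: "- T' y = v 0" by (simp add: zero clinear_zero[OF bounded_clinear_C])
  have "D y = x - T_col (C (v 0) + T' x)"
    by (simp add: y_def clinear_diff[OF bounded_clinear_D] D_D T_col_C[symmetric] clinear_add[OF bounded_clinear_T_col])
  then have Dy: "D y = x" by (simp add: zero clinear_zero[OF bounded_clinear_T_col])
  \<comment> \<open>Here it matters that \<open>v 0\<close> lies in the defect space:
    \<open>T_col\<close> maps that space into the closed range of \<open>D\<close>.\<close>
  have "y \<in> D_T_tilde_space a c T"
    unfolding y_def
    by (intro D_T_tilde_space_diff T_col_mem_closure v) (simp add: D_T_tilde_space_def closure_subset[THEN subsetD])
  moreover have "power_series v \<in> HK a E" using v by (auto simp: HK_def)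
  moreover have "dilation a c T (D y $ i) = mult_coord_adj a E i (power_series v)" for i
    by (simp add: mult_coord_adj_eq v x Dy dilation_eq)
  ultimately have "y \<in> D_tilde_space a c T" unfolding D_tilde_space_def by blast
  moreover have "power_series v = on_ball (\<lambda>z. W_T a c T z y)"
    unfolding W_T_def T'y Dy by (rule power_series_lift[OF v(1) x])
  ultimately show ?thesis by blast
qed

text \<open>The witness in \<open>D_tilde_space\<close> has the right backward shifts but an
  arbitrary constant term. Backward shifts never read the coefficient at 0, so it may be replaced by
  \<open>- T' y\<close>.\<close>

lemma W_T_wandering_coeffs:
  assumes "y \<in> D_tilde_space a c T"
  obtains v where "wandering_coeffs v" "on_ball (\<lambda>z. W_T a c T z y) = power_series v"
    "hk_norm a (power_series v) = tnorm_d a c T y"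
proof -
  from assms obtain f where y: "y \<in> D_T_tilde_space a c T" and f: "f \<in> HK a E"
    and adj: "\<And>i. dilation a c T (D y $ i) = mult_coord_adj a E i f"
    unfolding D_tilde_space_def by blast
  then obtain u where u: "f = power_series u" "hk_summable a u" "\<And>\<alpha>. u \<alpha> \<in> E"
    by (auto simp: HK_def)
  define v where "v \<alpha> = (if \<alpha> = 0 then - T' y else u \<alpha>)" for \<alpha>
  have "hk_summable a (\<lambda>\<alpha>. if \<alpha> = 0 then - T' y - u 0 else 0)"
    by (rule hk_summable_finite, rule finite_subset[of _ "{0}"]) auto
  from hk_summable_add[OF u(2) this] have "hk_summable a (\<lambda>\<alpha>. u \<alpha> + (if \<alpha> = 0 then - T' y - u 0 else 0))" .
  also have "(\<lambda>\<alpha>. u \<alpha> + (if \<alpha> = 0 then - T' y - u 0 else 0)) = v"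
    by (auto simp: v_def)
  finally have v: "hk_summable a v" .
  have "- T' y \<in> E" using E_diff[OF E_zero T_tilde_mem_E[OF y]] by simp
  then have vE: "v \<alpha> \<in> E" for \<alpha> using u(3) by (simp add: v_def)
  have "shift_down a i v = shift_down a i u" for i
    unfolding shift_down_def v_def by (auto simp: fun_eq_iff vec_eq_iff)
  moreover have "power_series (shift_down a i u) = power_series (dil (D y $ i))" for i
    using adj[of i] unfolding u(1) dilation_eq mult_coord_adj_eq[OF u(2,3)] ..
  ultimately have x: "shift_down a i v = dil (D y $ i)" for i
    using power_series_inject[OF hk_summable_shift_down[OF u(2)] hk_summable_dil] by simp
  have v0: "v 0 = - T' y" by (simp add: v_def)
  have "C (v 0) + T' (D y) = 0"
    by (simp add: v0 T_tilde_D clinear_minus[OF bounded_clinear_C])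
  then have "wandering_coeffs v" using v vE x unfolding wandering_coeffs_def by blast
  moreover have "on_ball (\<lambda>z. W_T a c T z y) = power_series v"
    unfolding power_series_lift[OF v x] v0 W_T_def ..
  \<comment> \<open>The squared length of \<open>D y\<close> is that of \<open>y\<close> minus that
    of \<open>T' y\<close>, and the constant term contributes exactly the latter.\<close>
  moreover have "coeff_inner a v v = tinner_d a c T y y"
  proof -
    have "tinner_d a c T (D y) (D y) = tinner_d a c T y (y - T_col (T' y))"
      using td.positive_op_hermitian[OF positive_D, of y "D y"] by (simp add: D_D)
    then have "tinner_d a c T (D y) (D y) = tinner_d a c T y y - cinner (T' y) (T' y)"
      by (simp add: td.diff_right cinner_T_tilde)
    then show ?thesis
      unfolding coeff_inner_lift(2)[OF v x] v0 by (simp add: cinner.minus_left cinner.minus_right)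
  qed
  then have "hk_norm a (power_series v) = tnorm_d a c T y"
    by (simp add: hk_norm_power_series[OF v] tnorm_d_def)
  ultimately show ?thesis using that by blast
qed

subsection \<open>The wandering subspace\<close>

abbreviation "M \<equiv> ominus (hk_inner a) (HK a E) (range (dilation a c T))"

lemma mem_M_iff:
  "f \<in> M \<longleftrightarrow> (\<exists>v. f = power_series v \<and> hk_summable a v \<and> (\<forall>\<alpha>. v \<alpha> \<in> E) \<and> (\<forall>h. coeff_inner a v (dil h) = 0))"
  unfolding ominus_def HK_def dilation_eq
  by (auto simp: hk_inner_power_series hk_summable_dil)

text \<open>Orthogonality of f to the z_i-multiples of M says that the i-th backward shift of f is
  orthogonal to M, hence equal to its projection onto the range of the dilation.\<close>

lemma wandering_iff: "f \<in> wandering a M \<longleftrightarrow> (\<exists>v. f = power_series v \<and> wandering_coeffs v)"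
proof
  assume "f \<in> wandering a M"
  then have fM: "f \<in> M" and orth: "\<And>g. (\<And>i. g i \<in> M) \<Longrightarrow> hk_inner a f (\<lambda>z. \<Sum>i\<in>UNIV. mult_coord i (g i) z) = 0"
    unfolding wandering_def ominus_def[of _ M] by blast+
  obtain v where v: "f = power_series v" "hk_summable a v" "\<And>\<alpha>. v \<alpha> \<in> E" "\<And>h. coeff_inner a v (dil h) = 0"
    using fM unfolding mem_M_iff by blast
  have "shift_down a i v = dil (dil_adj (shift_down a i v))" for i
  proof -
    define s where "s = shift_down a i v"
    have s: "hk_summable a s" unfolding s_def by (rule hk_summable_shift_down[OF v(2)])
    \<comment> \<open>The component of \<open>s\<close> in M. It is orthogonal to the dilation part
      by construction and to \<open>s\<close> by the assumption on \<open>f\<close>, so it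
      vanishes.\<close>
    define d where "d = (\<lambda>\<alpha>. s \<alpha> - dil (dil_adj s) \<alpha>)"
    have d: "hk_summable a d" unfolding d_def by (intro hk_summable_diff s hk_summable_dil)
    have "s \<alpha> \<in> E" for \<alpha> unfolding s_def shift_down_def by (intro E_scaleR v)
    then have dE: "d \<alpha> \<in> E" for \<alpha> unfolding d_def by (intro E_diff dil_mem_E)
    have "coeff_inner a s (dil h) = cinner (dil_adj s) h" for h
      using dil_adj[OF s, of h] coeff_inner_commute[of s "dil h"] cinner_commute[of "dil_adj s" h] by simp
    then have d_orth: "coeff_inner a d (dil h) = 0" for h
      unfolding d_def coeff_inner_diff_left[OF s hk_summable_dil hk_summable_dil] by (simp add: coeff_inner_dil)
    have dM: "power_series d \<in> M" unfolding mem_M_iff using d dE d_orth by blast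
    have zM: "(\<lambda>z. 0) \<in> M" unfolding mem_M_iff
      by (intro exI[of _ "\<lambda>\<alpha>. 0"]) (simp add: power_series_zero hk_summable_zero E_zero coeff_inner_def)
    \<comment> \<open>The wandering condition tests against full row sums; a tuple with a single
      non-zero entry isolates the index \<open>i\<close>.\<close>
    define g where "g k = (if k = i then power_series d else (\<lambda>z. 0))" for k
    have "(\<lambda>z. \<Sum>k\<in>UNIV. mult_coord k (g k) z) = mult_coord i (power_series d)"
    proof
      fix z
      have "(\<Sum>k\<in>UNIV. mult_coord k (g k) z) = (\<Sum>k\<in>UNIV. if k = i then mult_coord i (power_series d) z else 0)"
        by (rule sum.cong) (auto simp: g_def mult_coord_def)
      then show "(\<Sum>k\<in>UNIV. mult_coord k (g k) z) = mult_coord i (power_series d) z" by simp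
    qed
    then have "hk_inner a f (mult_coord i (power_series d)) = 0"
      using orth[of g] dM zM by (simp add: g_def)
    then have "coeff_inner a v (shift_up i d) = 0"
      by (simp add: v mult_coord_power_series hk_inner_power_series hk_summable_shift_up d)
    then have "coeff_inner a s d = 0"
      using coeff_inner_shift[of i d v] coeff_inner_commute[of v "shift_up i d"] coeff_inner_commute[of s d]
      unfolding s_def by simp
    moreover have "coeff_inner a (dil (dil_adj s)) d = 0"
      using d_orth[of "dil_adj s"] coeff_inner_commute[of "dil (dil_adj s)" d] by simp
    ultimately have "coeff_inner a d d = 0"
      using coeff_inner_diff_left[OF s hk_summable_dil[of "dil_adj s"] d] unfolding d_def[symmetric] by simp
    from coeff_inner_self_eq_zero[OF d this] have "s = dil (dil_adj s)"
      unfolding d_def by (simp add: fun_eq_iff)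
    then show ?thesis unfolding s_def .
  qed
  then have x: "shift_down a i v = dil ((\<chi> i. dil_adj (shift_down a i v)) $ i)" for i by simp
  have "cinner (C (v 0) + T' (\<chi> i. dil_adj (shift_down a i v))) h = cinner 0 h" for h
    using coeff_inner_lift(1)[OF v(2) x, of h] v(4)[of h] by simp
  then have "C (v 0) + T' (\<chi> i. dil_adj (shift_down a i v)) = 0" by (rule cinner_eqI_left)
  then have "wandering_coeffs v" unfolding wandering_coeffs_def using v x by blast
  then show "\<exists>v. f = power_series v \<and> wandering_coeffs v" using v by blast
next
  assume "\<exists>v. f = power_series v \<and> wandering_coeffs v"
  then obtain v x where f: "f = power_series v" and v: "hk_summable a v" "\<And>\<alpha>. v \<alpha> \<in> E"
    and x: "\<And>i. shift_down a i v = dil (x $ i)" and zero: "C (v 0) + T' x = 0"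
    unfolding wandering_coeffs_def by blast
  have "f \<in> M"
    unfolding mem_M_iff using f v coeff_inner_lift(1)[OF v(1) x] zero by auto
  moreover have "hk_inner a f (\<lambda>z. \<Sum>i\<in>UNIV. mult_coord i (g i) z) = 0" if "\<And>i. g i \<in> M" for g
  proof -
    have "\<forall>i. \<exists>u. g i = power_series u \<and> hk_summable a u \<and> (\<forall>h. coeff_inner a u (dil h) = 0)"
      using that unfolding mem_M_iff by blast
    then obtain u where u: "\<And>i. g i = power_series (u i)" "\<And>i. hk_summable a (u i)"
      "\<And>i h. coeff_inner a (u i) (dil h) = 0" by metis
    have "(\<lambda>z. \<Sum>i\<in>UNIV. mult_coord i (g i) z) = power_series (\<lambda>\<alpha>. \<Sum>i\<in>UNIV. shift_up i (u i) \<alpha>)"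
      by (rule ext) (simp add: power_series_sum hk_summable_shift_up u mult_coord_power_series)
    moreover have "coeff_inner a v (shift_up i (u i)) = 0" for i
      using coeff_inner_commute[of v "shift_up i (u i)"] by (simp add: coeff_inner_shift x u)
    ultimately show ?thesis
      by (simp add: f hk_inner_power_series v hk_summable_sum hk_summable_shift_up u coeff_inner_sum_right)
  qed
  ultimately show "f \<in> wandering a M"
    unfolding wandering_def ominus_def[of _ M] by blast
qed

lemma wandering_eq: "wandering a M = {on_ball (\<lambda>z. W_T a c T z x) | x. x \<in> D_tilde_space a c T}"
proof (intro set_eqI iffI)
  fix f assume "f \<in> wandering a M"
  then show "f \<in> {on_ball (\<lambda>z. W_T a c T z x) | x. x \<in> D_tilde_space a c T}"
    unfolding wandering_iff using wandering_coeffs_imp_W_T by blast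
next
  fix f assume "f \<in> {on_ball (\<lambda>z. W_T a c T z x) | x. x \<in> D_tilde_space a c T}"
  then show "f \<in> wandering a M"
    unfolding wandering_iff using W_T_wandering_coeffs by blast
qed

lemma hk_norm_W_T:
  "x \<in> D_tilde_space a c T \<Longrightarrow> hk_norm a (on_ball (\<lambda>z. W_T a c T z x)) = tnorm_d a c T x"
  by (metis W_T_wandering_coeffs)

end

section \<open>From the kernel function to the coefficient bounds\<close>

theorem theorem2p7:
  fixes k :: "complex \<Rightarrow> complex" and a :: "nat \<Rightarrow> real" and c :: "nat \<Rightarrow> complex" and r :: real
    and T :: "'d::finite \<Rightarrow> 'h::complex_hilbert_space \<Rightarrow> 'h"
    and M :: "(complex ^ 'd \<Rightarrow> 'h) set"
  assumes "k holomorphic_on ball 0 1"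
    and "\<And>z. z \<in> ball 0 1 \<Longrightarrow> (\<lambda>n. complex_of_real (a n) * z ^ n) sums k z"
    and "\<And>z. z \<in> ball 0 1 \<Longrightarrow> k z \<noteq> 0"
    and "a 0 = 1"
    and "\<And>n. a n > 0"
    and "0 < (INF n. a n / a (Suc n))"
    and "bdd_above (range (\<lambda>n. a n / a (Suc n)))"
    and "(\<lambda>n. a n / a (Suc n)) \<longlonglongrightarrow> r"
    and "\<And>z. z \<in> ball 0 1 \<Longrightarrow> (\<lambda>n. c n * z ^ n) sums (1 / k z)"
    and "pure_K_contraction a c T"
    and "M = ominus (hk_inner a) (HK a (defect_space c T)) (range (dilation a c T))"
  shows "wandering a M = {on_ball (\<lambda>z. W_T a c T z x) | x. x \<in> D_tilde_space a c T} \<and>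
    (\<forall>x\<in>D_tilde_space a c T.
      hk_norm a (on_ball (\<lambda>z. W_T a c T z x)) = tnorm_d a c T x)"
proof -
  \<comment> \<open>The positive infimum of the ratios bounds a_(n+1)/a_n from above, their supremum
    bounds a_n/a_(n+1).\<close>
  define b where "b = 1 / (INF n. a n / a (Suc n))"
  define B where "B = (SUP n. a n / a (Suc n))"
  have pos: "0 < a n" for n by fact
  have ratio_pos: "0 \<le> a n / a (Suc n)" for n using pos[of n] pos[of "Suc n"] by simp
  have low: "(INF n. a n / a (Suc n)) \<le> a n / a (Suc n)" for n
    by (rule cINF_lower) (use ratio_pos in \<open>auto intro!: bdd_belowI[of _ 0]\<close>)
  have "(INF n. a n / a (Suc n)) * a (Suc n) \<le> a n" for n
    using low[of n] pos[of "Suc n"] by (simp only: pos_le_divide_eq)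
  then have upper: "a (Suc n) \<le> b * a n" for n
    using assms(6) by (simp add: b_def pos_le_divide_eq mult.commute)
  have "a n / a (Suc n) \<le> B" for n
    unfolding B_def by (rule cSUP_upper) (use assms(7) in auto)
  then have lower: "a n \<le> B * a (Suc n)" for n
    using pos[of "Suc n"] by (simp add: divide_le_eq)
  have summable: "summable (\<lambda>n. a n * x ^ n)" if "0 \<le> x" "x < 1" for x
  proof -
    have "summable (\<lambda>n. complex_of_real (a n) * complex_of_real x ^ n)"
      using assms(2)[of "complex_of_real x"] that by (simp add: sums_iff)
    then have "summable (\<lambda>n. Re (complex_of_real (a n) * complex_of_real x ^ n))"
      by (rule summable_Re)
    then show ?thesis by (simp flip: of_real_power of_real_mult)
  qed
  interpret pure_contraction a b B T c r
  proof
    show "commuting_tuple T"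
      using assms(10) by (simp add: pure_K_contraction_def K_contraction_def)
  qed (use assms upper lower summable in auto)
  show ?thesis
    unfolding assms(11) using wandering_eq hk_norm_W_T by blast
qed

end
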